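(* Let $k=s+\frac12$ with $s\in\mathbb Z$, and write $s=12a+b$ with $a\in\mathbb Z$ and $b\in\{6,8,9,10,11,12,13,14,15,16,17,19\}$. There are absolute positive constants $A\le 9$ and $B\le 109$ such that the following holds. Let $m$ be an integer with $m\ge A|a|+B$ and $m\equiv 0,(-1)^{s-1}\pmod 4$, and let $\{f_{2-k,i}\}$ be the canonical basis of $M^!_{2-k}$, indexed by the admissible indices $i$ for weight $2-k$ in increasing order. Then for any integer $M>3a+\frac{3m}4+\frac b2-C$, it is impossible that the Fourier coefficients of $q^m$ in each of the first $M$ basis elements $f_{2-k,i}$ with $i\not\equiv m\pmod 4$ simultaneously vanish.
   Context: Let $q=e^{2\pi i\tau}$ and $\vartheta(\tau)=\sum_{n\in\mathbb Z}q^{n^2}$. For a weight $\kappa=t+\frac12$, $t\in\mathbb Z$, $M^!_\kappa$ is the space of holomorphic functions on the upper half plane, possibly with poles at the cusps, transforming like $\vartheta^{2\kappa}$ under $\Gamma_0(4)$ and satisfying Kohnen's plus space condition (Fourier expansion $\sum_{(-1)^tn\equiv0,1\,(4)}a(n)q^n$). Write $t=6\ell+\frac{k'}2$ with $\ell\in\mathbb Z$, $k'\in\{0,4,6,8,10,14\}$; let $N_\kappa=2\ell$ if $\ell$ is even and $N_\kappa=2\ell-(-1)^t$ if $\ell$ is odd. An integer $i$ is an admissible index for weight $\kappa$ if $i\ge -N_\kappa$ and $(-1)^{t-1}i\equiv0,1\pmod4$; for each such $i$ the canonical basis element is $f_{\kappa,i}(\tau)=q^{-i}+\sum_{n>N_\kappa,\,(-1)^tn\equiv0,1\,(4)}a_\kappa(i,n)q^n\in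 M^!_\kappa$, and these form a basis of $M^!_\kappa$. The constant $C$ is: $C=1$ if $m$ and $b$ are even; $C=\frac32$ if $m$ is even and $b$ odd; $C=\frac34$ if $m$ is odd and $b\in\{6,8,9,10,11,13\}$; $C=\frac74$ if $m$ is odd and $b\in\{12,14,15,16,17,19\}$. *)

theory Defs
  imports "HOL-Analysis.Analysis"
begin

text \<open>Weights are half-integral: the weight kappa = t + 1/2 is encoded by the integer t.\<close>

definition upper_half :: "complex set" where
  "upper_half = {\<tau>. Im \<tau> > 0}"

definition sgnpow :: "int \<Rightarrow> int" where
  "sgnpow t = (if even t then 1 else -1)"

definition theta :: "complex \<Rightarrow> complex" where
  "theta \<tau> = infsum (\<lambda>n::int. exp (2 * pi * \<i> * of_int (n^2) * \<tau>)) UNIV"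

definition moeb :: "int \<Rightarrow> int \<Rightarrow> int \<Rightarrow> int \<Rightarrow> complex \<Rightarrow> complex" where
  "moeb a b c d \<tau> = (of_int a * \<tau> + of_int b) / (of_int c * \<tau> + of_int d)"

definition Gamma0_4 :: "(int \<times> int \<times> int \<times> int) set" where
  "Gamma0_4 = {(a, b, c, d). a * d - b * c = 1 \<and> 4 dvd c}"

definition has_qexp :: "(complex \<Rightarrow> complex) \<Rightarrow> (int \<Rightarrow> complex) \<Rightarrow> bool" where
  "has_qexp f a \<longleftrightarrow>
     (\<forall>\<tau>\<in>upper_half. ((\<lambda>n::int. a n * exp (2 * pi * \<i> * of_int n * \<tau>)) has_sum f \<tau>) UNIV)"

definition plus_index :: "int \<Rightarrow> int \<Rightarrow> bool" where
  "plus_index t n \<longleftrightarrow> (sgnpow t * n) mod 4 \<in> {0, 1}"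

text \<open>The space M^!_{t+1/2}: holomorphic on the upper half plane, transforming like
  theta^(2t+1) under Gamma0(4), meromorphic at all cusps (at most exponential growth at
  every cusp, after removing the automorphy factor), plus space condition.\<close>
definition wh_plus :: "int \<Rightarrow> (complex \<Rightarrow> complex) \<Rightarrow> bool" where
  "wh_plus t f \<longleftrightarrow>
     f holomorphic_on upper_half \<and>
     (\<forall>(a, b, c, d)\<in>Gamma0_4. \<forall>\<tau>\<in>upper_half.
        f (moeb a b c d \<tau>) = (theta (moeb a b c d \<tau>) / theta \<tau>) powi (2 * t + 1) * f \<tau>) \<and>
     (\<forall>a b c d. a * d - b * c = 1 \<longrightarrow>
        (\<exists>C>0. \<forall>\<tau>. Im \<tau> \<ge> 1 \<longrightarrow>
           norm (f (moeb a b c d \<tau>))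
             \<le> C * exp (C * Im \<tau>) * norm (of_int c * \<tau> + of_int d) powr (real_of_int t + 1/2))) \<and>
     (\<exists>a. has_qexp f a \<and> (\<forall>n. \<not> plus_index t n \<longrightarrow> a n = 0))"

text \<open>t = 6 l + k'/2 with k'/2 in {0,2,3,4,5,7}.\<close>
definition ell :: "int \<Rightarrow> int" where
  "ell t = (if t mod 6 = 1 then (t - 7) div 6 else t div 6)"

definition Nk :: "int \<Rightarrow> int" where
  "Nk t = (if even (ell t) then 2 * ell t else 2 * ell t - sgnpow t)"

definition admissible :: "int \<Rightarrow> int \<Rightarrow> bool" where
  "admissible t i \<longleftrightarrow> i \<ge> - Nk t \<and> (sgnpow (t - 1) * i) mod 4 \<in> {0, 1}"

definition canon_coeff :: "int \<Rightarrow> int \<Rightarrow> int \<Rightarrow> complex" where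
  "canon_coeff t i = (THE a. a (- i) = 1 \<and>
       (\<forall>n. n \<noteq> - i \<and> n \<le> Nk t \<longrightarrow> a n = 0) \<and>
       (\<forall>n. \<not> plus_index t n \<longrightarrow> a n = 0) \<and>
       (\<exists>f. wh_plus t f \<and> has_qexp f a))"

definition firstM :: "int \<Rightarrow> int \<Rightarrow> int \<Rightarrow> int set" where
  "firstM t m M = {i. admissible t i \<and> i mod 4 \<noteq> m mod 4 \<and>
      int (card {j. admissible t j \<and> j mod 4 \<noteq> m mod 4 \<and> j < i}) < M}"

definition Cconst :: "int \<Rightarrow> int \<Rightarrow> real" where
  "Cconst m b = (if even m then (if even b then 1 else 3/2)
                 else if b \<in> {6, 8, 9, 10, 11, 13} then 3/4 else 7/4)"

end

theory Submission
  imports Defs "HOL-Complex_Analysis.Complex_Analysis" "HOL-Probability.Distributions"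
begin

text \<open>A form \<open>f\<close> in the plus space splits as \<open>F(4\<tau>) + G(4\<tau>)\<close> according to the exponents modulo 4, and \<open>(F, G)\<close> is a
  vector-valued form for the full modular group. Its Wronskian is a level one form of weight \<open>2t + 3\<close>, which bounds
  the sum of the orders of \<open>F\<close> and \<open>G\<close> at the cusp. The bound is attained: explicit polynomials in the theta
  constants divided by powers of \<open>\<eta>\<^sup>6\<close>, together with multiplication by the \<open>j\<close>-invariant, give for every \<open>u\<close> a form
  whose orders are exactly \<open>u\<close> and the complementary value. These extremal forms yield the canonical basis by
  elimination. The extremal form with leading exponent \<open>m\<close> in the residue class of \<open>m\<close> has its principal part in the
  other class, with a pole of order about \<open>m\<close>; so it is a combination of the first \<open>M\<close> admissible basis elements,
  and its coefficient at \<open>q\<^sup>m\<close> is not zero.\<close>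

section \<open>Theta constants\<close>

text \<open>\<open>canon_coeff\<close> is a definite description over \<open>wh_plus\<close>, so
  existence and uniqueness of the basis have to be proved, and the correspondence with pairs is
  needed in both directions: from \<open>wh_plus\<close> to pairs for uniqueness, and back, with
  growth at every cusp, for existence. The analytic input is the inversion formula of theta. It
  comes from the duplication formulas by way of the arithmetic-geometric mean instead of Poisson
  summation; Riemann sums of the Gaussian fix the constant. One number, \<open>lam t\<close>, is
  both the Wronskian bound for the sum of the two orders and the value attained by explicit forms;
  by \<open>Nk_lam\<close> it matches \<open>Nk t\<close>, so the elimination leaves no gap. The
  final count has room to spare: the extremal form with leading exponent m has a pole of order at
  most m + 1 - 4 \<open>ell t\<close>, so the number of basis elements below it grows like m/2,
  whereas M exceeds roughly 3m/4. The surplus m/4 absorbs the terms in a and b, which is why m has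
  to be bounded below linearly in |a|.\<close>

definition ee :: "complex \<Rightarrow> complex" where
  "ee z = exp (2 * of_real pi * \<i> * z)"

lemma ee_add: "ee (a + b) = ee a * ee b"
  by (simp add: ee_def ring_distribs exp_add)

lemma ee_0 [simp]: "ee 0 = 1"
  by (simp add: ee_def)

lemma ee_nonzero [simp]: "ee a \<noteq> 0"
  by (simp add: ee_def)

lemma ee_diff: "ee (a - b) = ee a / ee b"
  by (simp add: ee_def ring_distribs exp_diff)

lemma ee_of_nat_mult: "ee (of_nat n * a) = ee a ^ n"
  by (simp add: ee_def exp_of_nat_mult[symmetric] mult_ac)

lemma ee_of_int_mult: "ee (of_int n * a) = ee a powi n"
  unfolding ee_def exp_power_int by (rule arg_cong[of _ _ exp]) (simp only: mult_ac)

lemma ee_1 [simp]: "ee 1 = 1"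
  by (simp add: ee_def exp_two_pi_i)

lemma ee_of_int [simp]: "ee (of_int n) = 1"
  using ee_of_int_mult[of n 1] by simp

lemma ee_half: "ee (1/2) = -1"
  by (simp add: ee_def exp_pi_i')

lemma ee_quarter: "ee (1/4) = \<i>"
proof -
  have "2 * of_real pi * \<i> * (1/4) = \<i> * of_real (pi/2)" by simp
  then show ?thesis unfolding ee_def by (metis cis_conv_exp cis_pi_half)
qed

lemma norm_ee: "norm (ee z) = exp (- 2 * pi * Im z)"
  by (simp add: ee_def norm_exp_eq_Re)

lemma ee_in_ball: "\<tau> \<in> upper_half \<Longrightarrow> ee \<tau> \<in> ball 0 1"
  by (simp add: norm_ee upper_half_def)

text \<open>Lets an identity in \<tau> be read on the punctured disc: what is known of h (ee \<tau>)
  for all \<tau> is known of h away from 0.\<close>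

lemma ee_surj_ball:
  assumes "w \<in> ball 0 1" "w \<noteq> 0"
  obtains \<tau> where "\<tau> \<in> upper_half" "ee \<tau> = w"
proof -
  define \<tau> where "\<tau> = Ln w / (2 * of_real pi * \<i>)"
  have e: "ee \<tau> = w" using assms by (simp add: ee_def \<tau>_def)
  then have "exp (- 2 * pi * Im \<tau>) < 1" using assms norm_ee[of \<tau>] by simp
  then have "Im \<tau> > 0" by (simp add: zero_less_mult_iff)
  then show ?thesis using e that by (auto simp: upper_half_def)
qed

section \<open>Theta series as power series in q\<close>

lemma lacunary_series:
  fixes e :: "nat \<Rightarrow> nat"
  assumes e: "\<And>k. e k \<ge> k"
  obtains h where "h holomorphic_on ball 0 1"
    "\<And>w. w \<in> ball 0 1 \<Longrightarrow> ((\<lambda>k. w ^ e k) has_sum h w) UNIV"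
    "h 0 = (if e 0 = 0 then 1 else (0::complex))"
proof -
  have bd: "norm (w ^ e k) \<le> norm w ^ k" if "w \<in> ball 0 1" for w :: complex and k
    using that e[of k] by (simp add: norm_power power_decreasing)
  obtain g where g: "\<forall>x\<in>ball 0 1. ((\<lambda>k. x ^ e k) sums g x) \<and> g field_differentiable (at (x::complex))"
  proof (rule series_differentiable_comparison_complex[of "ball 0 1" "\<lambda>k x. x ^ e k"])
    fix x :: complex assume x: "x \<in> ball 0 1"
    \<comment> \<open>A radius strictly between |x| and 1: near x all terms are dominated by the
      geometric series of r, because \<open>e k \<ge> k\<close>.\<close>
    define r where "r = (1 + norm x) / 2"
    have r: "norm x < r" "r < 1" "0 < r" using x by (auto simp: r_def add_pos_nonneg)
    have "norm (y ^ e k) \<le> norm (of_real (r ^ k) :: complex)" if "y \<in> ball x (r - norm x)" for y k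
    proof -
      have "norm y < r" using that norm_triangle_ineq2[of y x] by (simp add: dist_norm norm_minus_commute)
      then have "norm (y ^ e k) \<le> norm y ^ k" using r by (intro bd) auto
      also have "\<dots> \<le> r ^ k" using \<open>norm y < r\<close> by (intro power_mono) auto
      finally show ?thesis using r by (simp add: norm_power)
    qed
    then have *: "\<forall>\<^sub>F n in sequentially. \<forall>y\<in>ball x (r - norm x) \<inter> ball 0 1.
        norm (y ^ e n) \<le> norm (of_real (r ^ n) :: complex)"
      by (intro always_eventually) blast
    have "summable (\<lambda>k. of_real (r ^ k) :: complex)"
      using r by (intro summable_of_real summable_geometric) simp
    moreover have "range (\<lambda>k. of_real (r ^ k) :: complex) \<subseteq> \<real>\<^sub>\<ge>\<^sub>0"
      using r by (auto simp del: of_real_power simp: nonneg_Reals_of_real_iff)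
    ultimately show "\<exists>d h. 0 < d \<and> summable h \<and> range h \<subseteq> \<real>\<^sub>\<ge>\<^sub>0 \<and>
        (\<forall>\<^sub>F n in sequentially. \<forall>y\<in>ball x d \<inter> ball 0 1. norm (y ^ e n) \<le> norm (h n :: complex))"
      using r(1) * by (intro exI[of _ "r - norm x"] exI[of _ "\<lambda>k. of_real (r ^ k)"] conjI) simp_all
  next
    show "(\<lambda>x::complex. x ^ e n) field_differentiable at x" for n x
      by (intro field_differentiable_power field_differentiable_ident)
  qed simp_all
  then have g: "\<And>x. x \<in> ball 0 1 \<Longrightarrow> (\<lambda>k. x ^ e k) sums g x"
      "\<And>x. x \<in> ball 0 1 \<Longrightarrow> g field_differentiable (at (x::complex))" by blast+
  show thesis
  proof
    show "g holomorphic_on ball 0 1"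
      using g(2) by (auto simp: holomorphic_on_def intro: field_differentiable_at_within)
    show "((\<lambda>k. w ^ e k) has_sum g w) UNIV" if w: "w \<in> ball 0 1" for w
    proof (rule norm_summable_imp_has_sum)
      show "summable (\<lambda>k. norm (w ^ e k))"
        by (rule summable_comparison_test'[OF summable_geometric[of "norm w"]]) (use w bd in auto)
    qed (use g w in auto)
    \<comment> \<open>At 0 only the term k = 0 can survive, and it does so exactly when
      \<open>e 0 = 0\<close>, through 0 ^ 0 = 1.\<close>
    have "(\<lambda>k. (0::complex) ^ e k) sums (\<Sum>k\<in>{0}. 0 ^ e k)"
    proof (rule sums_finite)
      fix k assume "k \<notin> {0::nat}"
      then have "e k > 0" using e[of k] by simp
      then show "(0::complex) ^ e k = 0" by simp
    qed simp
    then have "g 0 = (\<Sum>k\<in>{0}. 0 ^ e k)"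
      using g(1)[of 0] by (intro sums_unique2[of "\<lambda>k. 0 ^ e k"]) auto
    then show "g 0 = (if e 0 = 0 then 1 else 0)" by simp
  qed
qed

text \<open>The reflection n -> -1 - n is the one that preserves (n + 1/2)^2, so the two halves of
  the series \<open>theta1\<close> coincide.\<close>

lemma has_sum_int_split:
  fixes f :: "int \<Rightarrow> complex"
  assumes "((\<lambda>k. f (int k)) has_sum A) UNIV" "((\<lambda>k. f (- 1 - int k)) has_sum B) UNIV"
  shows "(f has_sum (A + B)) UNIV"
proof -
  have 1: "(f has_sum A) (range int)"
    using assms(1) by (subst has_sum_reindex) (auto simp: o_def)
  have 2: "(f has_sum B) (range (\<lambda>k. - 1 - int k))"
    using assms(2) by (subst has_sum_reindex) (auto simp: o_def inj_on_def)
  have "UNIV = range int \<union> range (\<lambda>k. - 1 - int k)"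
  proof (intro set_eqI iffI UNIV_I)
    fix n :: int
    show "n \<in> range int \<union> range (\<lambda>k. - 1 - int k)"
    proof (cases "n \<ge> 0")
      case True
      then have "n = int (nat n)" by simp
      then show ?thesis by blast
    next
      case False
      then have "n = - 1 - int (nat (- 1 - n))" by simp
      then show ?thesis by blast
    qed
  qed
  moreover have "range int \<inter> range (\<lambda>k. - 1 - int k) = {}" by auto
  ultimately show ?thesis using has_sum_Un_disjoint[OF 1 2] by simp
qed

text \<open>In Jacobi's notation \<open>theta \<tau> = \<theta>\<^sub>3(2\<tau>)\<close> and \<open>theta1 \<tau> = \<theta>\<^sub>2(2\<tau>)\<close>.\<close>

definition theta1 :: "complex \<Rightarrow> complex" where
  "theta1 \<tau> = infsum (\<lambda>n::int. ee ((of_int n + 1/2)\<^sup>2 * \<tau>)) UNIV"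

lemma theta_qseries:
  obtains h where "h holomorphic_on ball 0 1" "h 0 = 1"
    "\<And>\<tau>. \<tau> \<in> upper_half \<Longrightarrow> theta \<tau> = h (ee \<tau>)"
    "\<And>\<tau>. \<tau> \<in> upper_half \<Longrightarrow> ((\<lambda>n::int. ee ((of_int n)\<^sup>2 * \<tau>)) has_sum theta \<tau>) UNIV"
proof -
  obtain h1 where h1: "h1 holomorphic_on ball 0 1"
    "\<And>w. w \<in> ball 0 1 \<Longrightarrow> ((\<lambda>k. w ^ (k * k)) has_sum h1 w) UNIV" "h1 0 = (1::complex)"
    using lacunary_series[of "\<lambda>k. k * k"] by auto
  obtain h2 where h2: "h2 holomorphic_on ball 0 1"
    "\<And>w. w \<in> ball 0 1 \<Longrightarrow> ((\<lambda>k. w ^ ((k + 1) * (k + 1))) has_sum h2 w) UNIV" "h2 0 = (0::complex)"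
    using lacunary_series[of "\<lambda>k. (k + 1) * (k + 1)"] by auto
  have hs: "((\<lambda>n::int. ee ((of_int n)\<^sup>2 * \<tau>)) has_sum (h1 (ee \<tau>) + h2 (ee \<tau>))) UNIV"
    if "\<tau> \<in> upper_half" for \<tau>
  proof (rule has_sum_int_split)
    have "ee ((of_int (int k))\<^sup>2 * \<tau>) = ee \<tau> ^ (k * k)" for k
      using ee_of_nat_mult[of "k * k" \<tau>] by (simp add: power2_eq_square)
    then show "((\<lambda>k. ee ((of_int (int k))\<^sup>2 * \<tau>)) has_sum h1 (ee \<tau>)) UNIV"
      using h1(2)[OF ee_in_ball[OF that]] by simp
    have "ee ((of_int (- 1 - int k))\<^sup>2 * \<tau>) = ee \<tau> ^ ((k + 1) * (k + 1))" for k
      using ee_of_nat_mult[of "(k + 1) * (k + 1)" \<tau>] by (simp add: power2_eq_square algebra_simps)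
    then show "((\<lambda>k. ee ((of_int (- 1 - int k))\<^sup>2 * \<tau>)) has_sum h2 (ee \<tau>)) UNIV"
      using h2(2)[OF ee_in_ball[OF that]] by simp
  qed
  have th: "theta \<tau> = h1 (ee \<tau>) + h2 (ee \<tau>)" if "\<tau> \<in> upper_half" for \<tau>
    using hs[OF that] unfolding theta_def ee_def by (intro infsumI) (simp add: mult_ac)
  show thesis
    by (rule that[of "\<lambda>w. h1 w + h2 w"]) (use h1 h2 hs th in \<open>auto intro!: holomorphic_intros\<close>)
qed

text \<open>As (n + 1/2)^2 = n (n + 1) + 1/4, a factor q^(1/4) splits off and a series in q remains;
  its two equal halves explain the value 2 at 0.\<close>

lemma theta1_qseries:
  obtains h where "h holomorphic_on ball 0 1" "h 0 = 2"
    "\<And>\<tau>. \<tau> \<in> upper_half \<Longrightarrow> theta1 \<tau> = ee (\<tau> / 4) * h (ee \<tau>)"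
    "\<And>\<tau>. \<tau> \<in> upper_half \<Longrightarrow> ((\<lambda>n::int. ee ((of_int n + 1/2)\<^sup>2 * \<tau>)) has_sum theta1 \<tau>) UNIV"
proof -
  obtain h1 where h1: "h1 holomorphic_on ball 0 1"
    "\<And>w. w \<in> ball 0 1 \<Longrightarrow> ((\<lambda>k. w ^ (k * (k + 1))) has_sum h1 w) UNIV" "h1 0 = (1::complex)"
    using lacunary_series[of "\<lambda>k. k * (k + 1)"] by auto
  have hs: "((\<lambda>n::int. ee ((of_int n + 1/2)\<^sup>2 * \<tau>)) has_sum (ee (\<tau>/4) * h1 (ee \<tau>) + ee (\<tau>/4) * h1 (ee \<tau>))) UNIV"
    if "\<tau> \<in> upper_half" for \<tau>
  proof (rule has_sum_int_split)
    have s: "((\<lambda>k. ee (\<tau>/4) * ee \<tau> ^ (k * (k + 1))) has_sum ee (\<tau>/4) * h1 (ee \<tau>)) UNIV"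
      by (intro has_sum_cmult_right h1(2) ee_in_ball that)
    have "ee ((of_int (int k) + 1/2)\<^sup>2 * \<tau>) = ee (\<tau>/4) * ee \<tau> ^ (k * (k + 1))" for k
      unfolding ee_of_nat_mult[symmetric] ee_add[symmetric]
      by (rule arg_cong[of _ _ ee]) (simp add: power2_eq_square field_simps)
    then show "((\<lambda>k. ee ((of_int (int k) + 1/2)\<^sup>2 * \<tau>)) has_sum ee (\<tau>/4) * h1 (ee \<tau>)) UNIV"
      using s by simp
    have "ee ((of_int (- 1 - int k) + 1/2)\<^sup>2 * \<tau>) = ee (\<tau>/4) * ee \<tau> ^ (k * (k + 1))" for k
      unfolding ee_of_nat_mult[symmetric] ee_add[symmetric]
      by (rule arg_cong[of _ _ ee]) (simp add: power2_eq_square field_simps)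
    then show "((\<lambda>k. ee ((of_int (- 1 - int k) + 1/2)\<^sup>2 * \<tau>)) has_sum ee (\<tau>/4) * h1 (ee \<tau>)) UNIV"
      using s by simp
  qed
  have th: "theta1 \<tau> = ee (\<tau>/4) * h1 (ee \<tau>) + ee (\<tau>/4) * h1 (ee \<tau>)" if "\<tau> \<in> upper_half" for \<tau>
    using hs[OF that] unfolding theta1_def by (rule infsumI)
  show thesis
    by (rule that[of "\<lambda>w. 2 * h1 w"]) (use h1 hs th in \<open>auto intro!: holomorphic_intros\<close>)
qed

lemma theta_has_sum:
  "\<tau> \<in> upper_half \<Longrightarrow> ((\<lambda>n::int. ee ((of_int n)\<^sup>2 * \<tau>)) has_sum theta \<tau>) UNIV"
  by (rule theta_qseries)

lemma theta1_has_sum: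
  "\<tau> \<in> upper_half \<Longrightarrow> ((\<lambda>n::int. ee ((of_int n + 1/2)\<^sup>2 * \<tau>)) has_sum theta1 \<tau>) UNIV"
  by (rule theta1_qseries)

lemma holomorphic_ee [holomorphic_intros]:
  "f holomorphic_on A \<Longrightarrow> (\<lambda>z. ee (f z)) holomorphic_on A"
  unfolding ee_def by (intro holomorphic_intros)

lemma open_upper_half [simp]: "open upper_half"
  unfolding upper_half_def by (rule open_halfspace_Im_gt)

lemma convex_upper_half: "convex upper_half"
  unfolding upper_half_def by (rule convex_halfspace_Im_gt)

lemma connected_upper_half: "connected upper_half"
  by (rule convex_connected[OF convex_upper_half])

lemma holomorphic_comp_ee:
  assumes "h holomorphic_on ball 0 1"
  shows "(\<lambda>\<tau>. h (ee \<tau>)) holomorphic_on upper_half"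
proof -
  have "(h \<circ> ee) holomorphic_on upper_half"
    by (rule holomorphic_on_compose_gen[OF _ assms])
       (use ee_in_ball holomorphic_ee[OF holomorphic_on_id] in \<open>auto simp: id_def\<close>)
  then show ?thesis by (simp add: o_def)
qed

lemma theta_holomorphic: "theta holomorphic_on upper_half"
proof -
  obtain h where "h holomorphic_on ball 0 1" "\<And>\<tau>. \<tau> \<in> upper_half \<Longrightarrow> theta \<tau> = h (ee \<tau>)"
    using theta_qseries by metis
  then show ?thesis using holomorphic_comp_ee by (subst holomorphic_cong[OF refl]) auto
qed

section \<open>Duplication identities\<close>

lemma theta_quarter:
  assumes "\<tau> \<in> upper_half"
  shows "theta (\<tau> / 4) = theta \<tau> + theta1 \<tau>"
proof -
  define f where "f = (\<lambda>n::int. ee ((of_int n)\<^sup>2 * (\<tau> / 4)))"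
  have H: "\<tau> / 4 \<in> upper_half" using assms by (simp add: upper_half_def)
  have 1: "(f has_sum theta \<tau>) (range (\<lambda>n. 2 * n))"
    using theta_has_sum[OF assms] by (subst has_sum_reindex) (auto simp: o_def inj_on_def f_def power_mult_distrib)
  have eq: "f (2 * n + 1) = ee ((of_int n + 1/2)\<^sup>2 * \<tau>)" for n
    unfolding f_def by (rule arg_cong[of _ _ ee]) (simp add: power2_eq_square field_simps)
  have 2: "(f has_sum theta1 \<tau>) (range (\<lambda>n. 2 * n + 1))"
    using theta1_has_sum[OF assms] by (subst has_sum_reindex) (auto simp: o_def inj_on_def eq)
  have U: "range (\<lambda>n::int. 2 * n) \<union> range (\<lambda>n. 2 * n + 1) = UNIV"
    by (auto simp: image_iff) presburger
  have "range (\<lambda>n::int. 2 * n) \<inter> range (\<lambda>n. 2 * n + 1) = {}"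
    by auto presburger
  then have "(f has_sum (theta \<tau> + theta1 \<tau>)) UNIV" using has_sum_Un_disjoint[OF 1 2] U by simp
  then show ?thesis using theta_has_sum[OF H] has_sum_unique unfolding f_def by blast
qed

text \<open>Over the complex numbers summability is absolute, which justifies the unordered double
  sum.\<close>

lemma has_sum_product_complex:
  fixes f :: "'a \<Rightarrow> complex" and g :: "'b \<Rightarrow> complex"
  assumes f: "(f has_sum A) UNIV" and g: "(g has_sum B) UNIV"
  shows "((\<lambda>(x, y). f x * g y) has_sum (A * B)) UNIV"
proof -
  have "f summable_on UNIV" "g summable_on UNIV" using assms has_sum_imp_summable by auto
  then have "(\<lambda>x. norm (f x)) summable_on UNIV" "(\<lambda>x. norm (g x)) summable_on UNIV"
    by (simp_all add: summable_on_iff_abs_summable_on_complex)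
  then have "(\<lambda>z. norm (case z of (x, y) \<Rightarrow> f x * g y)) summable_on (SIGMA x:UNIV. UNIV)"
    by (subst Infinite_Sum.abs_summable_on_Sigma_iff)
      (auto simp: norm_mult infsum_cmult_right' abs_mult
        intro!: summable_on_cmult_right summable_on_cmult_left)
  then have s: "(\<lambda>(x, y). f x * g y) summable_on (SIGMA x:UNIV. UNIV)"
    by (rule Infinite_Sum.abs_summable_summable)
  have "((\<lambda>(x, y). f x * g y) has_sum (A * B)) (SIGMA x:UNIV. UNIV)"
  proof (rule has_sum_SigmaI[OF _ _ s])
    show "((\<lambda>y. case (x, y) of (x, y) \<Rightarrow> f x * g y) has_sum f x * B) UNIV" for x
      using has_sum_cmult_right[OF g] by simp
    show "((\<lambda>x. f x * B) has_sum A * B) UNIV"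
      by (rule has_sum_cmult_left[OF f])
  qed
  then show ?thesis by simp
qed

text \<open>Rotation of the lattice: m = u + v, n = u - v gives m^2 + n^2 = 2 u^2 + 2 v^2. Integers
  u, v cover the pairs with m + n even; the other pairs come from half-integers u, v and produce
  \<open>theta1\<close>.\<close>

lemma theta_square:
  assumes "\<tau> \<in> upper_half"
  shows "(theta \<tau>)\<^sup>2 = (theta (2 * \<tau>))\<^sup>2 + (theta1 (2 * \<tau>))\<^sup>2"
proof -
  define f where "f = (\<lambda>(m::int, n::int). ee ((of_int m)\<^sup>2 * \<tau>) * ee ((of_int n)\<^sup>2 * \<tau>))"
  have H: "2 * \<tau> \<in> upper_half" using assms by (simp add: upper_half_def)
  have 0: "(f has_sum theta \<tau> * theta \<tau>) UNIV"
    unfolding f_def by (intro has_sum_product_complex theta_has_sum assms)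
  define p where "p = (\<lambda>(u::int, v::int). (u + v, u - v))"
  define p' where "p' = (\<lambda>(u::int, v::int). (u + v + 1, u - v))"
  have fp: "f \<circ> p = (\<lambda>(m, n). ee ((of_int m)\<^sup>2 * (2 * \<tau>)) * ee ((of_int n)\<^sup>2 * (2 * \<tau>)))"
    by (auto simp: fun_eq_iff f_def p_def ee_add[symmetric] power2_eq_square algebra_simps)
  have 1: "(f has_sum theta (2 * \<tau>) * theta (2 * \<tau>)) (range p)"
    by (subst has_sum_reindex, force simp: inj_on_def p_def, unfold fp)
       (intro has_sum_product_complex theta_has_sum H)
  have fp': "f \<circ> p' = (\<lambda>(m, n). ee ((of_int m + 1/2)\<^sup>2 * (2 * \<tau>)) * ee ((of_int n + 1/2)\<^sup>2 * (2 * \<tau>)))"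
    by (auto simp: fun_eq_iff f_def p'_def ee_add[symmetric] power2_eq_square algebra_simps)
  have 2: "(f has_sum theta1 (2 * \<tau>) * theta1 (2 * \<tau>)) (range p')"
    by (subst has_sum_reindex, force simp: inj_on_def p'_def, unfold fp')
       (intro has_sum_product_complex theta1_has_sum H)
  have "x \<in> range p \<union> range p'" for x
  proof -
    obtain m n where x: "x = (m, n)" by force
    show ?thesis
    proof (cases "even (m + n)")
      case True
      then obtain k where "m + n = 2 * k" by (elim evenE)
      then have "x = p (k, m - k)" by (simp add: x p_def)
      then show ?thesis by blast
    next
      case False
      then obtain k where "m + n = 2 * k + 1" by (elim oddE)
      then have "x = p' (k, m - k - 1)" by (simp add: x p'_def)
      then show ?thesis by blast
    qed
  qed
  then have U: "range p \<union> range p' = UNIV" by blast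
  have "range p \<inter> range p' = {}"
    by (auto simp: p_def p'_def) presburger
  then have "(f has_sum (theta (2 * \<tau>) * theta (2 * \<tau>) + theta1 (2 * \<tau>) * theta1 (2 * \<tau>))) UNIV"
    using has_sum_Un_disjoint[OF 1 2] U by simp
  then show ?thesis using 0 has_sum_unique unfolding power2_eq_square by blast
qed

lemma upper_half_scale [simp]:
  "\<tau> \<in> upper_half \<Longrightarrow> 2 * \<tau> \<in> upper_half" "\<tau> \<in> upper_half \<Longrightarrow> 4 * \<tau> \<in> upper_half"
  "\<tau> \<in> upper_half \<Longrightarrow> \<tau> / 4 \<in> upper_half" "\<tau> \<in> upper_half \<Longrightarrow> \<tau> / 2 \<in> upper_half"
  by (auto simp: upper_half_def)

lemma upper_half_shift [simp]:
  "\<tau> \<in> upper_half \<Longrightarrow> \<tau> + 1 \<in> upper_half" "\<tau> \<in> upper_half \<Longrightarrow> \<tau> - 1 \<in> upper_half"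
  "\<tau> \<in> upper_half \<Longrightarrow> \<tau> + 1/2 \<in> upper_half" "\<tau> \<in> upper_half \<Longrightarrow> \<tau> + 1/4 \<in> upper_half"
  "\<tau> \<in> upper_half \<Longrightarrow> \<tau> + of_int n \<in> upper_half"
  by (auto simp: upper_half_def)

lemma upper_half_nonzero: "\<tau> \<in> upper_half \<Longrightarrow> \<tau> \<noteq> 0"
  by (auto simp: upper_half_def)

lemma zero_notin_upper_half [simp]: "0 \<notin> upper_half"
  by (simp add: upper_half_def)

lemma upper_half_inversion [simp]:
  assumes "\<tau> \<in> upper_half"
  shows "- 1 / \<tau> \<in> upper_half"
proof -
  have "Im (- 1 / \<tau>) = Im \<tau> / (norm \<tau>)\<^sup>2"
    by (simp add: Im_divide cmod_power2)
  then show ?thesis using assms upper_half_nonzero[OF assms] by (simp add: upper_half_def)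
qed

lemma theta_plus_1: "\<tau> \<in> upper_half \<Longrightarrow> theta (\<tau> + 1) = theta \<tau>"
  by (metis theta_qseries ee_add ee_1 mult.right_neutral upper_half_shift(1))

lemma theta1_plus_1: 
  assumes "\<tau> \<in> upper_half" 
  shows "theta1 (\<tau> + 1) = \<i> * theta1 \<tau>"
proof -
  obtain h where h: "\<And>\<tau>. \<tau> \<in> upper_half \<Longrightarrow> theta1 \<tau> = ee (\<tau> / 4) * h (ee \<tau>)"
    using theta1_qseries by metis
  show ?thesis using h[of \<tau>] h[of "\<tau> + 1"] assms 
    by (simp add: ee_add add_divide_distrib ee_quarter)
qed

lemma theta_quarter_shift:
  assumes "\<tau> \<in> upper_half"
  shows "theta ((\<tau> + 1) / 4) = theta \<tau> + \<i> * theta1 \<tau>"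
  using theta_quarter[of "\<tau> + 1"] assms by (simp add: theta_plus_1 theta1_plus_1)

lemma theta_half_shift:
  assumes "\<tau> \<in> upper_half"
  shows "theta (\<tau> / 4 + 1/2) = theta \<tau> - theta1 \<tau>"
proof -
  have "theta ((\<tau> + 1 + 1) / 4) = theta \<tau> - theta1 \<tau>"
    using theta_quarter_shift[of "\<tau> + 1"] assms by (simp add: theta_plus_1 theta1_plus_1)
  moreover have "(\<tau> + 1 + 1) / 4 = \<tau> / 4 + 1/2" by (simp add: field_simps)
  ultimately show ?thesis by metis
qed

lemma theta_square_half_shift:
  assumes "\<tau> \<in> upper_half"
  shows "(theta (\<tau> + 1/2))\<^sup>2 = (theta (2 * \<tau>))\<^sup>2 - (theta1 (2 * \<tau>))\<^sup>2"
proof -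
  have "2 * (\<tau> + 1/2) = 2 * \<tau> + 1" by simp
  then show ?thesis using theta_square[of "\<tau> + 1/2"] assms
    by (simp add: theta_plus_1 theta1_plus_1 power_mult_distrib)
qed

text \<open>Compares two expansions of the square of theta at \<tau>/2: the one of
  \<open>theta_square\<close>, and the square of theta (2\<tau>) + theta1 (2\<tau>).\<close>

lemma theta1_square:
  assumes "\<tau> \<in> upper_half"
  shows "(theta1 \<tau>)\<^sup>2 = 2 * theta (2 * \<tau>) * theta1 (2 * \<tau>)"
proof -
  have "theta (\<tau> / 2) = theta (2 * \<tau>) + theta1 (2 * \<tau>)"
    using theta_quarter[of "2 * \<tau>"] assms by simp
  then show ?thesis
    using theta_square[of "\<tau> / 2"] theta_square[of \<tau>] assms by (simp add: power2_sum)
qed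

text \<open>The geometric half of the arithmetic-geometric mean recursion, in Jacobi's notation
  theta3 theta4 = theta4^2 with doubled argument on the right. The arithmetic half is contained in
  \<open>theta_square\<close> and \<open>theta_square_half_shift\<close>.\<close>

lemma theta_times_half_shift:
  assumes "\<tau> \<in> upper_half"
  shows "theta \<tau> * theta (\<tau> + 1/2) = (theta (2 * \<tau> + 1/2))\<^sup>2"
proof -
  have "theta \<tau> = theta (4 * \<tau>) + theta1 (4 * \<tau>)" "theta (\<tau> + 1/2) = theta (4 * \<tau>) - theta1 (4 * \<tau>)"
    using theta_quarter[of "4 * \<tau>"] theta_half_shift[of "4 * \<tau>"] assms by simp_all
  then have "theta \<tau> * theta (\<tau> + 1/2) = (theta (2 * (2 * \<tau>)))\<^sup>2 - (theta1 (2 * (2 * \<tau>)))\<^sup>2"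
    by (simp add: power2_eq_square square_diff_square_factored)
  then show ?thesis using theta_square_half_shift[of "2 * \<tau>"] assms by simp
qed

section \<open>Behaviour at the cusp and absence of zeros\<close>

lemma theta_limit:
  assumes "\<epsilon> > 0"
  obtains K where "\<And>\<tau>. Im \<tau> > K \<Longrightarrow> norm (theta \<tau> - 1) < \<epsilon>"
proof -
  obtain h where h: "h holomorphic_on ball 0 1" "h 0 = 1"
      "\<And>\<tau>. \<tau> \<in> upper_half \<Longrightarrow> theta \<tau> = h (ee \<tau>)"
    using theta_qseries by metis
  have "isCont h 0"
    using h(1) holomorphic_on_imp_continuous_on[OF h(1)]
    by (simp add: continuous_on_eq_continuous_at)
  then obtain d where d: "d > 0" "\<And>w. norm w < d \<Longrightarrow> norm (h w - 1) < \<epsilon>"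
    using assms h(2) unfolding continuous_at_eps_delta by (metis dist_norm diff_zero)
  define K where "K = max 0 (- ln d / (2 * pi))"
  show ?thesis
  proof
    fix \<tau> assume "Im \<tau> > K"
    then have t: "Im \<tau> > 0" "- 2 * pi * Im \<tau> < ln d" by (auto simp: K_def field_simps)
    then have "exp (- 2 * pi * Im \<tau>) < exp (ln d)" by (subst exp_less_cancel_iff)
    then have "norm (ee \<tau>) < d" using d(1) by (simp add: norm_ee)
    then show "norm (theta \<tau> - 1) < \<epsilon>" using d h(3) t by (simp add: upper_half_def)
  qed
qed

text \<open>A zero \<open>\<tau>\<close> would propagate along \<open>2\<^sup>n\<tau> + 1/2\<close> up to the cusp, where theta tends to 1.\<close>

lemma theta_nonzero:
  assumes "\<tau> \<in> upper_half"
  shows "theta \<tau> \<noteq> 0"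
proof
  assume z: "theta \<tau> = 0"
  have H: "of_nat (2 ^ n) * \<tau> \<in> upper_half" for n
    using assms by (simp add: upper_half_def)
  have "theta (of_nat (2 ^ Suc n) * \<tau> + 1/2) = 0" for n
  proof (induction n)
    case 0
    then show ?case using theta_times_half_shift[OF assms] z by simp
  next
    case (Suc n)
    define \<sigma> where "\<sigma> = of_nat (2 ^ Suc n) * \<tau> + 1/2"
    have s: "\<sigma> \<in> upper_half" unfolding \<sigma>_def by (intro upper_half_shift(3) H)
    \<comment> \<open>Doubling turns the shift 1/2 into the period 1, so the new 1/2 is the only
      shift left.\<close>
    have "2 * \<sigma> + 1/2 = of_nat (2 ^ Suc (Suc n)) * \<tau> + 1/2 + 1" by (simp add: \<sigma>_def algebra_simps)
    then have "theta (2 * \<sigma> + 1/2) = theta (of_nat (2 ^ Suc (Suc n)) * \<tau> + 1/2)"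
      using theta_plus_1[OF upper_half_shift(3)[OF H]] by metis
    then show ?case using theta_times_half_shift[OF s] Suc by (simp add: \<sigma>_def)
  qed
  moreover obtain K where K: "\<And>\<tau>. Im \<tau> > K \<Longrightarrow> norm (theta \<tau> - 1) < 1"
    using theta_limit[of 1] by auto
  moreover obtain n where n: "K / Im \<tau> < of_nat n" using reals_Archimedean2 by blast
  moreover have "K < Im (of_nat (2 ^ Suc n) * \<tau> + 1/2)"
  proof -
    have "real n < 2 ^ n" by (rule of_nat_less_two_power)
    also have "\<dots> \<le> 2 ^ Suc n" by simp
    finally have "K / Im \<tau> < 2 ^ Suc n" using n by linarith
    then show ?thesis using assms by (simp add: upper_half_def field_simps)
  qed
  ultimately show False by fastforce
qed

section \<open>The inversion formula\<close>

text \<open>Under \<open>y \<mapsto> 2y\<close> the pairs \<open>(t3(y)\<^sup>2, t4(y)\<^sup>2)\<close> and \<open>(t3(1/y)\<^sup>2/y, t2(1/y)\<^sup>2/y)\<close> both follow the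
  arithmetic-geometric mean recursion, with limit 1; so neither pair strictly dominates the other by a constant factor.
  Together with the same statement at \<open>1/y\<close> and Jacobi's identity this forces equality.\<close>

lemma agm_inversion:
  fixes t2 t3 t4 :: "real \<Rightarrow> real"
  assumes pos: "\<And>y. y > 0 \<Longrightarrow> t3 y \<noteq> 0" "\<And>y. y > 0 \<Longrightarrow> t4 y \<noteq> 0"
    and up3: "\<And>y. y > 0 \<Longrightarrow> (t3 y)\<^sup>2 + (t4 y)\<^sup>2 = 2 * (t3 (2 * y))\<^sup>2"
    and up4: "\<And>y. y > 0 \<Longrightarrow> t3 y * t4 y = (t4 (2 * y))\<^sup>2"
    and down3: "\<And>y. y > 0 \<Longrightarrow> (t3 y)\<^sup>2 + (t2 y)\<^sup>2 = (t3 (y / 2))\<^sup>2"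
    and down2: "\<And>y. y > 0 \<Longrightarrow> 2 * t3 y * t2 y = (t2 (y / 2))\<^sup>2"
    and jacobi: "\<And>y. y > 0 \<Longrightarrow> t3 y ^ 4 = t2 y ^ 4 + t4 y ^ 4"
    and lim: "(t3 \<longlongrightarrow> 1) at_top" "((\<lambda>y. (t3 (1 / y))\<^sup>2 / y) \<longlongrightarrow> 1) at_top"
    and y: "y > 0"
  shows "(t3 (1 / y))\<^sup>2 / y = (t3 y)\<^sup>2"
proof -
  \<comment> \<open>Capital letters are the transformed values, small letters the original ones; the
    goal is A y = a y.\<close>
  define A where "A = (\<lambda>y. (t3 (1 / y))\<^sup>2 / y)"
  define B where "B = (\<lambda>y. (t2 (1 / y))\<^sup>2 / y)"
  define C where "C = (\<lambda>y. (t4 (1 / y))\<^sup>2 / y)"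
  define a where "a = (\<lambda>y. (t3 y)\<^sup>2)"
  define b where "b = (\<lambda>y. (t4 y)\<^sup>2)"
  define c where "c = (\<lambda>y. (t2 y)\<^sup>2)"
  have nn: "A y \<ge> 0" "B y \<ge> 0" "C y \<ge> 0" "a y > 0" "b y > 0" "c y \<ge> 0" if "y > 0" for y
    using that pos by (auto simp: A_def B_def C_def a_def b_def c_def)
  have A2: "A (2 * y) = (A y + B y) / 2" if "y > 0" for y
    using down3[of "1 / y"] that by (simp add: A_def B_def field_simps)
  have B2: "(B (2 * y))\<^sup>2 = A y * B y" if "y > 0" for y
  proof -
    have "(2 * t3 (1 / y) * t2 (1 / y))\<^sup>2 = ((t2 (1 / (2 * y)))\<^sup>2)\<^sup>2"
      using down2[of "1 / y"] that by (simp add: mult.commute)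
    then show ?thesis using that by (simp add: A_def B_def power2_eq_square field_simps)
  qed
  have a2: "a (2 * y) = (a y + b y) / 2" if "y > 0" for y
    using up3[of y] that by (simp add: a_def b_def)
  have b2: "(b (2 * y))\<^sup>2 = a y * b y" if "y > 0" for y
    using up4[of y, symmetric] that by (simp add: a_def b_def power_mult_distrib)
  have alim: "(\<lambda>n. a (2 ^ n * y)) \<longlonglongrightarrow> 1" and Alim: "(\<lambda>n. A (2 ^ n * y)) \<longlonglongrightarrow> 1" if "y > 0" for y
  proof -
    have f: "filterlim (\<lambda>n. 2 ^ n * y) at_top sequentially"
      using that by real_asymp
    have "(a \<longlongrightarrow> 1) at_top" using tendsto_power[OF lim(1), of 2] by (simp add: a_def)
    then show "(\<lambda>n. a (2 ^ n * y)) \<longlonglongrightarrow> 1" by (rule filterlim_compose[OF _ f])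
    have "(A \<longlongrightarrow> 1) at_top" using lim(2) by (simp add: A_def)
    then show "(\<lambda>n. A (2 ^ n * y)) \<longlonglongrightarrow> 1" by (rule filterlim_compose[OF _ f])
  qed
  \<comment> \<open>Both means are monotone and homogeneous, so domination by a factor K survives
    every step of the recursion. In the limit, where A and a tend to 1, it reads K \<le> 1.\<close>
  have lower: "K \<le> 1" if K: "K \<ge> 0" "K * a y \<le> A y" "K * b y \<le> B y" and y: "y > 0" for K y
  proof -
    have *: "K * a (2 ^ n * y) \<le> A (2 ^ n * y) \<and> K * b (2 ^ n * y) \<le> B (2 ^ n * y)" for n
    proof (induction n)
      case (Suc n)
      define z where "z = 2 ^ n * y"
      have z: "z > 0" "2 ^ Suc n * y = 2 * z" using y by (auto simp: z_def)
      have IH: "K * a z \<le> A z" "K * b z \<le> B z" using Suc by (auto simp: z_def)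
      have "K * a (2 * z) \<le> A (2 * z)"
        unfolding A2[OF z(1)] a2[OF z(1)] using IH by (simp add: distrib_left)
      moreover have "(K * b (2 * z))\<^sup>2 \<le> (B (2 * z))\<^sup>2"
      proof -
        have "(K * b (2 * z))\<^sup>2 = (K * a z) * (K * b z)"
          using b2[OF z(1)] by (simp add: power_mult_distrib power2_eq_square)
        also have "\<dots> \<le> A z * B z" using IH nn[OF z(1)] K(1) by (intro mult_mono) auto
        finally show ?thesis using B2[OF z(1)] by simp
      qed
      then have "K * b (2 * z) \<le> B (2 * z)"
        using nn(2)[of "2 * z"] z(1) by (intro power2_le_imp_le[of "K * b (2 * z)"]) auto
      ultimately show ?case unfolding z(2) by blast
    qed (use K in auto)
    have "K * 1 \<le> 1"
      by (rule tendsto_le[OF _ Alim[OF y] tendsto_mult_left[OF alim[OF y]]]) (use * in auto)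
    then show ?thesis by simp
  qed
  have upper: "K \<ge> 1" if K: "K \<ge> 0" "K * a y \<ge> A y" "K * b y \<ge> B y" and y: "y > 0" for K y
  proof -
    have *: "K * a (2 ^ n * y) \<ge> A (2 ^ n * y) \<and> K * b (2 ^ n * y) \<ge> B (2 ^ n * y)" for n
    proof (induction n)
      case (Suc n)
      define z where "z = 2 ^ n * y"
      have z: "z > 0" "2 ^ Suc n * y = 2 * z" using y by (auto simp: z_def)
      have IH: "K * a z \<ge> A z" "K * b z \<ge> B z" using Suc by (auto simp: z_def)
      have "K * a (2 * z) \<ge> A (2 * z)"
        unfolding A2[OF z(1)] a2[OF z(1)] using IH by (simp add: distrib_left)
      moreover have "(K * b (2 * z))\<^sup>2 \<ge> (B (2 * z))\<^sup>2"
      proof -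
        have "A z * B z \<le> (K * a z) * (K * b z)" using IH nn[OF z(1)] K(1) by (intro mult_mono) auto
        also have "\<dots> = (K * b (2 * z))\<^sup>2"
          using b2[OF z(1)] by (simp add: power_mult_distrib power2_eq_square)
        finally show ?thesis using B2[OF z(1)] by simp
      qed
      then have "K * b (2 * z) \<ge> B (2 * z)"
        using nn(5)[of "2 * z"] z(1) K(1) by (intro power2_le_imp_le[of "B (2 * z)"]) auto
      ultimately show ?case unfolding z(2) by blast
    qed (use K in auto)
    have "1 \<le> K * 1"
      by (rule tendsto_le[OF _ tendsto_mult_left[OF alim[OF y]] Alim[OF y]]) (use * in auto)
    then show ?thesis by simp
  qed
  \<comment> \<open>Otherwise the smaller of the two ratios is a factor K > 1 to which
    \<open>lower\<close> applies.\<close>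
  have not_gt: "\<not> (A y > a y \<and> B y > b y)" if y: "y > 0" for y
  proof
    assume *: "A y > a y \<and> B y > b y"
    define K where "K = min (A y / a y) (B y / b y)"
    have "K > 1" using * nn[OF y] by (simp add: K_def)
    moreover have "K * a y \<le> A y" "K * b y \<le> B y"
      using nn[OF y] by (simp_all add: K_def flip: pos_le_divide_eq)
    ultimately show False using lower[of K y] y by auto
  qed
  have not_lt: "\<not> (A y < a y \<and> B y < b y)" if y: "y > 0" for y
  proof
    assume *: "A y < a y \<and> B y < b y"
    define K where "K = max (A y / a y) (B y / b y)"
    have "K < 1" "K \<ge> 0" using * nn[OF y] by (auto simp add: K_def le_max_iff_disj)
    moreover have "K * a y \<ge> A y" "K * b y \<ge> B y"
      using nn[OF y] by (simp_all add: K_def flip: pos_divide_le_eq)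
    ultimately show False using upper[of K y] y by auto
  qed
  \<comment> \<open>Passing to 1/y exchanges A with a, B with c and b with C, up to the common
    factor y; the strict dominations excluded for (A, B) and (a, b) are thereby excluded for (A, C)
    and (a, c) as well.\<close>
  have inv: "A (1 / y) = y * a y" "a (1 / y) = y * A y" "B (1 / y) = y * c y" "b (1 / y) = y * C y"
    using y by (auto simp: A_def B_def C_def a_def b_def c_def)
  have not_lt': "\<not> (A y < a y \<and> C y < c y)" using not_gt[of "1 / y"] y by (simp add: inv)
  have not_gt': "\<not> (A y > a y \<and> C y > c y)" using not_lt[of "1 / y"] y by (simp add: inv)
  have sq: "(a y)\<^sup>2 = (b y)\<^sup>2 + (c y)\<^sup>2" "(A y)\<^sup>2 = (B y)\<^sup>2 + (C y)\<^sup>2"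
    using jacobi[of y] jacobi[of "1 / y"] y
    by (simp_all add: A_def B_def C_def a_def b_def c_def power_divide add_divide_distrib
        flip: power_mult)
  \<comment> \<open>If A exceeded a, then B \<le> b and C \<le> c would follow, and Jacobi's
    identity A^2 = B^2 + C^2 would give A \<le> a after all.\<close>
  have "A y \<le> a y"
  proof (rule ccontr)
    assume g: "\<not> A y \<le> a y"
    then have "B y \<le> b y" "C y \<le> c y" using not_gt[OF y] not_gt' by auto
    then have "(B y)\<^sup>2 \<le> (b y)\<^sup>2" "(C y)\<^sup>2 \<le> (c y)\<^sup>2" using nn[OF y] by (auto intro: power_mono)
    then have "(A y)\<^sup>2 \<le> (a y)\<^sup>2" using sq by simp
    then show False using g nn[OF y] by (meson less_imp_le power2_le_imp_le)
  qed
  moreover have "A y \<ge> a y"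
  proof (rule ccontr)
    assume g: "\<not> A y \<ge> a y"
    then have "b y \<le> B y" "c y \<le> C y" using not_lt[OF y] not_lt' by auto
    then have "(b y)\<^sup>2 \<le> (B y)\<^sup>2" "(c y)\<^sup>2 \<le> (C y)\<^sup>2" using nn[OF y] by (auto intro: power_mono)
    then have "(a y)\<^sup>2 \<le> (A y)\<^sup>2" using sq by simp
    then show False using g nn[OF y] by (meson less_imp_le power2_le_imp_le)
  qed
  ultimately show ?thesis by (simp add: A_def a_def)
qed

lemma integral_gauss_limit:
  "((\<lambda>y. integral {0..y} (\<lambda>x::real. exp (- x\<^sup>2))) \<longlongrightarrow> sqrt pi / 2) at_top"
proof -
  define g where "g = (\<lambda>x::real. indicator {0..} x *\<^sub>R exp (- x\<^sup>2))"
  have g: "integrable lborel g" "integral\<^sup>L lborel g = sqrt pi / 2"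
    using gaussian_moment_0 by (auto simp: has_bochner_integral_iff g_def)
  have "((\<lambda>y. \<integral>x. indicator {..y} x *\<^sub>R g x \<partial>lborel) \<longlongrightarrow> sqrt pi / 2) at_top"
    using tendsto_integral_at_top[OF _ g(1)] g(2) by simp
  moreover have "(\<integral>x. indicator {..y} x *\<^sub>R g x \<partial>lborel) = integral {0..y} (\<lambda>x. exp (- x\<^sup>2))" for y
  proof -
    have "set_integrable lborel {0..y} (\<lambda>x::real. exp (- x\<^sup>2))"
      by (rule borel_integrable_atLeastAtMost') (intro continuous_intros)
    then have "(LINT x:{0..y}|lborel. exp (- x\<^sup>2)) = integral {0..y} (\<lambda>x::real. exp (- x\<^sup>2))"
      by (rule set_borel_integral_eq_integral)
    then show ?thesis
      unfolding set_lebesgue_integral_def g_def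
      by (subst (asm) Bochner_Integration.integral_cong[OF refl, of _ _ "\<lambda>x. indicator {..y} x *\<^sub>R (indicator {0..} x *\<^sub>R exp (- x\<^sup>2))"])
         (auto simp: indicator_def)
  qed
  ultimately show ?thesis by simp
qed

text \<open>Lower and upper Riemann sums with mesh c of the decreasing function exp (-x^2) on the
  positive axis, compared with its integral sqrt pi / 2.\<close>

lemma gauss_sum_bounds:
  assumes c: "c > (0::real)"
  obtains S where "(\<lambda>k. exp (- (c * real (Suc k))\<^sup>2)) sums S" "2 * c * S \<le> sqrt pi" "sqrt pi \<le> 2 * c * (1 + S)"
proof -
  define g where "g = (\<lambda>x::real. exp (- x\<^sup>2))"
  have gint: "g integrable_on {x..y}" for x y
    unfolding g_def by (intro integrable_continuous_interval continuous_intros)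
  have step: "c * g (c * real (Suc k)) \<le> integral {c * real k..c * real (Suc k)} g"
      "integral {c * real k..c * real (Suc k)} g \<le> c * g (c * real k)" for k
  proof -
    have le: "c * real k \<le> c * real (Suc k)" using c by simp
    have len: "c * real (Suc k) - c * real k = c" by (simp add: algebra_simps)
    have "integral {c * real k..c * real (Suc k)} (\<lambda>x. g (c * real (Suc k))) \<le> integral {c * real k..c * real (Suc k)} g"
    proof (rule integral_le[OF _ gint])
      fix x assume x: "x \<in> {c * real k..c * real (Suc k)}"
      have "0 \<le> c * real k" using c by simp
      then have "x\<^sup>2 \<le> (c * real (Suc k))\<^sup>2" using x by (intro power_mono) auto
      then show "g (c * real (Suc k)) \<le> g x" by (simp add: g_def)
    qed auto
    then show "c * g (c * real (Suc k)) \<le> integral {c * real k..c * real (Suc k)} g"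
      using le len by simp
    have "integral {c * real k..c * real (Suc k)} g \<le> integral {c * real k..c * real (Suc k)} (\<lambda>x. g (c * real k))"
    proof (rule integral_le[OF gint])
      fix x assume x: "x \<in> {c * real k..c * real (Suc k)}"
      have "0 \<le> c * real k" using c by simp
      then have "(c * real k)\<^sup>2 \<le> x\<^sup>2" using x by (intro power_mono) auto
      then show "g x \<le> g (c * real k)" by (simp add: g_def)
    qed auto
    then show "integral {c * real k..c * real (Suc k)} g \<le> c * g (c * real k)"
      using le len by simp
  qed
  have bounds: "(\<Sum>k<n. c * g (c * real (Suc k))) \<le> integral {0..c * real n} g \<and>
      integral {0..c * real n} g \<le> (\<Sum>k<n. c * g (c * real k))" for n
  proof (induction n)
    case (Suc n)
    have "integral {0..c * real (Suc n)} g = integral {0..c * real n} g + integral {c * real n..c * real (Suc n)} g"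
      using c by (intro Henstock_Kurzweil_Integration.integral_combine[symmetric] gint) auto
    then show ?case using Suc step[of n] by simp
  qed simp
  define S where "S = (\<Sum>k. g (c * real (Suc k)))"
  have "summable (\<lambda>k. g (c * real (Suc k)))"
  proof (rule summable_comparison_test'[of "\<lambda>k. exp (- c\<^sup>2) ^ k" 0])
    show "summable (\<lambda>k. exp (- c\<^sup>2) ^ k)" using c by (intro summable_geometric) simp
    fix k :: nat
    have "real k \<le> (real (Suc k))\<^sup>2" by (simp add: power2_eq_square algebra_simps)
    then have "real k * c\<^sup>2 \<le> (c * real (Suc k))\<^sup>2"
      unfolding power_mult_distrib by (subst mult.commute) (intro mult_left_mono, auto)
    then show "norm (g (c * real (Suc k))) \<le> exp (- c\<^sup>2) ^ k"
      by (simp add: g_def flip: exp_of_nat_mult)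
  qed
  then have S: "(\<lambda>k. g (c * real (Suc k))) sums S" by (simp add: S_def summable_sums)
  have S0: "(\<lambda>k. g (c * real k)) sums (S + g (c * real 0))"
    using S by (subst sums_Suc_iff[symmetric]) simp_all
  have f: "filterlim (\<lambda>n. c * real n) at_top sequentially" using c by real_asymp
  have lim: "(\<lambda>n. integral {0..c * real n} g) \<longlonglongrightarrow> sqrt pi / 2"
    using filterlim_compose[OF integral_gauss_limit f] by (simp add: g_def)
  have "c * S \<le> sqrt pi / 2"
    by (rule tendsto_le[OF _ lim sums_mult[OF S, unfolded sums_def]]) (use bounds in auto)
  moreover have "sqrt pi / 2 \<le> c * (S + g (c * real 0))"
    by (rule tendsto_le[OF _ sums_mult[OF S0, unfolded sums_def] lim]) (use bounds in auto)
  moreover have "g (c * real 0) = 1" by (simp add: g_def)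
  ultimately show ?thesis using S that[of S] by (simp add: g_def algebra_simps)
qed

text \<open>Controls the behaviour 1 / sqrt h of theta at i h / 2 for small h; this supplies the
  limit at the cusp 0 in \<open>agm_inversion\<close>.\<close>

lemma theta_imaginary_bounds:
  assumes "h > 0"
  obtains r where "theta (\<i> * of_real (h / 2)) = of_real r" "r > 0" "\<bar>sqrt h * r - 1\<bar> \<le> sqrt h"
proof -
  define c where "c = sqrt (pi * h)"
  have c: "c > 0" using assms by (simp add: c_def)
  obtain S where S: "(\<lambda>k. exp (- (c * real (Suc k))\<^sup>2)) sums S" "2 * c * S \<le> sqrt pi" "sqrt pi \<le> 2 * c * (1 + S)"
    using gauss_sum_bounds[OF c] by blast
  have hs: "((\<lambda>k. exp (- (c * real (Suc k))\<^sup>2)) has_sum S) UNIV"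
    by (rule norm_summable_imp_has_sum) (use S sums_summable in auto)
  have S0: "(\<lambda>k. exp (- (c * real k)\<^sup>2)) sums (S + exp (- (c * real 0)\<^sup>2))"
    using S(1) by (subst sums_Suc_iff[symmetric]) simp_all
  have hs0: "((\<lambda>k. exp (- (c * real k)\<^sup>2)) has_sum (S + 1)) UNIV"
    by (rule norm_summable_imp_has_sum) (use S0 sums_summable in auto)
  have val: "ee ((of_int n)\<^sup>2 * (\<i> * of_real (h / 2))) = of_real (exp (- (c * real_of_int n)\<^sup>2))" for n
  proof -
    have "2 * of_real pi * \<i> * ((of_int n)\<^sup>2 * (\<i> * of_real (h / 2))) = of_real (- (c * real_of_int n)\<^sup>2)"
      using assms by (simp add: c_def power_mult_distrib real_sqrt_pow2 mult_ac)
    then show ?thesis unfolding ee_def exp_of_real[symmetric] by metis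
  qed
  have "((\<lambda>n::int. ee ((of_int n)\<^sup>2 * (\<i> * of_real (h / 2)))) has_sum (of_real (S + 1) + of_real S)) UNIV"
  proof (rule has_sum_int_split)
    show "((\<lambda>k. ee ((of_int (int k))\<^sup>2 * (\<i> * of_real (h / 2)))) has_sum of_real (S + 1)) UNIV"
      unfolding val has_sum_of_real_iff using hs0 by simp
    have "(c * real_of_int (- 1 - int k))\<^sup>2 = (c * real (Suc k))\<^sup>2" for k
      by (simp add: power2_eq_square algebra_simps)
    then show "((\<lambda>k. ee ((of_int (- 1 - int k))\<^sup>2 * (\<i> * of_real (h / 2)))) has_sum of_real S) UNIV"
      unfolding val has_sum_of_real_iff using hs by simp
  qed
  moreover have "\<i> * of_real (h / 2) \<in> upper_half" using assms by (simp add: upper_half_def)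
  ultimately have th: "theta (\<i> * of_real (h / 2)) = of_real (2 * S + 1)"
    using theta_has_sum has_sum_unique by fastforce
  have "S \<ge> 0" using S(1) by (rule sums_le[OF _ sums_zero, rotated]) simp
  have cs: "c = sqrt pi * sqrt h" by (simp add: c_def real_sqrt_mult)
  have "sqrt pi * (sqrt h * (2 * S + 1) - 1) \<le> sqrt pi * sqrt h"
    "sqrt pi * (- sqrt h) \<le> sqrt pi * (sqrt h * (2 * S + 1) - 1)"
    using S(2,3) unfolding cs by (simp_all add: algebra_simps)
  then have "\<bar>sqrt h * (2 * S + 1) - 1\<bar> \<le> sqrt h"
    unfolding mult_le_cancel_left by (auto simp: abs_le_iff)
  then show ?thesis using that[OF th] \<open>S \<ge> 0\<close> by simp
qed

lemma theta_inversion_imaginary: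
  assumes y: "y > 0"
  shows "theta (\<i> * of_real (1 / y / 2)) = of_real (sqrt y) * theta (\<i> * of_real (y / 2))"
proof -
  define t3 where "t3 = (\<lambda>y. Re (theta (\<i> * of_real (y / 2))))"
  have t3: "theta (\<i> * of_real (y / 2)) = of_real (t3 y)" "t3 y > 0" "\<bar>sqrt y * t3 y - 1\<bar> \<le> sqrt y" if y: "y > 0" for y
    using theta_imaginary_bounds[OF y] by (metis Re_complex_of_real t3_def)+
  \<comment> \<open>Jacobi's theta2 and theta4 at i y, expressed through theta3 by
    \<open>theta_quarter\<close> and \<open>theta_half_shift\<close>; this makes it evident that
    they are real.\<close>
  define t2 where "t2 = (\<lambda>y. t3 (y / 4) - t3 y)"
  define t4 where "t4 = (\<lambda>y. 2 * t3 (4 * y) - t3 y)"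
  have H: "\<i> * of_real (y / 2) \<in> upper_half" if "y > 0" for y using that by (simp add: upper_half_def)
  have t2: "theta1 (\<i> * of_real (y / 2)) = of_real (t2 y)" if "y > 0" for y
  proof -
    have "\<i> * of_real (y / 2) / 4 = \<i> * of_real (y / 4 / 2)" by simp
    then show ?thesis using theta_quarter[OF H[OF that]] t3[of y] t3[of "y / 4"] that
      by (simp add: t2_def eq_diff_eq add.commute)
  qed
  have t4: "theta (\<i> * of_real (y / 2) + 1/2) = of_real (t4 y)" if "y > 0" for y
  proof -
    have "\<i> * of_real (4 * y / 2) / 4 = \<i> * of_real (y / 2)" by simp
    then have "theta (\<i> * of_real (y / 2) + 1/2) = of_real (t3 (4 * y)) - of_real (t2 (4 * y))"
      using theta_half_shift[OF H[of "4 * y"]] t3(1)[of "4 * y"] t2[of "4 * y"] that by simp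
    then show ?thesis by (simp add: t4_def t2_def)
  qed
  have "(t3 (1 / y))\<^sup>2 / y = (t3 y)\<^sup>2"
  proof (rule agm_inversion[where ?t2.0 = t2 and ?t4.0 = t4])
    fix y :: real assume y: "y > 0"
    show "t3 y \<noteq> 0" using t3(2)[OF y] by simp
    show "t4 y \<noteq> 0" using t4[OF y] theta_nonzero[OF upper_half_shift(3)[OF H[OF y]]] by auto
    have two: "2 * (\<i> * complex_of_real (x / 2)) = \<i> * of_real (2 * x / 2)" for x by simp
    have eqs: "(t3 x)\<^sup>2 = (t3 (2 * x))\<^sup>2 + (t2 (2 * x))\<^sup>2"
      "(t4 x)\<^sup>2 = (t3 (2 * x))\<^sup>2 - (t2 (2 * x))\<^sup>2" "(t2 x)\<^sup>2 = 2 * t3 (2 * x) * t2 (2 * x)"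
      "t3 x * t4 x = (t4 (2 * x))\<^sup>2" if x: "x > 0" for x
    proof -
      have x2: "2 * x > 0" using x by simp
      have "(complex_of_real (t3 x))\<^sup>2 = (of_real (t3 (2 * x)))\<^sup>2 + (of_real (t2 (2 * x)))\<^sup>2"
        using theta_square[OF H[OF x]] unfolding two t3(1)[OF x] t3(1)[OF x2] t2[OF x2] .
      then show "(t3 x)\<^sup>2 = (t3 (2 * x))\<^sup>2 + (t2 (2 * x))\<^sup>2"
        unfolding of_real_power[symmetric] of_real_add[symmetric] of_real_eq_iff .
      have "(complex_of_real (t4 x))\<^sup>2 = (of_real (t3 (2 * x)))\<^sup>2 - (of_real (t2 (2 * x)))\<^sup>2"
        using theta_square_half_shift[OF H[OF x]] unfolding two t4[OF x] t3(1)[OF x2] t2[OF x2] .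
      then show "(t4 x)\<^sup>2 = (t3 (2 * x))\<^sup>2 - (t2 (2 * x))\<^sup>2"
        unfolding of_real_power[symmetric] of_real_diff[symmetric] of_real_eq_iff .
      have "(complex_of_real (t2 x))\<^sup>2 = 2 * of_real (t3 (2 * x)) * of_real (t2 (2 * x))"
        using theta1_square[OF H[OF x]] unfolding two t2[OF x] t3(1)[OF x2] t2[OF x2] .
      then have "complex_of_real ((t2 x)\<^sup>2) = of_real (2 * t3 (2 * x) * t2 (2 * x))" by simp
      then show "(t2 x)\<^sup>2 = 2 * t3 (2 * x) * t2 (2 * x)" unfolding of_real_eq_iff .
      have "of_real (t3 x) * of_real (t4 x) = (complex_of_real (t4 (2 * x)))\<^sup>2"
        using theta_times_half_shift[OF H[OF x]] unfolding two t4[OF x] t3(1)[OF x] t4[OF x2] .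
      then show "t3 x * t4 x = (t4 (2 * x))\<^sup>2"
        unfolding of_real_power[symmetric] of_real_mult[symmetric] of_real_eq_iff .
    qed
    show "(t3 y)\<^sup>2 + (t4 y)\<^sup>2 = 2 * (t3 (2 * y))\<^sup>2" using eqs[OF y] by simp
    show "t3 y * t4 y = (t4 (2 * y))\<^sup>2" using eqs[OF y] by simp
    show "(t3 y)\<^sup>2 + (t2 y)\<^sup>2 = (t3 (y / 2))\<^sup>2" using eqs[of "y / 2"] y by simp
    show "2 * t3 y * t2 y = (t2 (y / 2))\<^sup>2" using eqs[of "y / 2"] y by simp
    \<comment> \<open>Jacobi's quartic identity: factor the difference of fourth powers and apply
      the duplication formulas to both factors.\<close>
    have "t3 y ^ 4 - t4 y ^ 4 = ((t3 y)\<^sup>2 - (t4 y)\<^sup>2) * ((t3 y)\<^sup>2 + (t4 y)\<^sup>2)"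
      by (simp add: algebra_simps flip: power_add)
    also have "\<dots> = (2 * (t2 (2 * y))\<^sup>2) * (2 * (t3 (2 * y))\<^sup>2)"
      using eqs(1,2)[OF y] by simp
    also have "\<dots> = ((t2 y)\<^sup>2)\<^sup>2" unfolding eqs(3)[OF y] by (simp add: power2_eq_square)
    finally show "t3 y ^ 4 = t2 y ^ 4 + t4 y ^ 4" by (simp flip: power_mult)
  next
    show "(t3 \<longlongrightarrow> 1) at_top"
    proof (rule tendstoI)
      fix e :: real assume "e > 0"
      then obtain K where K: "\<And>\<tau>. Im \<tau> > K \<Longrightarrow> norm (theta \<tau> - 1) < e" using theta_limit by metis
      have "dist (t3 y) 1 < e" if "y > max 0 (2 * K)" for y
      proof -
        have "norm (theta (\<i> * of_real (y / 2)) - 1) < e" using that by (intro K) auto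
        then have "norm (complex_of_real (t3 y - 1)) < e" using t3(1)[of y] that by simp
        then show ?thesis unfolding norm_of_real by (simp add: dist_real_def)
      qed
      then show "\<forall>\<^sub>F y in at_top. dist (t3 y) 1 < e"
        using eventually_gt_at_top[of "max 0 (2 * K)"] by (auto elim: eventually_mono)
    qed
    have "((\<lambda>y. sqrt (1 / y) * t3 (1 / y) - 1) \<longlongrightarrow> 0) at_top"
    proof (rule Lim_null_comparison)
      show "\<forall>\<^sub>F y in at_top. norm (sqrt (1 / y) * t3 (1 / y) - 1) \<le> sqrt (1 / y)"
        using eventually_gt_at_top[of 0] by eventually_elim (use t3(3) in auto)
      show "((\<lambda>y::real. sqrt (1 / y)) \<longlongrightarrow> 0) at_top" by real_asymp
    qed
    then have "((\<lambda>y. sqrt (1 / y) * t3 (1 / y)) \<longlongrightarrow> 1) at_top"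
      by (rule LIM_zero_cancel)
    then have "((\<lambda>y. (sqrt (1 / y) * t3 (1 / y))\<^sup>2) \<longlongrightarrow> 1\<^sup>2) at_top" by (rule tendsto_power)
    moreover have "\<forall>\<^sub>F y in at_top. (sqrt (1 / y) * t3 (1 / y))\<^sup>2 = (t3 (1 / y))\<^sup>2 / y"
      using eventually_gt_at_top[of 0]
      by eventually_elim (simp add: power_mult_distrib real_sqrt_divide power_divide)
    ultimately show "((\<lambda>y. (t3 (1 / y))\<^sup>2 / y) \<longlongrightarrow> 1) at_top"
      using Lim_transform_eventually by fastforce
  qed (rule y)
  then have "(t3 (1 / y))\<^sup>2 = (sqrt y * t3 y)\<^sup>2" using y by (simp add: power_mult_distrib field_simps)
  then have "t3 (1 / y) = sqrt y * t3 y"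
    by (rule power2_eq_imp_eq) (use t3(2)[of y] t3(2)[of "1 / y"] y in auto)
  then have "complex_of_real (t3 (1 / y)) = of_real (sqrt y) * of_real (t3 y)" by (metis of_real_mult)
  then show ?thesis unfolding t3(1)[OF y] t3(1)[OF zero_less_one[THEN divide_pos_pos, OF y]] .
qed

text \<open>The principal branch is harmless: the argument has positive real part on the upper half plane.\<close>

definition sfac :: "complex \<Rightarrow> complex" where
  "sfac \<tau> = csqrt (\<tau> / (2 * \<i>))"

lemma sfac_arg_Re: "\<tau> \<in> upper_half \<Longrightarrow> Re (\<tau> / (2 * \<i>)) > 0"
  by (simp add: upper_half_def Re_divide)

lemma sfac_sq: "(sfac \<tau>)\<^sup>2 = \<tau> / (2 * \<i>)"
  by (simp add: sfac_def)

lemma sfac_nonzero: "\<tau> \<in> upper_half \<Longrightarrow> sfac \<tau> \<noteq> 0"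
  by (auto simp: sfac_def upper_half_def)

lemma sfac_holomorphic: "sfac holomorphic_on upper_half"
  unfolding sfac_def
  by (intro holomorphic_intros) (use sfac_arg_Re complex_nonpos_Reals_iff in force)+

text \<open>Both sides are holomorphic and agree on the positive imaginary axis, where the branch in
  \<open>sfac\<close> is the positive root; the identity theorem does the rest.\<close>

theorem theta_inversion:
  assumes "\<tau> \<in> upper_half"
  shows "theta (- 1 / \<tau>) = sfac \<tau> * theta (\<tau> / 4)"
proof -
  define f where "f = (\<lambda>\<tau>. theta (- 1 / \<tau>) - sfac \<tau> * theta (\<tau> / 4))"
  have c1: "(\<lambda>\<tau>. theta (- 1 / \<tau>)) holomorphic_on upper_half"
    by (rule holomorphic_on_compose_gen[OF _ theta_holomorphic, unfolded o_def])
       (auto intro!: holomorphic_intros simp: upper_half_nonzero simp del: upper_half_inversion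
             dest: upper_half_inversion)
  have c2: "(\<lambda>\<tau>. theta (\<tau> / 4)) holomorphic_on upper_half"
    by (rule holomorphic_on_compose_gen[OF _ theta_holomorphic, unfolded o_def])
       (auto intro!: holomorphic_intros)
  have f: "f holomorphic_on upper_half"
    unfolding f_def by (intro holomorphic_intros c1 c2 sfac_holomorphic)
  have "f \<tau> = 0"
  proof (rule analytic_continuation[OF f])
    show "{\<i> * of_real y |y. y > 0} \<subseteq> upper_half" by (auto simp: upper_half_def)
    show "\<i> \<in> upper_half" by (simp add: upper_half_def)
    show "\<i> islimpt {\<i> * of_real y |y. y > 0}"
    proof (unfold islimpt_sequential, intro exI conjI allI)
      show "\<i> * of_real (1 + 1 / real (Suc n)) \<in> {\<i> * of_real y |y. y > 0} - {\<i>}" for n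
      proof -
        define x where "x = 1 + 1 / real (Suc n)"
        have "x > 0" "x \<noteq> 1" by (auto intro: add_pos_nonneg simp: x_def)
        moreover from this have "\<i> * of_real x \<noteq> \<i>" by (auto simp: complex_eq_iff)
        ultimately show ?thesis unfolding x_def[symmetric] by blast
      qed
      have "(\<lambda>n. 1 + 1 / real (Suc n)) \<longlonglongrightarrow> 1" by real_asymp
      then have "(\<lambda>n. \<i> * of_real (1 + 1 / real (Suc n))) \<longlonglongrightarrow> \<i> * of_real 1"
        by (intro tendsto_intros)
      then show "(\<lambda>n. \<i> * of_real (1 + 1 / real (Suc n))) \<longlonglongrightarrow> \<i>" by simp
    qed
    fix z assume "z \<in> {\<i> * of_real y |y. y > 0}"
    then obtain y where y: "z = \<i> * of_real y" "y > 0" by auto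
    have "- 1 / z = \<i> * of_real (1 / (y / 2) / 2)" using y by (simp add: field_simps)
    moreover have "z / 4 = \<i> * of_real (y / 2 / 2)" using y by simp
    moreover have "sfac z = of_real (sqrt (y / 2))"
    proof -
      have "z / (2 * \<i>) = of_real (y / 2)" using y by simp
      then show ?thesis unfolding sfac_def using y by (simp add: csqrt_of_real_nonneg del: of_real_divide)
    qed
    ultimately show "f z = 0"
      using theta_inversion_imaginary[of "y / 2"] y unfolding f_def by (metis diff_self half_gt_zero)
  qed (use assms connected_upper_half in auto)
  then show ?thesis by (simp add: f_def)
qed

lemma theta_S:
  assumes "\<tau> \<in> upper_half"
  shows "theta (- 1 / \<tau>) = sfac \<tau> * (theta \<tau> + theta1 \<tau>)"
  using theta_inversion[OF assms] theta_quarter[OF assms] by simp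

text \<open>The square of the product is 1/4. Both principal roots have positive real part, which
  excludes the value -1/2.\<close>

lemma sfac_inversion:
  assumes "\<tau> \<in> upper_half"
  shows "sfac \<tau> * sfac (- 1 / \<tau>) = 1 / 2"
proof -
  define z where "z = sfac \<tau>"
  define w where "w = sfac (- 1 / \<tau>)"
  have "(z * w)\<^sup>2 = (1/2)\<^sup>2"
    unfolding power_mult_distrib z_def w_def sfac_sq
    using upper_half_nonzero[OF assms] by (simp add: power2_eq_square)
  then have "z * w = 1/2 \<or> z * w = - (1/2)" unfolding power2_eq_iff .
  moreover have "z * w \<noteq> - (1/2)"
  proof
    assume zw: "z * w = - (1/2)"
    have "Re z > 0" "Re w > 0"
      using sfac_arg_Re[OF assms] sfac_arg_Re[OF upper_half_inversion[OF assms]]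
      unfolding z_def w_def sfac_def by (auto simp: add_nonneg_pos)
    moreover have "Re w * (norm z)\<^sup>2 = - Re z / 2"
    proof -
      \<comment> \<open>Multiplying by |z|^2 = z cnj z turns z w = -1/2 into an equation for w |z|^2
        whose right side has negative real part.\<close>
      have "w * of_real ((norm z)\<^sup>2) = (z * w) * cnj z" by (simp only: complex_norm_square mult_ac)
      then have "w * of_real ((norm z)\<^sup>2) = - (1/2) * cnj z" unfolding zw .
      then have "Re (w * of_real ((norm z)\<^sup>2)) = Re (- (1/2) * cnj z)" by (rule arg_cong)
      then show ?thesis unfolding Re_complex_of_real times_complex.simps by simp
    qed
    moreover have "Re w * (norm z)\<^sup>2 \<ge> 0" using \<open>Re w > 0\<close> by simp
    ultimately show False by simp
  qed
  ultimately show ?thesis by (simp add: z_def w_def)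
qed

text \<open>The inversion is an involution: \<open>theta_S\<close> at -1/\<tau> expresses theta
  \<tau> through both transformed constants, and it is solved for the second one.\<close>

lemma theta1_S:
  assumes "\<tau> \<in> upper_half"
  shows "theta1 (- 1 / \<tau>) = sfac \<tau> * (theta \<tau> - theta1 \<tau>)"
proof -
  have H: "- 1 / \<tau> \<in> upper_half" using assms by (rule upper_half_inversion)
  have "- 1 / (- 1 / \<tau>) = \<tau>" by simp
  then have "theta \<tau> = sfac (- 1 / \<tau>) * (theta (- 1 / \<tau>) + theta1 (- 1 / \<tau>))"
    using theta_S[OF H] by simp
  then have E: "sfac \<tau> * theta \<tau> = 1/2 * (theta (- 1 / \<tau>) + theta1 (- 1 / \<tau>))"
    using sfac_inversion[OF assms] by (metis mult.assoc)
  have "2 * (sfac \<tau> * theta \<tau>) = theta (- 1 / \<tau>) + theta1 (- 1 / \<tau>)" unfolding E by simp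
  then have "theta1 (- 1 / \<tau>) = 2 * (sfac \<tau> * theta \<tau>) - theta (- 1 / \<tau>)" by (simp only: add_diff_cancel_left')
  then show ?thesis using theta_S[OF assms] by (simp add: algebra_simps)
qed

text \<open>The inversion turns \<open>theta1\<close> into a value of \<open>theta\<close> at a
  shift by 1/2, so the absence of zeros carries over.\<close>

lemma theta1_nonzero:
  assumes "\<tau> \<in> upper_half"
  shows "theta1 \<tau> \<noteq> 0"
proof -
  have H: "- 1 / \<tau> \<in> upper_half" using assms by (rule upper_half_inversion)
  have "theta1 (- 1 / (- 1 / \<tau>)) = sfac (- 1 / \<tau>) * theta ((- 1 / \<tau>) / 4 + 1/2)"
    using theta1_S[OF H] theta_half_shift[OF H] by simp
  moreover have "- 1 / (- 1 / \<tau>) = \<tau>" by simp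
  ultimately show ?thesis
    using sfac_nonzero[OF H] theta_nonzero[OF upper_half_shift(3)[OF upper_half_scale(3)[OF H]]] by simp
qed

section \<open>Vector-valued forms\<close>

definition has_qs :: "complex \<Rightarrow> (int \<Rightarrow> complex) \<Rightarrow> (complex \<Rightarrow> complex) \<Rightarrow> bool" where
  "has_qs \<kappa> \<alpha> F \<longleftrightarrow>
     (\<forall>\<tau>\<in>upper_half. ((\<lambda>n::int. \<alpha> n * ee ((of_int n + \<kappa>) * \<tau>)) has_sum F \<tau>) UNIV)"

lemma has_qs_lin:
  assumes "has_qs \<kappa> \<alpha> F" "has_qs \<kappa> \<beta> G"
  shows "has_qs \<kappa> (\<lambda>n. x * \<alpha> n + y * \<beta> n) (\<lambda>\<tau>. x * F \<tau> + y * G \<tau>)"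
  unfolding has_qs_def
proof
  fix \<tau> assume "\<tau> \<in> upper_half"
  then have "((\<lambda>n::int. x * (\<alpha> n * ee ((of_int n + \<kappa>) * \<tau>)) + y * (\<beta> n * ee ((of_int n + \<kappa>) * \<tau>)))
      has_sum (x * F \<tau> + y * G \<tau>)) UNIV"
    using assms unfolding has_qs_def by (intro has_sum_add has_sum_cmult_right) auto
  then show "((\<lambda>n. (x * \<alpha> n + y * \<beta> n) * ee ((of_int n + \<kappa>) * \<tau>)) has_sum (x * F \<tau> + y * G \<tau>)) UNIV"
    by (simp add: algebra_simps)
qed

lemma range_shift_int: "range (\<lambda>k. u + int k) = {u..}"
proof -
  have "n \<in> range (\<lambda>k. u + int k)" if "n \<ge> u" for n
  proof -
    have "n = u + int (nat (n - u))" using that by simp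
    then show ?thesis by blast
  qed
  then show ?thesis by auto
qed

lemma has_sum_int_from:
  fixes f :: "int \<Rightarrow> complex"
  assumes "\<And>n. n < u \<Longrightarrow> f n = 0"
  shows "(f has_sum S) UNIV \<longleftrightarrow> ((\<lambda>k. f (u + int k)) has_sum S) UNIV"
proof -
  have "(f has_sum S) UNIV \<longleftrightarrow> (f has_sum S) {u..}"
    by (rule has_sum_cong_neutral) (use assms in auto)
  also have "\<dots> \<longleftrightarrow> (f \<circ> (\<lambda>k. u + int k) has_sum S) UNIV"
    unfolding range_shift_int[symmetric] by (rule has_sum_reindex) (simp add: inj_on_def)
  finally show ?thesis by (simp add: o_def)
qed

lemma qs_of_holomorphic:
  assumes h: "h holomorphic_on ball 0 1"
    and F: "\<And>\<tau>. \<tau> \<in> upper_half \<Longrightarrow> F \<tau> = ee ((of_int u + \<kappa>) * \<tau>) * h (ee \<tau>)"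
  obtains \<alpha> where "has_qs \<kappa> \<alpha> F" "\<And>n. n < u \<Longrightarrow> \<alpha> n = 0" "\<alpha> u = h 0"
proof -
  define c where "c = (\<lambda>n. (deriv ^^ n) h 0 / fact n)"
  define \<alpha> where "\<alpha> = (\<lambda>n. if n < u then 0 else c (nat (n - u)))"
  have sums: "(\<lambda>k. c k * w ^ k) sums h w" if "w \<in> ball 0 1" for w
    using holomorphic_power_series[OF h that] by (simp add: c_def)
  have hs: "((\<lambda>k. c k * w ^ k) has_sum h w) UNIV" if w: "w \<in> ball 0 1" for w
  proof (rule norm_summable_imp_has_sum[OF _ sums[OF w]])
    define x where "x = complex_of_real ((1 + norm w) / 2)"
    have x: "norm x = (1 + norm w) / 2" unfolding x_def norm_of_real by simp
    have "summable (\<lambda>k. c k * x ^ k)" using sums[of x] w x by (auto simp: sums_iff)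
    then show "summable (\<lambda>k. norm (c k * w ^ k))" by (rule powser_insidea) (use w x in auto)
  qed
  show thesis
  proof
    show "has_qs \<kappa> \<alpha> F" unfolding has_qs_def
    proof
      fix \<tau> assume t: "\<tau> \<in> upper_half"
      have "((\<lambda>k. ee ((of_int u + \<kappa>) * \<tau>) * (c k * ee \<tau> ^ k)) has_sum F \<tau>) UNIV"
        unfolding F[OF t] by (intro has_sum_cmult_right hs ee_in_ball t)
      moreover have "ee ((of_int u + \<kappa>) * \<tau>) * (c k * ee \<tau> ^ k) = \<alpha> (u + int k) * ee ((of_int (u + int k) + \<kappa>) * \<tau>)" for k
      proof -
        have "ee ((of_int (u + int k) + \<kappa>) * \<tau>) = ee ((of_int u + \<kappa>) * \<tau> + of_nat k * \<tau>)"
          by (simp add: algebra_simps)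
        then show ?thesis by (simp add: \<alpha>_def ee_add ee_of_nat_mult)
      qed
      ultimately show "((\<lambda>n. \<alpha> n * ee ((of_int n + \<kappa>) * \<tau>)) has_sum F \<tau>) UNIV"
        by (subst has_sum_int_from[of u]) (auto simp: \<alpha>_def)
    qed
  qed (auto simp: \<alpha>_def c_def)
qed

lemma holomorphic_of_qs:
  assumes qs: "has_qs \<kappa> \<alpha> F" and u: "\<And>n. n < u \<Longrightarrow> \<alpha> n = 0"
  obtains h where "h holomorphic_on ball 0 1" "h 0 = \<alpha> u"
    "\<And>\<tau>. \<tau> \<in> upper_half \<Longrightarrow> F \<tau> = ee ((of_int u + \<kappa>) * \<tau>) * h (ee \<tau>)"
    "(\<And>\<tau>. \<tau> \<in> upper_half \<Longrightarrow> F \<tau> = 0) \<Longrightarrow> \<alpha> = (\<lambda>_. 0)"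
proof -
  define c where "c = (\<lambda>k. \<alpha> (u + int k))"
  define h where "h = (\<lambda>w. \<Sum>k. c k * w ^ k)"
  have *: "((\<lambda>k. c k * ee \<tau> ^ k) has_sum F \<tau> / ee ((of_int u + \<kappa>) * \<tau>)) UNIV" if t: "\<tau> \<in> upper_half" for \<tau>
  proof -
    have "((\<lambda>n. \<alpha> n * ee ((of_int n + \<kappa>) * \<tau>)) has_sum F \<tau>) UNIV"
      using qs t by (simp add: has_qs_def)
    then have "((\<lambda>k. \<alpha> (u + int k) * ee ((of_int (u + int k) + \<kappa>) * \<tau>)) has_sum F \<tau>) UNIV"
      by (subst (asm) has_sum_int_from[of u]) (auto simp: u)
    then have "((\<lambda>k. \<alpha> (u + int k) * ee ((of_int (u + int k) + \<kappa>) * \<tau>) / ee ((of_int u + \<kappa>) * \<tau>)) has_sum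
        F \<tau> / ee ((of_int u + \<kappa>) * \<tau>)) UNIV"
      by (rule has_sum_divide_const)
    moreover have "\<alpha> (u + int k) * ee ((of_int (u + int k) + \<kappa>) * \<tau>) / ee ((of_int u + \<kappa>) * \<tau>) = c k * ee \<tau> ^ k" for k
    proof -
      have "ee ((of_int (u + int k) + \<kappa>) * \<tau>) = ee ((of_int u + \<kappa>) * \<tau> + of_nat k * \<tau>)"
        by (simp add: algebra_simps)
      then show ?thesis by (simp add: c_def ee_add ee_of_nat_mult)
    qed
    ultimately show ?thesis by simp
  qed
  have val: "h (ee \<tau>) = F \<tau> / ee ((of_int u + \<kappa>) * \<tau>)" if t: "\<tau> \<in> upper_half" for \<tau>
    unfolding h_def using has_sum_imp_sums[OF *[OF t]] by (simp add: sums_iff)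
  \<comment> \<open>Every nonzero w in the disc is some ee \<tau>, so convergence on the upper half
    plane already makes the power series converge on the whole disc.\<close>
  have sums: "(\<lambda>k. c k * (w - 0) ^ k) sums h w" if w: "w \<in> ball 0 1" for w
  proof (cases "w = 0")
    case True
    then show ?thesis unfolding h_def using powser_sums_zero[of c] by (simp add: sums_iff)
  next
    case False
    then obtain \<tau> where t: "\<tau> \<in> upper_half" "ee \<tau> = w" using ee_surj_ball w by blast
    then show ?thesis using has_sum_imp_sums[OF *[OF t(1)]] val[OF t(1)] by simp
  qed
  show thesis
  proof
    show holo: "h holomorphic_on ball 0 1" by (rule power_series_holomorphic[OF sums])
    show h0: "h 0 = \<alpha> u" unfolding h_def by (simp add: c_def)
    show "F \<tau> = ee ((of_int u + \<kappa>) * \<tau>) * h (ee \<tau>)" if "\<tau> \<in> upper_half" for \<tau>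
      using val[OF that] by simp
    assume z: "\<And>\<tau>. \<tau> \<in> upper_half \<Longrightarrow> F \<tau> = 0"
    have hz: "h w = 0" if "w \<in> ball 0 1" "w \<noteq> 0" for w
      using that ee_surj_ball[OF that] val z by (metis div_0)
    have h00: "h 0 = 0"
    proof -
      have "h \<midarrow>0\<rightarrow> h 0"
        using holomorphic_on_imp_continuous_on[OF holo] by (simp add: continuous_on_eq_continuous_at isCont_def)
      moreover have "h \<midarrow>0\<rightarrow> 0"
      proof (rule Lim_transform_eventually[OF tendsto_const])
        have "\<forall>\<^sub>F w in at (0::complex). w \<in> ball 0 1 - {0}"
          by (rule eventually_at_in_open) auto
        then show "\<forall>\<^sub>F w in at 0. 0 = h w"
          by eventually_elim (use hz in auto)
      qed
      ultimately show ?thesis using LIM_unique by blast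
    qed
    have "c m = 0" for m
    proof (rule ccontr)
      assume m: "c m \<noteq> 0"
      have "c 0 = 0" using h00 h0 by (simp add: c_def)
      with m have "m > 0" by (cases m) auto
      \<comment> \<open>Uniqueness of coefficients: zeros of a nontrivial power series are isolated,
        yet h vanishes on the whole disc.\<close>
      obtain s where s: "0 < s" "\<And>z. z \<in> cball 0 s - {0} \<Longrightarrow> h z \<noteq> 0"
        by (rule powser_0_nonzero[of 1 0 c h m]) (use sums h00 \<open>m > 0\<close> m in \<open>auto simp: dist_norm\<close>)
      define z where "z = complex_of_real (min s (1/2))"
      have "z \<in> cball 0 s - {0}" "z \<in> ball 0 1" "z \<noteq> 0" using s(1)
        by (auto simp: z_def simp del: of_real_divide)
      then show False using s(2) hz by blast
    qed
    then have "\<alpha> n = 0" for n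
    proof (cases "n < u")
      case False
      then have "n = u + int (nat (n - u))" by simp
      then show ?thesis using \<open>\<And>m. c m = 0\<close> unfolding c_def by metis
    qed (use u in auto)
    then show "\<alpha> = (\<lambda>_. 0)" by auto
  qed
qed

text \<open>A form of weight \<open>t + 1/2\<close> in the plus space is \<open>F(4\<tau>) + G(4\<tau>)\<close>, where \<open>F\<close> collects the exponents
  divisible by 4 and \<open>G\<close> has exponents in \<open>\<int> \<plusminus> 1/4\<close>; the pair \<open>(F, G)\<close> transforms under all of SL(2,Z). The
  coefficient sequences \<open>\<alpha>, \<beta>\<close> in \<open>vv\<close> are indexed by the integral part of the exponent.\<close>

definition ceps :: "int \<Rightarrow> complex" where
  "ceps t = of_int (sgnpow t) / 4"

text \<open>For even t the factor \<open>cS t * sfac \<tau> powi (2 * t + 1)\<close> is just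
  \<tau>^t \<open>sfac \<tau>\<close>, by \<open>sfac_sq\<close>. The value is dictated by the plus
  space: it is half of (1 - i)^(2t+1) + (1 + i)^(2t+1), see \<open>cS_sum\<close>.\<close>

definition cS :: "int \<Rightarrow> complex" where
  "cS t = (2 * \<i>) powi t * (if even t then 1 else \<i>)"

definition vvf :: "int \<Rightarrow> (complex \<Rightarrow> complex) \<Rightarrow> (complex \<Rightarrow> complex) \<Rightarrow> bool" where
  "vvf t F G \<longleftrightarrow> (\<forall>\<tau>\<in>upper_half.
      F (- 1 / \<tau>) = cS t * sfac \<tau> powi (2 * t + 1) * (F \<tau> + G \<tau>) \<and>
      G (- 1 / \<tau>) = cS t * sfac \<tau> powi (2 * t + 1) * (F \<tau> - G \<tau>))"

definition vv :: "int \<Rightarrow> (int \<Rightarrow> complex) \<Rightarrow> (int \<Rightarrow> complex) \<Rightarrow> bool" where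
  "vv t \<alpha> \<beta> \<longleftrightarrow> (\<exists>u. \<forall>n<u. \<alpha> n = 0 \<and> \<beta> n = 0) \<and>
     (\<exists>F G. has_qs 0 \<alpha> F \<and> has_qs (ceps t) \<beta> G \<and> vvf t F G)"

lemma vv_lin:
  assumes "vv t \<alpha> \<beta>" "vv t \<alpha>' \<beta>'"
  shows "vv t (\<lambda>n. x * \<alpha> n + y * \<alpha>' n) (\<lambda>n. x * \<beta> n + y * \<beta>' n)"
proof -
  obtain u F G where 1: "\<And>n. n < u \<Longrightarrow> \<alpha> n = 0 \<and> \<beta> n = 0"
      "has_qs 0 \<alpha> F" "has_qs (ceps t) \<beta> G" "vvf t F G"
    using assms(1) unfolding vv_def by metis
  obtain u' F' G' where 2: "\<And>n. n < u' \<Longrightarrow> \<alpha>' n = 0 \<and> \<beta>' n = 0"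
      "has_qs 0 \<alpha>' F'" "has_qs (ceps t) \<beta>' G'" "vvf t F' G'"
    using assms(2) unfolding vv_def by metis
  have "vvf t (\<lambda>\<tau>. x * F \<tau> + y * F' \<tau>) (\<lambda>\<tau>. x * G \<tau> + y * G' \<tau>)"
    unfolding vvf_def
  proof
    fix \<tau> assume t: "\<tau> \<in> upper_half"
    define c where "c = cS t * sfac \<tau> powi (2 * t + 1)"
    have E: "F (- 1 / \<tau>) = c * (F \<tau> + G \<tau>)" "G (- 1 / \<tau>) = c * (F \<tau> - G \<tau>)"
        "F' (- 1 / \<tau>) = c * (F' \<tau> + G' \<tau>)" "G' (- 1 / \<tau>) = c * (F' \<tau> - G' \<tau>)"
      using 1(4) 2(4) t unfolding vvf_def c_def by auto
    show "x * F (- 1 / \<tau>) + y * F' (- 1 / \<tau>) =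
        cS t * sfac \<tau> powi (2 * t + 1) * (x * F \<tau> + y * F' \<tau> + (x * G \<tau> + y * G' \<tau>)) \<and>
      x * G (- 1 / \<tau>) + y * G' (- 1 / \<tau>) =
        cS t * sfac \<tau> powi (2 * t + 1) * (x * F \<tau> + y * F' \<tau> - (x * G \<tau> + y * G' \<tau>))"
      unfolding c_def[symmetric] E by (simp add: algebra_simps)
  qed
  moreover have "\<forall>n<min u u'. x * \<alpha> n + y * \<alpha>' n = 0 \<and> x * \<beta> n + y * \<beta>' n = 0" using 1(1) 2(1) by auto
  ultimately show ?thesis unfolding vv_def
    using has_qs_lin[OF 1(2) 2(2)] has_qs_lin[OF 1(3) 2(3)] by blast
qed

lemma vv_zero: "vv t (\<lambda>_. 0) (\<lambda>_. 0)"
  unfolding vv_def has_qs_def vvf_def by (intro conjI exI[of _ "\<lambda>_. 0"]) auto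

lemma vv_sum:
  assumes "finite I" "\<And>i. i \<in> I \<Longrightarrow> vv t (\<alpha> i) (\<beta> i)"
  shows "vv t (\<lambda>n. \<Sum>i\<in>I. c i * \<alpha> i n) (\<lambda>n. \<Sum>i\<in>I. c i * \<beta> i n)"
  using assms
proof (induction I rule: finite_induct)
  case (insert i I)
  then show ?case using vv_lin[of t "\<alpha> i" "\<beta> i" "\<lambda>n. \<Sum>i\<in>I. c i * \<alpha> i n" "\<lambda>n. \<Sum>i\<in>I. c i * \<beta> i n" "c i" 1]
    by simp
qed (simp add: vv_zero)

lemma vv_functions:
  assumes vv: "vv t \<alpha> \<beta>" and u: "\<And>n. n < u \<Longrightarrow> \<alpha> n = 0" and v: "\<And>n. n < v \<Longrightarrow> \<beta> n = 0"
  obtains F G h k where "h holomorphic_on ball 0 1" "k holomorphic_on ball 0 1" "h 0 = \<alpha> u" "k 0 = \<beta> v"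
    "\<And>\<tau>. \<tau> \<in> upper_half \<Longrightarrow> F \<tau> = ee (of_int u * \<tau>) * h (ee \<tau>)"
    "\<And>\<tau>. \<tau> \<in> upper_half \<Longrightarrow> G \<tau> = ee ((of_int v + ceps t) * \<tau>) * k (ee \<tau>)"
    "vvf t F G" "has_qs 0 \<alpha> F" "has_qs (ceps t) \<beta> G"
    "(\<And>\<tau>. \<tau> \<in> upper_half \<Longrightarrow> F \<tau> = 0) \<Longrightarrow> \<alpha> = (\<lambda>_. 0)"
    "(\<And>\<tau>. \<tau> \<in> upper_half \<Longrightarrow> G \<tau> = 0) \<Longrightarrow> \<beta> = (\<lambda>_. 0)"
proof -
  obtain F G where FG: "has_qs 0 \<alpha> F" "has_qs (ceps t) \<beta> G" "vvf t F G"
    using vv unfolding vv_def by blast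
  obtain h where h: "h holomorphic_on ball 0 1" "h 0 = \<alpha> u"
    "\<And>\<tau>. \<tau> \<in> upper_half \<Longrightarrow> F \<tau> = ee ((of_int u + 0) * \<tau>) * h (ee \<tau>)"
    "(\<And>\<tau>. \<tau> \<in> upper_half \<Longrightarrow> F \<tau> = 0) \<Longrightarrow> \<alpha> = (\<lambda>_. 0)"
    using holomorphic_of_qs[OF FG(1) u] by blast
  obtain k where k: "k holomorphic_on ball 0 1" "k 0 = \<beta> v"
    "\<And>\<tau>. \<tau> \<in> upper_half \<Longrightarrow> G \<tau> = ee ((of_int v + ceps t) * \<tau>) * k (ee \<tau>)"
    "(\<And>\<tau>. \<tau> \<in> upper_half \<Longrightarrow> G \<tau> = 0) \<Longrightarrow> \<beta> = (\<lambda>_. 0)"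
    using holomorphic_of_qs[OF FG(2) v] by blast
  show thesis
    by (rule that[OF h(1) k(1) h(2) k(2) _ k(3) FG(3) FG(1) FG(2)]) (use h(3,4) k(4) in auto)
qed

lemma vvI:
  assumes "h holomorphic_on ball 0 1" "k holomorphic_on ball 0 1"
    "\<And>\<tau>. \<tau> \<in> upper_half \<Longrightarrow> F \<tau> = ee (of_int u * \<tau>) * h (ee \<tau>)"
    "\<And>\<tau>. \<tau> \<in> upper_half \<Longrightarrow> G \<tau> = ee ((of_int v + ceps t) * \<tau>) * k (ee \<tau>)"
    "vvf t F G"
  shows "\<exists>\<alpha> \<beta>. vv t \<alpha> \<beta> \<and> (\<forall>n<u. \<alpha> n = 0) \<and> (\<forall>n<v. \<beta> n = 0) \<and> \<alpha> u = h 0 \<and> \<beta> v = k 0"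
proof -
  obtain \<alpha> where a: "has_qs 0 \<alpha> F" "\<And>n. n < u \<Longrightarrow> \<alpha> n = 0" "\<alpha> u = h 0"
    using qs_of_holomorphic[OF assms(1), of F u 0] assms(3) by auto
  obtain \<beta> where b: "has_qs (ceps t) \<beta> G" "\<And>n. n < v \<Longrightarrow> \<beta> n = 0" "\<beta> v = k 0"
    using qs_of_holomorphic[OF assms(2), of G v "ceps t"] assms(4) by auto
  have "vv t \<alpha> \<beta>" unfolding vv_def using a b assms(5) by (intro conjI exI[of _ "min u v"]) auto
  then show ?thesis using a b by blast
qed

section \<open>Scalar level one forms and octahedral invariants\<close>

text \<open>Level one forms of weight \<open>w\<close> with \<open>q\<close>-expansion \<open>q\<^sup>n + \<dots>\<close>, allowing poles at the cusp.\<close>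

definition scal :: "int \<Rightarrow> int \<Rightarrow> (complex \<Rightarrow> complex) \<Rightarrow> bool" where
  "scal w n A \<longleftrightarrow>
     (\<exists>h. h holomorphic_on ball 0 1 \<and> h 0 = 1 \<and> (\<forall>\<tau>\<in>upper_half. A \<tau> = ee (of_int n * \<tau>) * h (ee \<tau>))) \<and>
     (\<forall>\<tau>\<in>upper_half. A (- 1 / \<tau>) = \<tau> powi w * A \<tau>)"

lemma scal_mult:
  assumes "scal w n A" "scal w' n' B"
  shows "scal (w + w') (n + n') (\<lambda>\<tau>. A \<tau> * B \<tau>)"
proof -
  obtain h where h: "h holomorphic_on ball 0 1" "h 0 = 1" "\<And>\<tau>. \<tau> \<in> upper_half \<Longrightarrow> A \<tau> = ee (of_int n * \<tau>) * h (ee \<tau>)"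
    using assms(1) unfolding scal_def by auto
  obtain k where k: "k holomorphic_on ball 0 1" "k 0 = 1" "\<And>\<tau>. \<tau> \<in> upper_half \<Longrightarrow> B \<tau> = ee (of_int n' * \<tau>) * k (ee \<tau>)"
    using assms(2) unfolding scal_def by auto
  show ?thesis unfolding scal_def
  proof (intro conjI exI[of _ "\<lambda>w. h w * k w"] ballI)
    show "(\<lambda>w. h w * k w) holomorphic_on ball 0 1" by (intro holomorphic_intros h k)
    show "h 0 * k 0 = 1" by (simp add: h k)
    fix \<tau> assume t: "\<tau> \<in> upper_half"
    show "A \<tau> * B \<tau> = ee (of_int (n + n') * \<tau>) * (h (ee \<tau>) * k (ee \<tau>))"
      using h(3)[OF t] k(3)[OF t] by (simp add: ring_distribs ee_add)
    show "A (- 1 / \<tau>) * B (- 1 / \<tau>) = \<tau> powi (w + w') * (A \<tau> * B \<tau>)"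
      using assms t upper_half_nonzero[OF t] unfolding scal_def by (simp add: power_int_add)
  qed
qed

lemma powi_double: "(x::complex) powi (2 * w) = (x\<^sup>2) powi w"
  by (simp add: power_int_mult)

text \<open>An even w keeps the parity of t and with it the offset \<open>ceps t\<close>; the
  automorphy factors match because (2 i)^w (\<tau> / (2 i))^w = \<tau>^w. Leading coefficients
  survive because A is normalized.\<close>

lemma vv_scal:
  assumes A: "scal w n A" and w: "even w" and vv: "vv t \<alpha> \<beta>"
    and u: "\<And>n. n < u \<Longrightarrow> \<alpha> n = 0" and v: "\<And>n. n < v \<Longrightarrow> \<beta> n = 0"
  shows "\<exists>\<alpha>' \<beta>'. vv (t + w) \<alpha>' \<beta>' \<and> (\<forall>k<u + n. \<alpha>' k = 0) \<and> (\<forall>k<v + n. \<beta>' k = 0) \<and>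
      \<alpha>' (u + n) = \<alpha> u \<and> \<beta>' (v + n) = \<beta> v"
proof -
  obtain F G h k where FG: "h holomorphic_on ball 0 1" "k holomorphic_on ball 0 1" "h 0 = \<alpha> u" "k 0 = \<beta> v"
    "\<And>\<tau>. \<tau> \<in> upper_half \<Longrightarrow> F \<tau> = ee (of_int u * \<tau>) * h (ee \<tau>)"
    "\<And>\<tau>. \<tau> \<in> upper_half \<Longrightarrow> G \<tau> = ee ((of_int v + ceps t) * \<tau>) * k (ee \<tau>)"
    "vvf t F G" by (rule vv_functions[OF vv u v]) blast+
  obtain a where a: "a holomorphic_on ball 0 1" "a 0 = 1" "\<And>\<tau>. \<tau> \<in> upper_half \<Longrightarrow> A \<tau> = ee (of_int n * \<tau>) * a (ee \<tau>)"
    using A unfolding scal_def by auto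
  have ce: "ceps (t + w) = ceps t" using w by (simp add: ceps_def sgnpow_def)
  have "\<exists>\<alpha>' \<beta>'. vv (t + w) \<alpha>' \<beta>' \<and> (\<forall>k<u + n. \<alpha>' k = 0) \<and> (\<forall>k<v + n. \<beta>' k = 0) \<and>
      \<alpha>' (u + n) = a 0 * h 0 \<and> \<beta>' (v + n) = a 0 * k 0"
  proof (rule vvI[where F = "\<lambda>\<tau>. A \<tau> * F \<tau>" and G = "\<lambda>\<tau>. A \<tau> * G \<tau>"])
    show "(\<lambda>w. a w * h w) holomorphic_on ball 0 1" "(\<lambda>w. a w * k w) holomorphic_on ball 0 1"
      by (intro holomorphic_intros FG a)+
    show "A \<tau> * F \<tau> = ee (of_int (u + n) * \<tau>) * (a (ee \<tau>) * h (ee \<tau>))" if "\<tau> \<in> upper_half" for \<tau>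
      using a(3)[OF that] FG(5)[OF that] by (simp add: ring_distribs ee_add)
    show "A \<tau> * G \<tau> = ee ((of_int (v + n) + ceps (t + w)) * \<tau>) * (a (ee \<tau>) * k (ee \<tau>))" if "\<tau> \<in> upper_half" for \<tau>
      using a(3)[OF that] FG(6)[OF that] by (simp add: ring_distribs ee_add ce)
    show "vvf (t + w) (\<lambda>\<tau>. A \<tau> * F \<tau>) (\<lambda>\<tau>. A \<tau> * G \<tau>)" unfolding vvf_def
    proof
      fix \<tau> assume t: "\<tau> \<in> upper_half"
      note [simp] = upper_half_nonzero[OF t] sfac_nonzero[OF t]
      have "sfac \<tau> powi (2 * (t + w) + 1) = sfac \<tau> powi (2 * t + 1) * (\<tau> / (2 * \<i>)) powi w"
        unfolding sfac_sq[symmetric] powi_double[symmetric] by (simp flip: power_int_add add: algebra_simps)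
      then have "cS (t + w) * sfac \<tau> powi (2 * (t + w) + 1) = \<tau> powi w * (cS t * sfac \<tau> powi (2 * t + 1))"
      proof -
        have "(2 * \<i>) powi w * (\<tau> / (2 * \<i>)) powi w = \<tau> powi w"
          unfolding power_int_mult_distrib[symmetric] by simp
        moreover have "cS (t + w) = cS t * (2 * \<i>) powi w" using w by (simp add: cS_def power_int_add)
        ultimately show ?thesis using \<open>sfac \<tau> powi (2 * (t + w) + 1) = _\<close> by (metis mult.assoc mult.commute)
      qed
      then show "A (- 1 / \<tau>) * F (- 1 / \<tau>) = cS (t + w) * sfac \<tau> powi (2 * (t + w) + 1) * (A \<tau> * F \<tau> + A \<tau> * G \<tau>) \<and>
        A (- 1 / \<tau>) * G (- 1 / \<tau>) = cS (t + w) * sfac \<tau> powi (2 * (t + w) + 1) * (A \<tau> * F \<tau> - A \<tau> * G \<tau>)"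
        using A FG(7) t unfolding scal_def vvf_def by (simp add: ring_distribs mult_ac)
    qed
  qed
  then show ?thesis by (simp add: a FG)
qed

text \<open>The ring of octahedral invariants in the two theta constants contains \<open>2\<eta>\<^sup>6\<close> (as a semi-invariant) and the
  Eisenstein series of weights 4 and 6.\<close>

definition sextic :: "complex \<Rightarrow> complex" where
  "sextic \<tau> = theta \<tau> * theta1 \<tau> * (theta \<tau> ^ 4 - theta1 \<tau> ^ 4)"

definition E4 :: "complex \<Rightarrow> complex" where
  "E4 \<tau> = theta \<tau> ^ 8 + 14 * theta \<tau> ^ 4 * theta1 \<tau> ^ 4 + theta1 \<tau> ^ 8"

definition E6 :: "complex \<Rightarrow> complex" where
  "E6 \<tau> = (theta \<tau> ^ 4 + theta1 \<tau> ^ 4) * (theta \<tau> ^ 8 - 34 * theta \<tau> ^ 4 * theta1 \<tau> ^ 4 + theta1 \<tau> ^ 8)"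

text \<open>The sextic is a product of six linear forms in the two theta constants, and each of them
  is a value of \<open>theta\<close> or \<open>theta1\<close> on the upper half plane.\<close>

lemma sextic_nonzero:
  assumes t: "\<tau> \<in> upper_half"
  shows "sextic \<tau> \<noteq> 0"
proof -
  have "theta \<tau> ^ 4 - theta1 \<tau> ^ 4 = (theta \<tau> + theta1 \<tau>) * (theta \<tau> - theta1 \<tau>) * (theta \<tau> + \<i> * theta1 \<tau>) * (theta \<tau> - \<i> * theta1 \<tau>)"
    by (simp add: algebra_simps power4_eq_xxxx)
  moreover have "theta \<tau> + theta1 \<tau> \<noteq> 0" "theta \<tau> - theta1 \<tau> \<noteq> 0" "theta \<tau> + \<i> * theta1 \<tau> \<noteq> 0"
    using theta_quarter[OF t] theta_half_shift[OF t] theta_quarter_shift[OF t] t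
      theta_nonzero[of "\<tau> / 4"] theta_nonzero[of "\<tau> / 4 + 1/2"] theta_nonzero[of "(\<tau> + 1) / 4"] by auto
  moreover have "theta \<tau> - \<i> * theta1 \<tau> \<noteq> 0"
  proof -
    have "theta ((\<tau> - 1) / 4) = theta (\<tau> - 1) + theta1 (\<tau> - 1)" using theta_quarter[of "\<tau> - 1"] t by simp
    moreover have "theta (\<tau> - 1) = theta \<tau>" "theta1 (\<tau> - 1) = - \<i> * theta1 \<tau>"
      using theta_plus_1[of "\<tau> - 1"] theta1_plus_1[of "\<tau> - 1"] t by auto
    ultimately show ?thesis using theta_nonzero[of "(\<tau> - 1) / 4"] t by auto
  qed
  ultimately show ?thesis using theta_nonzero[OF t] theta1_nonzero[OF t] by (simp add: sextic_def)
qed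

text \<open>The cofactor has no zero on the disc, 0 included; so division by the sextic and its
  negative powers stay within functions holomorphic in q, up to a power of q.\<close>

lemma sextic_qrep:
  obtains h where "h holomorphic_on ball 0 1" "h 0 = 2" "\<And>w. w \<in> ball 0 1 \<Longrightarrow> h w \<noteq> 0"
    "\<And>\<tau>. \<tau> \<in> upper_half \<Longrightarrow> sextic \<tau> = ee (\<tau> / 4) * h (ee \<tau>)"
proof -
  obtain x where x: "x holomorphic_on ball 0 1" "x 0 = 1" "\<And>\<tau>. \<tau> \<in> upper_half \<Longrightarrow> theta \<tau> = x (ee \<tau>)"
    using theta_qseries by metis
  obtain y where y: "y holomorphic_on ball 0 1" "y 0 = 2" "\<And>\<tau>. \<tau> \<in> upper_half \<Longrightarrow> theta1 \<tau> = ee (\<tau> / 4) * y (ee \<tau>)"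
    using theta1_qseries by metis
  define h where "h = (\<lambda>w. x w * y w * (x w ^ 4 - w * y w ^ 4))"
  have P: "sextic \<tau> = ee (\<tau> / 4) * h (ee \<tau>)" if t: "\<tau> \<in> upper_half" for \<tau>
  proof -
    have "ee (\<tau> / 4) ^ 4 = ee \<tau>" using ee_of_nat_mult[of 4 "\<tau> / 4"] by simp
    then show ?thesis using x(3)[OF t] y(3)[OF t] by (simp add: sextic_def h_def power_mult_distrib)
  qed
  show thesis
  proof (rule that[of h])
    show "h holomorphic_on ball 0 1" unfolding h_def by (intro holomorphic_intros x y)
    show h0: "h 0 = 2" by (simp add: h_def x y)
    show "h w \<noteq> 0" if w: "w \<in> ball 0 1" for w
    proof (cases "w = 0")
      case False
      then obtain \<tau> where t: "\<tau> \<in> upper_half" "ee \<tau> = w" using ee_surj_ball w by blast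
      then show ?thesis using sextic_nonzero[OF t(1)] P[OF t(1)] by auto
    qed (simp add: h0)
  qed (rule P)
qed

lemma sextic_S:
  assumes t: "\<tau> \<in> upper_half"
  shows "sextic (- 1 / \<tau>) = 8 * sfac \<tau> ^ 6 * sextic \<tau>"
proof -
  define x y s where "x = theta \<tau>" and "y = theta1 \<tau>" and "s = sfac \<tau>"
  have "(s * (x + y)) * (s * (x - y)) * ((s * (x + y)) ^ 4 - (s * (x - y)) ^ 4) = 8 * s ^ 6 * (x * y * (x ^ 4 - y ^ 4))"
    by algebra
  then show ?thesis unfolding sextic_def theta_S[OF t] theta1_S[OF t] x_def y_def s_def .
qed

lemma sfac_power_even: "sfac \<tau> ^ (2 * n) = (\<tau> / (2 * \<i>)) ^ n"
  by (simp add: power_mult sfac_sq)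

text \<open>The inversion acts on (theta, theta1) as s = \<open>sfac \<tau>\<close> times the matrix
  with rows (1, 1) and (1, -1). The form is invariant up to 16 s^8, which s^2 = \<tau> / (2 i) turns
  into \<tau>^4.\<close>

lemma scal_E4: "scal 4 0 E4"
  unfolding scal_def
proof (intro conjI ballI)
  obtain x where x: "x holomorphic_on ball 0 1" "x 0 = 1" "\<And>\<tau>. \<tau> \<in> upper_half \<Longrightarrow> theta \<tau> = x (ee \<tau>)"
    using theta_qseries by metis
  obtain y where y: "y holomorphic_on ball 0 1" "y 0 = 2" "\<And>\<tau>. \<tau> \<in> upper_half \<Longrightarrow> theta1 \<tau> = ee (\<tau> / 4) * y (ee \<tau>)"
    using theta1_qseries by metis
  show "\<exists>h. h holomorphic_on ball 0 1 \<and> h 0 = 1 \<and> (\<forall>\<tau>\<in>upper_half. E4 \<tau> = ee (of_int 0 * \<tau>) * h (ee \<tau>))"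
  proof (intro exI[of _ "\<lambda>w. x w ^ 8 + 14 * x w ^ 4 * (w * y w ^ 4) + w\<^sup>2 * y w ^ 8"] conjI ballI)
    fix \<tau> assume t: "\<tau> \<in> upper_half"
    have "ee (\<tau> / 4) ^ 4 = ee \<tau>" "ee (\<tau> / 4) ^ 8 = (ee \<tau>)\<^sup>2"
      using ee_of_nat_mult[of 4 "\<tau> / 4"] ee_of_nat_mult[of 8 "\<tau> / 4"] ee_of_nat_mult[of 2 \<tau>] by simp_all
    then show "E4 \<tau> = ee (of_int 0 * \<tau>) * (x (ee \<tau>) ^ 8 + 14 * x (ee \<tau>) ^ 4 * (ee \<tau> * y (ee \<tau>) ^ 4) + (ee \<tau>)\<^sup>2 * y (ee \<tau>) ^ 8)"
      using x(3)[OF t] y(3)[OF t] by (simp add: E4_def power_mult_distrib)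
  qed (auto simp: x y intro!: holomorphic_intros x(1) y(1))
  fix \<tau> assume t: "\<tau> \<in> upper_half"
  define x y s where "x = theta \<tau>" and "y = theta1 \<tau>" and "s = sfac \<tau>"
  have "(s * (x + y)) ^ 8 + 14 * (s * (x + y)) ^ 4 * (s * (x - y)) ^ 4 + (s * (x - y)) ^ 8
      = 16 * s ^ 8 * (x ^ 8 + 14 * x ^ 4 * y ^ 4 + y ^ 8)"
    by algebra
  moreover have "16 * s ^ 8 = \<tau> ^ 4"
    using sfac_power_even[of \<tau> 4] unfolding s_def by (simp add: power_divide power_mult_distrib mult.commute)
  ultimately show "E4 (- 1 / \<tau>) = \<tau> powi 4 * E4 \<tau>"
    unfolding E4_def theta_S[OF t] theta1_S[OF t] x_def y_def s_def by simp
qed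

lemma scal_E6: "scal 6 0 E6"
  unfolding scal_def
proof (intro conjI ballI)
  obtain x where x: "x holomorphic_on ball 0 1" "x 0 = 1" "\<And>\<tau>. \<tau> \<in> upper_half \<Longrightarrow> theta \<tau> = x (ee \<tau>)"
    using theta_qseries by metis
  obtain y where y: "y holomorphic_on ball 0 1" "y 0 = 2" "\<And>\<tau>. \<tau> \<in> upper_half \<Longrightarrow> theta1 \<tau> = ee (\<tau> / 4) * y (ee \<tau>)"
    using theta1_qseries by metis
  show "\<exists>h. h holomorphic_on ball 0 1 \<and> h 0 = 1 \<and> (\<forall>\<tau>\<in>upper_half. E6 \<tau> = ee (of_int 0 * \<tau>) * h (ee \<tau>))"
  proof (intro exI[of _ "\<lambda>w. (x w ^ 4 + w * y w ^ 4) * (x w ^ 8 - 34 * x w ^ 4 * (w * y w ^ 4) + w\<^sup>2 * y w ^ 8)"] conjI ballI)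
    fix \<tau> assume t: "\<tau> \<in> upper_half"
    have "ee (\<tau> / 4) ^ 4 = ee \<tau>" "ee (\<tau> / 4) ^ 8 = (ee \<tau>)\<^sup>2"
      using ee_of_nat_mult[of 4 "\<tau> / 4"] ee_of_nat_mult[of 8 "\<tau> / 4"] ee_of_nat_mult[of 2 \<tau>] by simp_all
    then show "E6 \<tau> = ee (of_int 0 * \<tau>) * ((x (ee \<tau>) ^ 4 + ee \<tau> * y (ee \<tau>) ^ 4) *
        (x (ee \<tau>) ^ 8 - 34 * x (ee \<tau>) ^ 4 * (ee \<tau> * y (ee \<tau>) ^ 4) + (ee \<tau>)\<^sup>2 * y (ee \<tau>) ^ 8))"
      using x(3)[OF t] y(3)[OF t] by (simp add: E6_def power_mult_distrib)
  qed (auto simp: x y intro!: holomorphic_intros x(1) y(1))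
  fix \<tau> assume t: "\<tau> \<in> upper_half"
  define x y s where "x = theta \<tau>" and "y = theta1 \<tau>" and "s = sfac \<tau>"
  \<comment> \<open>The two factors of E6 are not invariant separately. The factor of degree eight
    splits into two quartics, as the third identity shows, and the inversion exchanges one of these
    with x^4 + y^4.\<close>
  have 1: "(s * (x + y)) ^ 4 + (s * (x - y)) ^ 4 = 2 * s ^ 4 * (x ^ 4 + 6 * x\<^sup>2 * y\<^sup>2 + y ^ 4)"
    by algebra
  have 2: "(s * (x + y)) ^ 8 - 34 * (s * (x + y)) ^ 4 * (s * (x - y)) ^ 4 + (s * (x - y)) ^ 8
      = - 32 * s ^ 8 * ((x ^ 4 + y ^ 4) * (x ^ 4 - 6 * x\<^sup>2 * y\<^sup>2 + y ^ 4))"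
    by algebra
  have 3: "(x ^ 4 + 6 * x\<^sup>2 * y\<^sup>2 + y ^ 4) * (x ^ 4 - 6 * x\<^sup>2 * y\<^sup>2 + y ^ 4) = x ^ 8 - 34 * x ^ 4 * y ^ 4 + y ^ 8"
    by algebra
  have "s ^ 12 = (\<tau> / (2 * \<i>)) ^ 6" using sfac_power_even[of \<tau> 6] by (simp add: s_def)
  then have 4: "- 64 * s ^ 12 = \<tau> ^ 6" by (simp add: power_divide power_mult_distrib)
  have "E6 (- 1 / \<tau>) = (2 * s ^ 4 * (x ^ 4 + 6 * x\<^sup>2 * y\<^sup>2 + y ^ 4)) *
      (- 32 * s ^ 8 * ((x ^ 4 + y ^ 4) * (x ^ 4 - 6 * x\<^sup>2 * y\<^sup>2 + y ^ 4)))"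
    using 1 2 unfolding E6_def theta_S[OF t] theta1_S[OF t] x_def y_def s_def by simp
  also have "\<dots> = (- 64 * s ^ 12) * ((x ^ 4 + y ^ 4) * ((x ^ 4 + 6 * x\<^sup>2 * y\<^sup>2 + y ^ 4) * (x ^ 4 - 6 * x\<^sup>2 * y\<^sup>2 + y ^ 4)))"
    by algebra
  finally show "E6 (- 1 / \<tau>) = \<tau> powi 6 * E6 \<tau>"
    unfolding 3 4 by (simp add: E6_def x_def y_def)
qed

text \<open>The sextic is 2 eta^6, so its fourth power over 16 is the discriminant; its powers shift
  orders by any integer k at the price of weight 12 k.\<close>

lemma scal_sextic_power: "scal (12 * k) k (\<lambda>\<tau>. (sextic \<tau> ^ 4 / 16) powi k)"
proof -
  obtain h where h: "h holomorphic_on ball 0 1" "h 0 = 2" "\<And>w. w \<in> ball 0 1 \<Longrightarrow> h w \<noteq> 0"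
    "\<And>\<tau>. \<tau> \<in> upper_half \<Longrightarrow> sextic \<tau> = ee (\<tau> / 4) * h (ee \<tau>)" using sextic_qrep by metis
  show ?thesis unfolding scal_def
  proof (intro conjI exI[of _ "\<lambda>w. (h w ^ 4 / 16) powi k"] ballI)
    show "(\<lambda>w. (h w ^ 4 / 16) powi k) holomorphic_on ball 0 1"
      using h(3) by (intro holomorphic_intros h) auto
    show "(h 0 ^ 4 / 16) powi k = 1" by (simp add: h)
    fix \<tau> assume t: "\<tau> \<in> upper_half"
    have "ee (\<tau> / 4) ^ 4 = ee \<tau>" using ee_of_nat_mult[of 4 "\<tau> / 4"] by simp
    then have "sextic \<tau> ^ 4 / 16 = ee \<tau> * (h (ee \<tau>) ^ 4 / 16)" using h(4)[OF t] by (simp add: power_mult_distrib)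
    then show "(sextic \<tau> ^ 4 / 16) powi k = ee (of_int k * \<tau>) * (h (ee \<tau>) ^ 4 / 16) powi k"
      by (simp only: power_int_mult_distrib ee_of_int_mult)
    have "(8 * sfac \<tau> ^ 6) ^ 4 = \<tau> ^ 12"
    proof -
      have "(8 * sfac \<tau> ^ 6) ^ 4 = 8 ^ 4 * sfac \<tau> ^ (2 * 12)" by (simp add: power_mult_distrib flip: power_mult)
      also have "\<dots> = \<tau> ^ 12" unfolding sfac_power_even by (simp add: power_divide power_mult_distrib)
      finally show ?thesis .
    qed
    then have "sextic (- 1 / \<tau>) ^ 4 / 16 = \<tau> powi 12 * (sextic \<tau> ^ 4 / 16)"
      unfolding sextic_S[OF t] by (simp add: power_mult_distrib)
    then show "(sextic (- 1 / \<tau>) ^ 4 / 16) powi k = \<tau> powi (12 * k) * (sextic \<tau> ^ 4 / 16) powi k"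
      by (simp only: power_int_mult_distrib power_int_mult)
  qed
qed

text \<open>Multiplication by \<open>\<eta>\<^sup>-\<^sup>6\<close> identifies the representation with its dual.\<close>

lemma vv_odd:
  assumes ev: "even t" and vv: "vv t \<alpha> \<beta>"
    and u: "\<And>n. n < u \<Longrightarrow> \<alpha> n = 0" and v: "\<And>n. n < v \<Longrightarrow> \<beta> n = 0"
  shows "\<exists>\<alpha>' \<beta>'. vv (t - 3) \<alpha>' \<beta>' \<and> (\<forall>n<v. \<alpha>' n = 0) \<and> (\<forall>n<u. \<beta>' n = 0) \<and>
      \<alpha>' v = \<beta> v / 2 \<and> \<beta>' u = - \<alpha> u / 2"
proof -
  obtain F G h k where FG: "h holomorphic_on ball 0 1" "k holomorphic_on ball 0 1" "h 0 = \<alpha> u" "k 0 = \<beta> v"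
    "\<And>\<tau>. \<tau> \<in> upper_half \<Longrightarrow> F \<tau> = ee (of_int u * \<tau>) * h (ee \<tau>)"
    "\<And>\<tau>. \<tau> \<in> upper_half \<Longrightarrow> G \<tau> = ee ((of_int v + ceps t) * \<tau>) * k (ee \<tau>)"
    "vvf t F G" by (rule vv_functions[OF vv u v]) blast+
  obtain p where p: "p holomorphic_on ball 0 1" "p 0 = 2" "\<And>w. w \<in> ball 0 1 \<Longrightarrow> p w \<noteq> 0"
    "\<And>\<tau>. \<tau> \<in> upper_half \<Longrightarrow> sextic \<tau> = ee (\<tau> / 4) * p (ee \<tau>)" using sextic_qrep by metis
  have ce: "ceps t = 1/4" "ceps (t - 3) = - 1/4" using ev by (auto simp: ceps_def sgnpow_def)
  \<comment> \<open>The components change places: division by q^(1/4) makes the exponents of G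
    integral and moves those of F by -1/4. The minus sign in front of F restores the shape of the
    inversion matrix.\<close>
  have "\<exists>\<alpha>' \<beta>'. vv (t - 3) \<alpha>' \<beta>' \<and> (\<forall>n<v. \<alpha>' n = 0) \<and> (\<forall>n<u. \<beta>' n = 0) \<and>
      \<alpha>' v = k 0 / p 0 \<and> \<beta>' u = - h 0 / p 0"
  proof (rule vvI[where F = "\<lambda>\<tau>. G \<tau> / sextic \<tau>" and G = "\<lambda>\<tau>. - F \<tau> / sextic \<tau>"])
    show "(\<lambda>w. k w / p w) holomorphic_on ball 0 1" "(\<lambda>w. - h w / p w) holomorphic_on ball 0 1"
      using p(3) by (intro holomorphic_intros FG p; simp)+
    show "G \<tau> / sextic \<tau> = ee (of_int v * \<tau>) * (k (ee \<tau>) / p (ee \<tau>))" if "\<tau> \<in> upper_half" for \<tau>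
    proof -
      have "ee ((of_int v + 1/4) * \<tau>) = ee (of_int v * \<tau>) * ee (\<tau> / 4)"
        by (simp add: distrib_right flip: ee_add)
      then show ?thesis using p(4)[OF that] FG(6)[OF that] by (simp add: ce)
    qed
    show "- F \<tau> / sextic \<tau> = ee ((of_int u + ceps (t - 3)) * \<tau>) * (- h (ee \<tau>) / p (ee \<tau>))" if "\<tau> \<in> upper_half" for \<tau>
    proof -
      have "ee ((of_int u + ceps (t - 3)) * \<tau>) = ee (of_int u * \<tau>) / ee (\<tau> / 4)"
        by (simp add: left_diff_distrib ce flip: ee_diff)
      then show ?thesis using p(4)[OF that] FG(5)[OF that] by simp
    qed
    show "vvf (t - 3) (\<lambda>\<tau>. G \<tau> / sextic \<tau>) (\<lambda>\<tau>. - F \<tau> / sextic \<tau>)" unfolding vvf_def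
    proof
      fix \<tau> assume t: "\<tau> \<in> upper_half"
      note nz = sfac_nonzero[OF t] sextic_nonzero[OF t]
      define c where "c = cS t * sfac \<tau> powi (2 * t + 1)"
      have "sfac \<tau> powi (2 * t + 1) = sfac \<tau> powi (2 * (t - 3) + 1) * sfac \<tau> ^ 6"
        using nz power_int_add[of "sfac \<tau>" "2 * (t - 3) + 1" 6] by (simp add: add.commute)
      moreover have "(2 * \<i>) powi t = (2 * \<i>) powi (t - 3) * (- 8 * \<i>)"
        using power_int_add[of "2 * \<i>" "t - 3" 3] by (simp add: power3_eq_cube)
      ultimately have c: "cS (t - 3) * sfac \<tau> powi (2 * (t - 3) + 1) = - c / (8 * sfac \<tau> ^ 6)"
        using nz ev by (simp add: c_def cS_def)
      have E: "F (- 1 / \<tau>) = c * (F \<tau> + G \<tau>)" "G (- 1 / \<tau>) = c * (F \<tau> - G \<tau>)"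
        using FG(7) t unfolding vvf_def c_def by auto
      show "G (- 1 / \<tau>) / sextic (- 1 / \<tau>) =
          cS (t - 3) * sfac \<tau> powi (2 * (t - 3) + 1) * (G \<tau> / sextic \<tau> + - F \<tau> / sextic \<tau>) \<and>
        - F (- 1 / \<tau>) / sextic (- 1 / \<tau>) =
          cS (t - 3) * sfac \<tau> powi (2 * (t - 3) + 1) * (G \<tau> / sextic \<tau> - - F \<tau> / sextic \<tau>)"
        unfolding c E sextic_S[OF t] using nz by (simp add: field_simps)
    qed
  qed
  then show ?thesis by (simp add: p FG)
qed

lemma vv_theta: "\<exists>\<alpha> \<beta>. vv 0 \<alpha> \<beta> \<and> (\<forall>n<0. \<alpha> n = 0) \<and> (\<forall>n<0. \<beta> n = 0) \<and> \<alpha> 0 = 1 \<and> \<beta> 0 = 2"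
proof -
  obtain x where x: "x holomorphic_on ball 0 1" "x 0 = 1" "\<And>\<tau>. \<tau> \<in> upper_half \<Longrightarrow> theta \<tau> = x (ee \<tau>)"
    using theta_qseries by metis
  obtain y where y: "y holomorphic_on ball 0 1" "y 0 = 2" "\<And>\<tau>. \<tau> \<in> upper_half \<Longrightarrow> theta1 \<tau> = ee (\<tau> / 4) * y (ee \<tau>)"
    using theta1_qseries by metis
  have "vvf 0 theta theta1" unfolding vvf_def by (simp add: cS_def theta_S[simplified] theta1_S[simplified])
  then show ?thesis
    using vvI[of x y theta 0 theta1 0 0] x y by (simp add: ceps_def sgnpow_def)
qed

text \<open>F and G are partial derivatives of the sextic x y (x^4 - y^4): with respect to y, and
  minus the one with respect to x. This skew gradient is equivariant, hence transforms like (theta,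
  theta1). Its leading coefficients 1, -10 are not proportional to the 1, 2 of
  \<open>vv_theta\<close>, which \<open>tight_even\<close> exploits.\<close>

lemma vv_theta_quintic:
  "\<exists>\<alpha> \<beta>. vv 2 \<alpha> \<beta> \<and> (\<forall>n<0. \<alpha> n = 0) \<and> (\<forall>n<0. \<beta> n = 0) \<and> \<alpha> 0 = 1 \<and> \<beta> 0 = - 10"
proof -
  obtain x where x: "x holomorphic_on ball 0 1" "x 0 = 1" "\<And>\<tau>. \<tau> \<in> upper_half \<Longrightarrow> theta \<tau> = x (ee \<tau>)"
    using theta_qseries by metis
  obtain y where y: "y holomorphic_on ball 0 1" "y 0 = 2" "\<And>\<tau>. \<tau> \<in> upper_half \<Longrightarrow> theta1 \<tau> = ee (\<tau> / 4) * y (ee \<tau>)"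
    using theta1_qseries by metis
  define F where "F = (\<lambda>\<tau>. theta \<tau> ^ 5 - 5 * theta \<tau> * theta1 \<tau> ^ 4)"
  define G where "G = (\<lambda>\<tau>. theta1 \<tau> ^ 5 - 5 * theta \<tau> ^ 4 * theta1 \<tau>)"
  define h where "h = (\<lambda>w. x w ^ 5 - 5 * x w * (w * y w ^ 4))"
  define k where "k = (\<lambda>w. w * y w ^ 5 - 5 * x w ^ 4 * y w)"
  have "vvf 2 F G" unfolding vvf_def
  proof
    fix \<tau> assume t: "\<tau> \<in> upper_half"
    define a b s where "a = theta \<tau>" and "b = theta1 \<tau>" and "s = sfac \<tau>"
    have "(s * (a + b)) ^ 5 - 5 * (s * (a + b)) * (s * (a - b)) ^ 4 = - 4 * s ^ 5 * ((a ^ 5 - 5 * a * b ^ 4) + (b ^ 5 - 5 * a ^ 4 * b))"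
      "(s * (a - b)) ^ 5 - 5 * (s * (a + b)) ^ 4 * (s * (a - b)) = - 4 * s ^ 5 * ((a ^ 5 - 5 * a * b ^ 4) - (b ^ 5 - 5 * a ^ 4 * b))"
      by algebra+
    moreover have "cS 2 * sfac \<tau> powi (2 * 2 + 1) = - 4 * s ^ 5" by (simp add: cS_def s_def power2_eq_square)
    ultimately show "F (- 1 / \<tau>) = cS 2 * sfac \<tau> powi (2 * 2 + 1) * (F \<tau> + G \<tau>) \<and>
        G (- 1 / \<tau>) = cS 2 * sfac \<tau> powi (2 * 2 + 1) * (F \<tau> - G \<tau>)"
      unfolding F_def G_def theta_S[OF t] theta1_S[OF t] a_def b_def s_def by metis
  qed
  moreover have "F \<tau> = ee (of_int 0 * \<tau>) * h (ee \<tau>)" "G \<tau> = ee ((of_int 0 + ceps 2) * \<tau>) * k (ee \<tau>)"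
    if t: "\<tau> \<in> upper_half" for \<tau>
  proof -
    have e: "ee (\<tau> / 4) ^ 4 = ee \<tau>" using ee_of_nat_mult[of 4 "\<tau> / 4"] by simp
    then have "ee (\<tau> / 4) ^ 5 = ee (\<tau> / 4) * ee \<tau>" by (simp add: eval_nat_numeral mult_ac)
    with e show "F \<tau> = ee (of_int 0 * \<tau>) * h (ee \<tau>)" "G \<tau> = ee ((of_int 0 + ceps 2) * \<tau>) * k (ee \<tau>)"
      using x(3)[OF t] y(3)[OF t]
      by (simp_all add: F_def G_def h_def k_def ceps_def sgnpow_def power_mult_distrib right_diff_distrib)
  qed
  moreover have "h holomorphic_on ball 0 1" "k holomorphic_on ball 0 1"
    unfolding h_def k_def by (intro holomorphic_intros x y)+
  moreover have "h 0 = 1" "k 0 = - 10" by (simp_all add: h_def k_def x y)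
  ultimately show ?thesis using vvI[of h k F 0 G 0 2] by metis
qed

section \<open>The Wronskian bound\<close>

lemma Im_inversion: "Im (- 1 / \<tau>) = Im \<tau> / (norm \<tau>)\<^sup>2"
  by (simp add: Im_divide cmod_power2)

lemma periodic_of_int:
  assumes g: "\<And>\<tau>. \<tau> \<in> upper_half \<Longrightarrow> g (\<tau> + 1) = g \<tau>" and t: "\<tau> \<in> upper_half"
  shows "g (\<tau> + of_int n) = g \<tau>"
proof (induction n rule: int_induct[where k = 0])
  case (step1 i)
  then show ?case using g[of "\<tau> + of_int i"] t by (simp add: add.assoc)
next
  case (step2 i)
  have "\<tau> + of_int (i - 1) \<in> upper_half" using t by (rule upper_half_shift)
  then show ?case using g[of "\<tau> + of_int (i - 1)"] step2 by simp
qed simp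

text \<open>If \<open>|Re \<tau>| \<le> 1/2\<close> and \<open>Im \<tau> < 1/2\<close>, then \<open>|\<tau>|\<^sup>2 < 1/2\<close>, so the inversion at least doubles the imaginary part.\<close>

lemma modular_reduction:
  fixes g :: "complex \<Rightarrow> 'a"
  assumes T: "\<And>\<tau>. \<tau> \<in> upper_half \<Longrightarrow> g (\<tau> + 1) = g \<tau>"
    and S: "\<And>\<tau>. \<tau> \<in> upper_half \<Longrightarrow> g (- 1 / \<tau>) = g \<tau>"
    and t: "\<tau> \<in> upper_half"
  obtains \<tau>' where "\<bar>Re \<tau>'\<bar> \<le> 1/2" "Im \<tau>' \<ge> 1/2" "g \<tau>' = g \<tau>"
proof -
  have *: "\<exists>\<tau>'. \<bar>Re \<tau>'\<bar> \<le> 1/2 \<and> Im \<tau>' \<ge> 1/2 \<and> g \<tau>' = g \<tau>"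
    if "\<tau> \<in> upper_half" "Im \<tau> \<ge> (1/2) ^ Suc n" for n \<tau>
    using that
  proof (induction n arbitrary: \<tau>)
    case 0
    define \<sigma> where "\<sigma> = \<tau> + of_int (- round (Re \<tau>))"
    have "\<bar>Re \<sigma>\<bar> \<le> 1/2" using of_int_round_abs_le[of "Re \<tau>"] by (simp add: \<sigma>_def abs_minus_commute)
    moreover have "Im \<sigma> \<ge> 1/2" using 0 by (simp add: \<sigma>_def)
    moreover have "g \<sigma> = g \<tau>" unfolding \<sigma>_def by (rule periodic_of_int[of g]) (use T 0 in auto)
    ultimately show ?case by blast
  next
    case (Suc n)
    define \<sigma> where "\<sigma> = \<tau> + of_int (- round (Re \<tau>))"
    have re: "\<bar>Re \<sigma>\<bar> \<le> 1/2" using of_int_round_abs_le[of "Re \<tau>"] by (simp add: \<sigma>_def abs_minus_commute)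
    have gs: "g \<sigma> = g \<tau>" unfolding \<sigma>_def by (rule periodic_of_int[of g]) (use T Suc in auto)
    have im: "Im \<sigma> = Im \<tau>" by (simp add: \<sigma>_def)
    have sH: "\<sigma> \<in> upper_half" using Suc(2) im by (simp add: upper_half_def)
    show ?case
    proof (cases "Im \<sigma> \<ge> 1/2")
      case True
      then show ?thesis using re gs by blast
    next
      case False
      have "(Re \<sigma>)\<^sup>2 \<le> (1/2)\<^sup>2" using re by (subst abs_le_square_iff[symmetric]) simp
      moreover have "(Im \<sigma>)\<^sup>2 \<le> (1/2)\<^sup>2" using False sH by (intro power_mono) (auto simp: upper_half_def)
      ultimately have n: "(norm \<sigma>)\<^sup>2 \<le> 1/2"
        unfolding cmod_power2 by (simp add: power_divide)
      have npos: "(norm \<sigma>)\<^sup>2 > 0" using upper_half_nonzero[OF sH] by simp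
      have "Im \<sigma> * (norm \<sigma>)\<^sup>2 * 2 \<le> Im \<sigma> * 1"
        unfolding mult.assoc using n sH by (intro mult_left_mono) (auto simp: upper_half_def)
      then have "2 * Im \<sigma> \<le> Im (- 1 / \<sigma>)" unfolding Im_inversion using npos by (simp add: field_simps)
      then have "Im (- 1 / \<sigma>) \<ge> (1/2) ^ Suc n" using Suc(3) im by simp
      then obtain \<tau>' where "\<bar>Re \<tau>'\<bar> \<le> 1/2" "Im \<tau>' \<ge> 1/2" "g \<tau>' = g (- 1 / \<sigma>)"
        using Suc(1)[OF upper_half_inversion[OF sH]] by blast
      then show ?thesis using S[OF sH] gs by auto
    qed
  qed
  have "Im \<tau> > 0" using t by (simp add: upper_half_def)
  then obtain n where "(1/2) ^ n < Im \<tau>" using real_arch_pow_inv[of "Im \<tau>" "1/2"] by auto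
  then have "(1/2) ^ Suc n \<le> Im \<tau>" using \<open>Im \<tau> > 0\<close> by simp
  then show ?thesis using *[OF t] that by blast
qed

lemma cusp_decay:
  assumes m: "m holomorphic_on ball 0 1" and d: "\<delta> > 0" and e: "\<epsilon> > 0"
  obtains K where "K > 0" "\<And>\<tau>. Im \<tau> > K \<Longrightarrow> norm (ee (of_real \<delta> * \<tau>) * m (ee \<tau>)) < \<epsilon>"
proof -
  have "continuous_on (cball 0 (1/2)) m"
    by (rule continuous_on_subset[OF holomorphic_on_imp_continuous_on[OF m]]) auto
  then have "bounded (m ` cball 0 (1/2))" by (intro compact_imp_bounded compact_continuous_image) auto
  then obtain B where B: "B > 0" "\<And>w. norm w \<le> 1/2 \<Longrightarrow> norm (m w) \<le> B"
    unfolding bounded_pos by force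
  define K where "K = max 1 (max (ln 2 / (2 * pi)) (- ln (\<epsilon> / B) / (2 * pi * \<delta>)))"
  show ?thesis
  proof
    show "K > 0" by (simp add: K_def)
    fix \<tau> assume K: "Im \<tau> > K"
    have "Im \<tau> > ln 2 / (2 * pi)" using K by (simp add: K_def)
    then have "- 2 * pi * Im \<tau> < - ln 2" by (simp add: field_simps)
    then have "exp (- 2 * pi * Im \<tau>) < exp (- ln 2)" by (subst exp_less_cancel_iff)
    then have "norm (ee \<tau>) \<le> 1/2" by (simp add: norm_ee exp_minus)
    then have mB: "norm (m (ee \<tau>)) \<le> B" by (rule B)
    have "Im \<tau> > - ln (\<epsilon> / B) / (2 * pi * \<delta>)" using K by (simp add: K_def)
    then have "- 2 * pi * (\<delta> * Im \<tau>) < ln (\<epsilon> / B)" using d by (simp add: field_simps)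
    then have "exp (- 2 * pi * (\<delta> * Im \<tau>)) < exp (ln (\<epsilon> / B))" by (subst exp_less_cancel_iff)
    then have "exp (- 2 * pi * (\<delta> * Im \<tau>)) < \<epsilon> / B" using e B by simp
    then have "norm (ee (of_real \<delta> * \<tau>)) < \<epsilon> / B" by (simp add: norm_ee)
    then have "norm (ee (of_real \<delta> * \<tau>)) * B < \<epsilon>" using B by (simp add: field_simps)
    moreover have "norm (ee (of_real \<delta> * \<tau>) * m (ee \<tau>)) \<le> norm (ee (of_real \<delta> * \<tau>)) * B"
      unfolding norm_mult by (intro mult_left_mono mB) simp
    ultimately show "norm (ee (of_real \<delta> * \<tau>) * m (ee \<tau>)) < \<epsilon>" by simp
  qed
qed

lemma qrep_holomorphic:
  assumes "h holomorphic_on ball 0 1" "\<And>\<tau>. \<tau> \<in> upper_half \<Longrightarrow> F \<tau> = ee (r * \<tau>) * h (ee \<tau>)"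
  shows "F holomorphic_on upper_half"
proof -
  have "(\<lambda>\<tau>. ee (r * \<tau>) * h (ee \<tau>)) holomorphic_on upper_half"
    by (intro holomorphic_intros holomorphic_comp_ee assms)
  then show ?thesis by (rule holomorphic_transform) (use assms in auto)
qed

text \<open>|X| is invariant under the modular group and tends to 0 at the cusp, so a nonzero X
  would attain its maximal modulus in a compact box and be constant, against the decay. Invariance
  is asked of the modulus since \<delta> may be fractional.\<close>

lemma modular_vanishing:
  assumes m: "m holomorphic_on ball 0 1" and d: "\<delta> > 0"
    and X: "\<And>\<tau>. \<tau> \<in> upper_half \<Longrightarrow> X \<tau> = ee (of_real \<delta> * \<tau>) * m (ee \<tau>)"
    and S: "\<And>\<tau>. \<tau> \<in> upper_half \<Longrightarrow> norm (X (- 1 / \<tau>)) = norm (X \<tau>)"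
    and t0: "\<tau>\<^sub>0 \<in> upper_half"
  shows "X \<tau>\<^sub>0 = 0"
proof (rule ccontr)
  assume nz: "X \<tau>\<^sub>0 \<noteq> 0"
  have holo: "X holomorphic_on upper_half"
    by (rule qrep_holomorphic[OF m X])
  have T: "norm (X (\<tau> + 1)) = norm (X \<tau>)" if "\<tau> \<in> upper_half" for \<tau>
    using X[OF that] X[of "\<tau> + 1"] that by (simp add: norm_mult norm_ee ee_add)
  obtain K where K: "K > 0" "\<And>\<tau>. Im \<tau> > K \<Longrightarrow> norm (X \<tau>) < norm (X \<tau>\<^sub>0)"
  proof -
    obtain K where "K > 0" "\<And>\<tau>. Im \<tau> > K \<Longrightarrow> norm (ee (of_real \<delta> * \<tau>) * m (ee \<tau>)) < norm (X \<tau>\<^sub>0)"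
      using cusp_decay[OF m d, of "norm (X \<tau>\<^sub>0)"] nz by auto
    then show ?thesis using that[of K] X by (auto simp: upper_half_def)
  qed
  \<comment> \<open>Contains every reduced point of height at most K; above that height |X| is
    already smaller than at the given point.\<close>
  define C where "C = cbox (Complex (- 1/2) (1/2)) (Complex (1/2) (max K 1))"
  have Cmem: "z \<in> C \<longleftrightarrow> \<bar>Re z\<bar> \<le> 1/2 \<and> 1/2 \<le> Im z \<and> Im z \<le> max K 1" for z
    by (auto simp: C_def in_cbox_complex_iff abs_le_iff)
  have CH: "C \<subseteq> upper_half" using Cmem by (auto simp: upper_half_def)
  have "compact C" by (simp add: C_def)
  moreover have "continuous_on C (\<lambda>z. norm (X z))"
    by (intro continuous_intros continuous_on_subset[OF holomorphic_on_imp_continuous_on[OF holo] CH])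
  moreover have red: "\<exists>z. (z \<in> C \<or> Im z > K) \<and> norm (X z) = norm (X \<tau>)" if t: "\<tau> \<in> upper_half" for \<tau>
  proof -
    obtain z where "\<bar>Re z\<bar> \<le> 1/2" "Im z \<ge> 1/2" "norm (X z) = norm (X \<tau>)"
      using modular_reduction[of "\<lambda>z. norm (X z)", OF T S t] by blast
    then show ?thesis unfolding Cmem by (intro exI[of _ z]) auto
  qed
  moreover have "C \<noteq> {}" using red[OF t0] K(2) by fastforce
  ultimately obtain z where z: "z \<in> C" "\<And>w. w \<in> C \<Longrightarrow> norm (X w) \<le> norm (X z)"
    using continuous_attains_sup[of C "\<lambda>z. norm (X z)"] by blast
  have z0: "norm (X \<tau>\<^sub>0) \<le> norm (X z)" using red[OF t0] K(2) z(2) by (metis less_irrefl)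
  have max: "norm (X w) \<le> norm (X z)" if w: "w \<in> upper_half" for w
  proof -
    obtain w' where w': "w' \<in> C \<or> Im w' > K" "norm (X w') = norm (X w)" using red[OF w] by blast
    then show ?thesis using z(2)[of w'] K(2)[of w'] z0 by auto
  qed
  have "X constant_on upper_half"
    by (rule maximum_modulus_principle[OF holo _ connected_upper_half, of upper_half z])
       (use z CH max in auto)
  then obtain c where c: "\<And>w. w \<in> upper_half \<Longrightarrow> X w = c" unfolding constant_on_def by blast
  have "\<i> * of_real (K + 1) \<in> upper_half" using K(1) by (simp add: upper_half_def)
  then have "norm c < norm (X \<tau>\<^sub>0)" using c K(2)[of "\<i> * of_real (K + 1)"] by simp
  then show False using c[OF t0] by simp
qed

section \<open>Transformation of the Wronskian\<close>

lemma norm_sfac_sq: "(norm (sfac \<tau>))\<^sup>2 = norm \<tau> / 2"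
  by (simp add: norm_power[symmetric] sfac_sq norm_divide norm_mult)

lemma norm_cS_sq: "(norm (cS t))\<^sup>2 = 4 powi t"
proof -
  have "norm (cS t) = 2 powi t" by (simp add: cS_def norm_mult norm_power_int)
  then show ?thesis by (simp add: power2_eq_square flip: power_int_mult_distrib)
qed

text \<open>The 1/2 compensates for the matrix with rows (1, 1) and (1, -1), which doubles sums of
  squares.\<close>

lemma norm_vv_factor_sq:
  assumes "\<tau> \<in> upper_half"
  shows "(norm (cS t * sfac \<tau> powi (2 * t + 1)))\<^sup>2 = norm \<tau> powi (2 * t + 1) / 2"
proof -
  have "(norm (cS t * sfac \<tau> powi (2 * t + 1)))\<^sup>2 = 4 powi t * (norm \<tau> / 2) powi (2 * t + 1)"
    unfolding norm_mult power_mult_distrib norm_cS_sq norm_power_int norm_sfac_sq[symmetric]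
    by (simp add: power_int_mult[symmetric] power_int_numeral[symmetric] mult.commute del: power_int_numeral)
  also have "\<dots> = norm \<tau> powi (2 * t + 1) / 2"
    by (simp add: power_int_divide_distrib power_int_add power_int_mult)
  finally show ?thesis .
qed

text \<open>Both components carry the same automorphy factor, so its derivative cancels. The -2 is
  the determinant of the matrix with rows (1, 1) and (1, -1); \<tau>^2 comes from the chain
  rule.\<close>

lemma vvf_wronskian_S:
  assumes F: "F holomorphic_on upper_half" and G: "G holomorphic_on upper_half" and vvf: "vvf t F G"
    and t: "\<tau> \<in> upper_half"
  shows "F (- 1 / \<tau>) * deriv G (- 1 / \<tau>) - G (- 1 / \<tau>) * deriv F (- 1 / \<tau>) =
    - 2 * (cS t * sfac \<tau> powi (2 * t + 1))\<^sup>2 * \<tau>\<^sup>2 * (F \<tau> * deriv G \<tau> - G \<tau> * deriv F \<tau>)"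
proof -
  define C where "C = (\<lambda>\<tau>. cS t * sfac \<tau> powi (2 * t + 1))"
  have C: "C holomorphic_on upper_half"
    unfolding C_def by (intro holomorphic_intros sfac_holomorphic) (use sfac_nonzero in auto)
  have D: "(f has_field_derivative deriv f z) (at z)" if "f holomorphic_on upper_half" "z \<in> upper_half" for f z
    using that holomorphic_derivI by fastforce
  have E: "F (- 1 / z) = C z * (F z + G z)" "G (- 1 / z) = C z * (F z - G z)" if "z \<in> upper_half" for z
    using vvf that unfolding vvf_def C_def by auto
  have \<tau>0: "\<tau> \<noteq> 0" using upper_half_nonzero[OF t] .
  have inv: "((\<lambda>z. - 1 / z) has_field_derivative (1 / \<tau>\<^sup>2)) (at \<tau>)"
    by (rule derivative_eq_intros refl | use \<tau>0 in \<open>simp add: power2_eq_square\<close>)+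
  have left: "((\<lambda>z. f (- 1 / z)) has_field_derivative (deriv f (- 1 / \<tau>) * (1 / \<tau>\<^sup>2))) (at \<tau>)"
    if "f holomorphic_on upper_half" for f
    by (rule DERIV_chain2[OF D[OF that upper_half_inversion[OF t]] inv])
  have right1: "((\<lambda>z. C z * (F z + G z)) has_field_derivative (deriv C \<tau> * (F \<tau> + G \<tau>) + (deriv F \<tau> + deriv G \<tau>) * C \<tau>)) (at \<tau>)"
    by (intro DERIV_mult DERIV_add D F G C t)
  have right2: "((\<lambda>z. C z * (F z - G z)) has_field_derivative (deriv C \<tau> * (F \<tau> - G \<tau>) + (deriv F \<tau> - deriv G \<tau>) * C \<tau>)) (at \<tau>)"
    by (intro DERIV_mult DERIV_diff D F G C t)
  have F': "deriv F (- 1 / \<tau>) * (1 / \<tau>\<^sup>2) = deriv C \<tau> * (F \<tau> + G \<tau>) + (deriv F \<tau> + deriv G \<tau>) * C \<tau>"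
  proof (rule DERIV_unique[OF left[OF F]])
    show "((\<lambda>z. F (- 1 / z)) has_field_derivative (deriv C \<tau> * (F \<tau> + G \<tau>) + (deriv F \<tau> + deriv G \<tau>) * C \<tau>)) (at \<tau>)"
      by (rule has_field_derivative_transform_within_open[OF right1 open_upper_half t]) (use E in auto)
  qed
  have G': "deriv G (- 1 / \<tau>) * (1 / \<tau>\<^sup>2) = deriv C \<tau> * (F \<tau> - G \<tau>) + (deriv F \<tau> - deriv G \<tau>) * C \<tau>"
  proof (rule DERIV_unique[OF left[OF G]])
    show "((\<lambda>z. G (- 1 / z)) has_field_derivative (deriv C \<tau> * (F \<tau> - G \<tau>) + (deriv F \<tau> - deriv G \<tau>) * C \<tau>)) (at \<tau>)"
      by (rule has_field_derivative_transform_within_open[OF right2 open_upper_half t]) (use E in auto)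
  qed
  define f g f' g' c c' where defs: "f = F \<tau>" "g = G \<tau>" "f' = deriv F \<tau>" "g' = deriv G \<tau>" "c = C \<tau>" "c' = deriv C \<tau>"
  have F'': "deriv F (- 1 / \<tau>) = \<tau>\<^sup>2 * (c' * (f + g) + (f' + g') * c)"
    using F' \<tau>0 unfolding defs by (simp add: field_simps)
  have G'': "deriv G (- 1 / \<tau>) = \<tau>\<^sup>2 * (c' * (f - g) + (f' - g') * c)"
    using G' \<tau>0 unfolding defs by (simp add: field_simps)
  have "c * (f + g) * (\<tau>\<^sup>2 * (c' * (f - g) + (f' - g') * c)) - c * (f - g) * (\<tau>\<^sup>2 * (c' * (f + g) + (f' + g') * c))
      = - 2 * c\<^sup>2 * \<tau>\<^sup>2 * (f * g' - g * f')" by algebra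
  then show ?thesis unfolding E[OF t] F'' G'' by (simp add: defs C_def)
qed

lemma deriv_qrep:
  assumes h: "h holomorphic_on ball 0 1"
    and F: "\<And>\<tau>. \<tau> \<in> upper_half \<Longrightarrow> F \<tau> = ee (r * \<tau>) * h (ee \<tau>)" and t: "\<tau> \<in> upper_half"
  shows "deriv F \<tau> = 2 * of_real pi * \<i> * ee (r * \<tau>) * (r * h (ee \<tau>) + ee \<tau> * deriv h (ee \<tau>))"
proof -
  have ee: "((\<lambda>z. ee (r * z)) has_field_derivative (2 * of_real pi * \<i> * r * ee (r * \<tau>))) (at \<tau>)" for r \<tau>
    unfolding ee_def by (rule derivative_eq_intros refl | simp add: mult_ac)+
  have "(h has_field_derivative deriv h (ee \<tau>)) (at (ee \<tau>))"
    using h ee_in_ball[OF t] holomorphic_derivI by blast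
  then have "((\<lambda>z. h (ee z)) has_field_derivative (deriv h (ee \<tau>) * (2 * of_real pi * \<i> * ee \<tau>))) (at \<tau>)"
    by (rule DERIV_chain2) (use ee[of 1 \<tau>] in simp)
  from DERIV_mult[OF ee[of r] this]
  have "((\<lambda>z. ee (r * z) * h (ee z)) has_field_derivative
      (2 * of_real pi * \<i> * ee (r * \<tau>) * (r * h (ee \<tau>) + ee \<tau> * deriv h (ee \<tau>)))) (at \<tau>)"
    by (simp add: algebra_simps)
  then have "(F has_field_derivative
      (2 * of_real pi * \<i> * ee (r * \<tau>) * (r * h (ee \<tau>) + ee \<tau> * deriv h (ee \<tau>)))) (at \<tau>)"
    by (rule has_field_derivative_transform_within_open[OF _ open_upper_half t]) (use F in auto)
  then show ?thesis by (rule DERIV_imp_deriv)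
qed

text \<open>Near a point where G is nonzero, the derivative of F / G is, up to sign, the Wronskian
  over G^2; the identity theorem extends the relation.\<close>

lemma wronskian_zero_proportional:
  assumes F: "F holomorphic_on upper_half" and G: "G holomorphic_on upper_half"
    and W: "\<And>\<tau>. \<tau> \<in> upper_half \<Longrightarrow> F \<tau> * deriv G \<tau> - G \<tau> * deriv F \<tau> = 0"
    and t0: "\<tau>\<^sub>0 \<in> upper_half" and nz: "G \<tau>\<^sub>0 \<noteq> 0" and t: "\<tau> \<in> upper_half"
  shows "F \<tau> = F \<tau>\<^sub>0 / G \<tau>\<^sub>0 * G \<tau>"
proof -
  have "continuous_on upper_half G" using G by (rule holomorphic_on_imp_continuous_on)
  then have "open {z \<in> upper_half. G z \<noteq> 0}"
    using continuous_open_preimage[of upper_half G "- {0}"] by (simp add: vimage_def Int_def open_Compl)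
  moreover have "\<tau>\<^sub>0 \<in> {z \<in> upper_half. G z \<noteq> 0}" using t0 nz by simp
  ultimately obtain e where e: "e > 0" "ball \<tau>\<^sub>0 e \<subseteq> {z \<in> upper_half. G z \<noteq> 0}"
    using openE by blast
  have D: "(f has_field_derivative deriv f z) (at z)" if "f holomorphic_on upper_half" "z \<in> upper_half" for f z
    using that holomorphic_derivI by fastforce
  have "\<exists>c. \<forall>z\<in>ball \<tau>\<^sub>0 e. F z / G z = c"
  proof (rule has_field_derivative_zero_constant)
    fix z assume z: "z \<in> ball \<tau>\<^sub>0 e"
    then have zH: "z \<in> upper_half" "G z \<noteq> 0" using e by auto
    have "((\<lambda>z. F z / G z) has_field_derivative ((deriv F z * G z - F z * deriv G z) / (G z * G z))) (at z)"
      by (intro DERIV_divide D F G zH)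
    moreover have "deriv F z * G z - F z * deriv G z = 0" using W[OF zH(1)] by (simp add: algebra_simps)
    ultimately show "((\<lambda>z. F z / G z) has_field_derivative 0) (at z within ball \<tau>\<^sub>0 e)"
      by (simp add: has_field_derivative_at_within)
  qed simp
  then obtain c where c: "\<And>z. z \<in> ball \<tau>\<^sub>0 e \<Longrightarrow> F z / G z = c" by blast
  have c0: "c = F \<tau>\<^sub>0 / G \<tau>\<^sub>0" using c[of \<tau>\<^sub>0] e by simp
  have "F \<tau> - c * G \<tau> = 0"
  proof (rule analytic_continuation_open[of "ball \<tau>\<^sub>0 e" upper_half "\<lambda>z. F z - c * G z" "\<lambda>_. 0"])
    show "F z - c * G z = 0" if "z \<in> ball \<tau>\<^sub>0 e" for z
      using c[OF that] e that by (auto simp: field_simps)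
  qed (use e t connected_upper_half in \<open>auto intro!: holomorphic_intros F G\<close>)
  then show ?thesis by (simp add: c0)
qed

text \<open>The Wronskian \<open>W\<close> of the two components has weight \<open>2t + 3\<close>, so \<open>W\<^sup>3/sextic\<^bsup>2t+3\<^esup>\<close> has an invariant
  absolute value; if the orders are large it vanishes at the cusp, hence everywhere.\<close>

theorem vv_vanishing:
  assumes vv: "vv t \<alpha> \<beta>" and u: "\<And>n. n < u \<Longrightarrow> \<alpha> n = 0" and v: "\<And>n. n < v \<Longrightarrow> \<beta> n = 0"
    and large: "12 * (u + v) + 3 * sgnpow t > 2 * t + 3"
  shows "\<alpha> = (\<lambda>_. 0) \<and> \<beta> = (\<lambda>_. 0)"
proof -
  obtain F G h k where FG: "h holomorphic_on ball 0 1" "k holomorphic_on ball 0 1"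
    "\<And>\<tau>. \<tau> \<in> upper_half \<Longrightarrow> F \<tau> = ee (of_int u * \<tau>) * h (ee \<tau>)"
    "\<And>\<tau>. \<tau> \<in> upper_half \<Longrightarrow> G \<tau> = ee ((of_int v + ceps t) * \<tau>) * k (ee \<tau>)"
    "vvf t F G" and zero:
    "(\<And>\<tau>. \<tau> \<in> upper_half \<Longrightarrow> F \<tau> = 0) \<Longrightarrow> \<alpha> = (\<lambda>_. 0)"
    "(\<And>\<tau>. \<tau> \<in> upper_half \<Longrightarrow> G \<tau> = 0) \<Longrightarrow> \<beta> = (\<lambda>_. 0)" by (rule vv_functions[OF vv u v]) blast+
  have F: "F holomorphic_on upper_half"
    by (rule qrep_holomorphic[OF FG(1,3)])
  have G: "G holomorphic_on upper_half"
    by (rule qrep_holomorphic[OF FG(2,4)])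
  obtain p where p: "p holomorphic_on ball 0 1" "\<And>w. w \<in> ball 0 1 \<Longrightarrow> p w \<noteq> 0"
    "\<And>\<tau>. \<tau> \<in> upper_half \<Longrightarrow> sextic \<tau> = ee (\<tau> / 4) * p (ee \<tau>)" using sextic_qrep by metis
  define W where "W = (\<lambda>\<tau>. F \<tau> * deriv G \<tau> - G \<tau> * deriv F \<tau>)"
  define r where "r = of_int v + ceps t"
  define w where "w = (\<lambda>q. 2 * of_real pi * \<i> * (h q * (r * k q + q * deriv k q) - k q * (of_int u * h q + q * deriv h q)))"
  have W: "W \<tau> = ee ((of_int u + r) * \<tau>) * w (ee \<tau>)" if "\<tau> \<in> upper_half" for \<tau>
  proof -
    have "deriv F \<tau> = 2 * of_real pi * \<i> * ee (of_int u * \<tau>) * (of_int u * h (ee \<tau>) + ee \<tau> * deriv h (ee \<tau>))"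
      by (rule deriv_qrep[OF FG(1) FG(3) that])
    moreover have "deriv G \<tau> = 2 * of_real pi * \<i> * ee (r * \<tau>) * (r * k (ee \<tau>) + ee \<tau> * deriv k (ee \<tau>))"
      unfolding r_def by (rule deriv_qrep[OF FG(2) FG(4) that])
    moreover have "G \<tau> = ee (r * \<tau>) * k (ee \<tau>)" unfolding r_def by (rule FG(4)[OF that])
    moreover have "ee ((of_int u + r) * \<tau>) = ee (of_int u * \<tau>) * ee (r * \<tau>)"
      by (simp add: ring_distribs ee_add)
    ultimately show ?thesis unfolding W_def w_def FG(3)[OF that] by (simp add: algebra_simps)
  qed
  \<comment> \<open>The exponent of q split off from W^3 / sextic^(2t+3): three times u + v +
    \<open>sgnpow t\<close>/4, minus (2t + 3)/4. Hypothesis \<open>large\<close> says precisely that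
    it is positive.\<close>
  define \<delta> where "\<delta> = (12 * (real_of_int u + real_of_int v) + 3 * real_of_int (sgnpow t) - (2 * t + 3)) / 4"
  have "real_of_int (2 * t + 3) < real_of_int (12 * (u + v) + 3 * sgnpow t)"
    using large by (simp only: of_int_less_iff)
  then have d: "\<delta> > 0" unfolding \<delta>_def by simp
  define X where "X = (\<lambda>\<tau>. W \<tau> ^ 3 / sextic \<tau> powi (2 * t + 3))"
  define m where "m = (\<lambda>q. w q ^ 3 / p q powi (2 * t + 3))"
  have "X \<tau> = 0" if "\<tau> \<in> upper_half" for \<tau>
  proof (rule modular_vanishing[OF _ d _ _ that])
    show "m holomorphic_on ball 0 1" unfolding m_def w_def
      by (intro holomorphic_intros FG p holomorphic_deriv) (use p(2) in auto)
    fix \<tau> assume t: "\<tau> \<in> upper_half"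
    have e1: "ee ((of_int u + r) * \<tau>) ^ 3 = ee (3 * (of_int u + r) * \<tau>)"
      using ee_of_nat_mult[of 3 "(of_int u + r) * \<tau>"] by (simp add: mult_ac)
    have e2: "ee (\<tau> / 4) powi (2 * t + 3) = ee (of_int (2 * t + 3) * (\<tau> / 4))"
      by (rule ee_of_int_mult[symmetric])
    have "3 * (of_int u + r) * \<tau> - of_int (2 * t + 3) * (\<tau> / 4) = of_real \<delta> * \<tau>"
      by (simp add: \<delta>_def r_def ceps_def field_simps)
    then have e3: "ee (3 * (of_int u + r) * \<tau>) / ee (of_int (2 * t + 3) * (\<tau> / 4)) = ee (of_real \<delta> * \<tau>)"
      unfolding ee_diff[symmetric] by (rule arg_cong)
    show "X \<tau> = ee (of_real \<delta> * \<tau>) * m (ee \<tau>)"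
      unfolding X_def m_def W[OF t] p(3)[OF t] power_mult_distrib power_int_mult_distrib e1 e2 e3[symmetric]
      by simp
    define n where "n = norm \<tau>"
    have n: "n > 0" using upper_half_nonzero[OF t] by (simp add: n_def)
    have "norm (W (- 1 / \<tau>)) = 2 * (n powi (2 * t + 1) / 2) * n\<^sup>2 * norm (W \<tau>)"
      unfolding W_def vvf_wronskian_S[OF F G FG(5) t] norm_mult norm_power[symmetric] n_def
      using norm_vv_factor_sq[OF t, of t] by (simp add: norm_power norm_mult)
    also have "\<dots> = n powi (2 * t + 3) * norm (W \<tau>)"
      using n power_int_add[of n "2 * t + 1" 2] by (simp add: add.commute)
    finally have "norm (W (- 1 / \<tau>)) ^ 3 = (n powi (2 * t + 3)) ^ 3 * norm (W \<tau>) ^ 3"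
      by (simp add: power_mult_distrib)
    moreover have "norm (sextic (- 1 / \<tau>)) = n ^ 3 * norm (sextic \<tau>)"
    proof -
      have "norm (sfac \<tau>) ^ 6 = ((norm (sfac \<tau>))\<^sup>2) ^ 3" by (simp flip: power_mult)
      then show ?thesis unfolding sextic_S[OF t] norm_mult norm_power norm_sfac_sq n_def
        by (simp add: power_divide)
    qed
    ultimately have "norm (X (- 1 / \<tau>)) = (n powi (2 * t + 3)) ^ 3 * norm (W \<tau>) ^ 3 / (n ^ 3 * norm (sextic \<tau>)) powi (2 * t + 3)"
      unfolding X_def norm_divide norm_power norm_power_int by simp
    also have "\<dots> = norm (X \<tau>)"
    proof -
      have "(n ^ 3) powi (2 * t + 3) = (n powi (2 * t + 3)) ^ 3"
        by (metis power_int_mult power_int_of_nat mult.commute)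
      then show ?thesis using n unfolding X_def norm_divide norm_power norm_power_int power_int_mult_distrib by simp
    qed
    finally show "norm (X (- 1 / \<tau>)) = norm (X \<tau>)" .
  qed
  then have W0: "F \<tau> * deriv G \<tau> - G \<tau> * deriv F \<tau> = 0" if "\<tau> \<in> upper_half" for \<tau>
    using that sextic_nonzero[OF that] unfolding X_def W_def by fastforce
  have Cnz: "cS t * sfac \<tau> powi (2 * t + 1) \<noteq> 0" if "\<tau> \<in> upper_half" for \<tau>
    using sfac_nonzero[OF that] by (simp add: cS_def)
  \<comment> \<open>If G were nonzero, F = c G would hold. Translation by 1 fixes F but multiplies G
    by i or -i, so c = 0; the inversion formula for F = 0 then makes G vanish.\<close>
  have G0: "G \<tau> = 0" if t0: "\<tau> \<in> upper_half" for \<tau>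
  proof (rule ccontr)
    assume nz: "G \<tau> \<noteq> 0"
    define c where "c = F \<tau> / G \<tau>"
    have FcG: "F z = c * G z" if "z \<in> upper_half" for z
      unfolding c_def by (rule wronskian_zero_proportional[OF F G W0 t0 nz that])
    have "F (\<tau> + 1) = F \<tau>" using FG(3)[OF t0] FG(3)[of "\<tau> + 1"] t0 by (simp add: ee_add ring_distribs)
    moreover have "G (\<tau> + 1) = ee (ceps t) * G \<tau>"
      using FG(4)[OF t0] FG(4)[of "\<tau> + 1"] t0 by (simp add: ee_add ring_distribs)
    ultimately have "c * (ee (ceps t) * G \<tau>) = c * G \<tau>" using FcG[of \<tau>] FcG[of "\<tau> + 1"] t0 by simp
    moreover have "ee (ceps t) \<noteq> 1"
    proof -
      have "ee (- (1/4)) = - \<i>" using ee_diff[of 0 "1/4"] by (simp add: ee_quarter)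
      then show ?thesis by (auto simp: ceps_def sgnpow_def ee_quarter complex_eq_iff)
    qed
    ultimately have "c = 0" using nz by auto
    then have Fz: "F z = 0" if "z \<in> upper_half" for z using FcG[OF that] by simp
    have "F (- 1 / \<tau>) = cS t * sfac \<tau> powi (2 * t + 1) * (F \<tau> + G \<tau>)" using FG(5) t0 unfolding vvf_def by blast
    then show False using Fz[OF t0] Fz[OF upper_half_inversion[OF t0]] Cnz[OF t0] nz by simp
  qed
  have F0: "F \<tau> = 0" if t0: "\<tau> \<in> upper_half" for \<tau>
  proof -
    have "G (- 1 / \<tau>) = cS t * sfac \<tau> powi (2 * t + 1) * (F \<tau> - G \<tau>)" using FG(5) t0 unfolding vvf_def by blast
    then show ?thesis using G0[OF t0] G0[OF upper_half_inversion[OF t0]] Cnz[OF t0]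
      by (metis mult_eq_0_iff diff_zero)
  qed
  show ?thesis using zero F0 G0 by blast
qed

section \<open>Forms of extremal order\<close>

text \<open>The largest integer x with 12 x + 3 \<open>sgnpow t\<close> \<le> 2 t + 3, that is, the
  largest total order that \<open>vv_vanishing\<close> leaves open.\<close>

definition lam :: "int \<Rightarrow> int" where
  "lam t = (if even t then ell t else ell t + 1)"

lemma lam_bound:
  assumes "x > lam t"
  shows "12 * x + 3 * sgnpow t > 2 * t + 3"
proof (cases "even t")
  case True
  then have "t mod 6 \<noteq> 1" by presburger
  then have "lam t = t div 6" using True by (simp add: lam_def ell_def)
  moreover have "t mod 6 \<le> 4" using True by presburger
  moreover have "t = 6 * (t div 6) + t mod 6" by simp
  ultimately have "t \<le> 6 * lam t + 4" by linarith
  then show ?thesis using assms True by (simp add: sgnpow_def)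
next
  case False
  have "t \<le> 6 * ell t + 7" unfolding ell_def by presburger
  then show ?thesis using assms False by (simp add: sgnpow_def lam_def)
qed

definition ord_ge :: "(int \<Rightarrow> complex) \<Rightarrow> int \<Rightarrow> bool" where
  "ord_ge \<alpha> u \<longleftrightarrow> (\<forall>n<u. \<alpha> n = 0)"

lemma ord_ge_lin: "ord_ge \<alpha> u \<Longrightarrow> ord_ge \<beta> u \<Longrightarrow> ord_ge (\<lambda>n. x * \<alpha> n + y * \<beta> n) u"
  by (simp add: ord_ge_def)

lemma ord_ge_mono: "ord_ge \<alpha> u \<Longrightarrow> v \<le> u \<Longrightarrow> ord_ge \<alpha> v"
  by (simp add: ord_ge_def)

lemma ord_ge_Suc: "ord_ge \<alpha> u \<Longrightarrow> \<alpha> u = 0 \<Longrightarrow> ord_ge \<alpha> (u + 1)"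
  unfolding ord_ge_def by (metis zless_add1_eq)

lemma vv_eq_zero:
  assumes "vv t \<alpha> \<beta>" "ord_ge \<alpha> u" "ord_ge \<beta> v" "u + v > lam t"
  shows "\<alpha> n = 0" "\<beta> n = 0"
  using vv_vanishing[OF assms(1), of u v] assms lam_bound[OF assms(4)] by (auto simp: ord_ge_def)

text \<open>The pair attains the maximal total order allowed by \<open>vv_eq_zero\<close>.\<close>

definition tight :: "int \<Rightarrow> int \<Rightarrow> bool" where
  "tight t u \<longleftrightarrow> (\<exists>\<alpha> \<beta>. vv t \<alpha> \<beta> \<and> ord_ge \<alpha> u \<and> ord_ge \<beta> (lam t - u) \<and> \<alpha> u \<noteq> 0 \<and> \<beta> (lam t - u) \<noteq> 0)"

text \<open>If one of the two leading coefficients vanished, the total order would exceed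
  \<open>lam t\<close> and the form would be zero, contradicting the other.\<close>

lemma tightI:
  assumes vv: "vv t \<alpha> \<beta>" and o: "ord_ge \<alpha> u" "ord_ge \<beta> v" and uv: "u + v = lam t"
    and nz: "\<alpha> u \<noteq> 0 \<or> \<beta> v \<noteq> 0"
  shows "tight t u"
proof -
  have "\<alpha> u \<noteq> 0"
  proof
    assume "\<alpha> u = 0"
    then have "ord_ge \<alpha> (u + 1)" using o ord_ge_Suc by blast
    then show False using vv_eq_zero[OF vv, of "u + 1" v] o nz uv by auto
  qed
  moreover have "\<beta> v \<noteq> 0"
  proof
    assume "\<beta> v = 0"
    then have "ord_ge \<beta> (v + 1)" using o ord_ge_Suc by blast
    then show False using vv_eq_zero[OF vv, of u "v + 1"] o nz uv by auto
  qed
  moreover have "lam t - u = v" using uv by simp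
  ultimately show ?thesis unfolding tight_def using vv o by metis
qed

lemma vv_scal_ord:
  assumes A: "scal w n A" and w: "even w" and vv: "vv t \<alpha> \<beta>" and o: "ord_ge \<alpha> u" "ord_ge \<beta> v"
  obtains \<alpha>' \<beta>' where "vv (t + w) \<alpha>' \<beta>'" "ord_ge \<alpha>' (u + n)" "ord_ge \<beta>' (v + n)"
    "\<alpha>' (u + n) = \<alpha> u" "\<beta>' (v + n) = \<beta> v"
  using vv_scal[OF A w vv, of u v] o unfolding ord_ge_def by blast

text \<open>j is E4^3 over the discriminant: weight 0 and expansion q^(-1) + ..., so both orders
  drop by one and the leading coefficients stay.\<close>

lemma vv_times_j:
  assumes "vv t \<alpha> \<beta>" "ord_ge \<alpha> u" "ord_ge \<beta> v"
  obtains \<alpha>' \<beta>' where "vv t \<alpha>' \<beta>'" "ord_ge \<alpha>' (u - 1)" "ord_ge \<beta>' (v - 1)" "\<alpha>' (u - 1) = \<alpha> u" "\<beta>' (v - 1) = \<beta> v"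
proof -
  have "scal (4 + 4 + 4 + 12 * (- 1)) (0 + 0 + 0 + (- 1)) (\<lambda>\<tau>. E4 \<tau> * E4 \<tau> * E4 \<tau> * (sextic \<tau> ^ 4 / 16) powi (- 1))"
    by (intro scal_mult scal_E4 scal_sextic_power)
  then have "scal 0 (- 1) (\<lambda>\<tau>. E4 \<tau> * E4 \<tau> * E4 \<tau> * (sextic \<tau> ^ 4 / 16) powi (- 1))" by simp
  from vv_scal_ord[OF this _ assms] show ?thesis using that by (metis add.right_neutral even_zero uminus_add_conv_diff add.commute)
qed

text \<open>Multiplication by j lowers both orders by one. Subtracting multiples of the form of
  order u + 1 and then of the form of order u raises the second order by two; both corrections start
  beyond u - 1 in the first component and leave its leading term alone.\<close>

lemma tight_down:
  assumes "tight t u" "tight t (u + 1)"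
  shows "tight t (u - 1)"
proof -
  define L where "L = lam t - u"
  obtain a b where ab: "vv t a b" "ord_ge a u" "ord_ge b L" "a u \<noteq> 0" "b L \<noteq> 0"
    using assms(1) unfolding tight_def L_def by blast
  have L1: "lam t - (u + 1) = L - 1" by (simp add: L_def)
  obtain p q where pq: "vv t p q" "ord_ge p (u + 1)" "ord_ge q (L - 1)" "q (L - 1) \<noteq> 0"
    using assms(2) unfolding tight_def L1 by blast
  obtain a' b' where ab': "vv t a' b'" "ord_ge a' (u - 1)" "ord_ge b' (L - 1)" "a' (u - 1) = a u" "b' (L - 1) = b L"
    using vv_times_j[OF ab(1-3)] by blast
  define c where "c = - b' (L - 1) / q (L - 1)"
  define r s where "r = (\<lambda>n. 1 * a' n + c * p n)" and "s = (\<lambda>n. 1 * b' n + c * q n)"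
  have rs: "vv t r s" "ord_ge r (u - 1)" "ord_ge s (L - 1)" unfolding r_def s_def
    by (intro vv_lin ord_ge_lin ab' pq ord_ge_mono[OF pq(2)]; simp)+
  have "s (L - 1) = 0" using pq(4) by (simp add: s_def c_def)
  then have s: "ord_ge s L" using ord_ge_Suc[OF rs(3)] by simp
  have r: "r (u - 1) = a u" using pq(2) ab'(4) by (simp add: r_def ord_ge_def)
  define d where "d = - s L / b L"
  define x y where "x = (\<lambda>n. 1 * r n + d * a n)" and "y = (\<lambda>n. 1 * s n + d * b n)"
  have xy: "vv t x y" "ord_ge x (u - 1)" "ord_ge y L" unfolding x_def y_def
    by (intro vv_lin ord_ge_lin ab rs s ord_ge_mono[OF ab(2)]; simp)+
  have "y L = 0" using ab(5) by (simp add: y_def d_def)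
  then have y: "ord_ge y (L + 1)" using ord_ge_Suc[OF xy(3)] by simp
  have "x (u - 1) = a u" using ab(2) r by (simp add: x_def ord_ge_def)
  then show ?thesis using tightI[OF xy(1,2) y] ab(4) by (simp add: L_def)
qed

text \<open>Mirror image of \<open>tight_down\<close>: two corrections clear the first component at
  u - 1 and u, and the second keeps its leading term one place lower.\<close>

lemma tight_up:
  assumes "tight t u" "tight t (u - 1)"
  shows "tight t (u + 1)"
proof -
  define L where "L = lam t - u"
  obtain a b where ab: "vv t a b" "ord_ge a u" "ord_ge b L" "a u \<noteq> 0" "b L \<noteq> 0"
    using assms(1) unfolding tight_def L_def by blast
  have L1: "lam t - (u - 1) = L + 1" by (simp add: L_def)
  obtain p q where pq: "vv t p q" "ord_ge p (u - 1)" "ord_ge q (L + 1)" "p (u - 1) \<noteq> 0"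
    using assms(2) unfolding tight_def L1 by blast
  obtain a' b' where ab': "vv t a' b'" "ord_ge a' (u - 1)" "ord_ge b' (L - 1)" "a' (u - 1) = a u" "b' (L - 1) = b L"
    using vv_times_j[OF ab(1-3)] by blast
  define c where "c = - a' (u - 1) / p (u - 1)"
  define r s where "r = (\<lambda>n. 1 * a' n + c * p n)" and "s = (\<lambda>n. 1 * b' n + c * q n)"
  have rs: "vv t r s" "ord_ge r (u - 1)" "ord_ge s (L - 1)" unfolding r_def s_def
    by (intro vv_lin ord_ge_lin ab' pq ord_ge_mono[OF pq(3)]; simp)+
  have "r (u - 1) = 0" using pq(4) by (simp add: r_def c_def)
  then have r: "ord_ge r u" using ord_ge_Suc[OF rs(2)] by simp
  have s: "s (L - 1) = b L" using pq(3) ab'(5) by (simp add: s_def ord_ge_def)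
  define d where "d = - r u / a u"
  define x y where "x = (\<lambda>n. 1 * r n + d * a n)" and "y = (\<lambda>n. 1 * s n + d * b n)"
  have xy: "vv t x y" "ord_ge x u" "ord_ge y (L - 1)" unfolding x_def y_def
    by (intro vv_lin ord_ge_lin ab rs r ord_ge_mono[OF ab(3)]; simp)+
  have "x u = 0" using ab(4) by (simp add: x_def d_def)
  then have x: "ord_ge x (u + 1)" using ord_ge_Suc[OF xy(2)] by simp
  have "y (L - 1) = b L" using ab(3) s by (simp add: y_def ord_ge_def)
  then show ?thesis using tightI[OF xy(1) x xy(3)] ab(5) by (simp add: L_def)
qed

lemma tight_all:
  assumes "tight t u" "tight t (u + 1)"
  shows "tight t v"
proof -
  have "tight t v \<and> tight t (v + 1)"
  proof (induction v rule: int_induct[where k = u])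
    case (step1 i)
    then show ?case using tight_up[of t "i + 1"] by simp
  next
    case (step2 i)
    then show ?case using tight_down[of t i] by simp
  qed (use assms in auto)
  then show ?thesis by simp
qed

text \<open>Weights 0, 4, 6, 8, 10 and 14 have products of E4 and E6 of order 0. Weight 2 modulo 12
  has to be reached from 14, which costs one power of the discriminant and explains why a and b can
  differ by one.\<close>

lemma scalar_forms:
  assumes "even t"
  obtains a b A B where "scal t a A" "scal (t - 2) b B" "a + b + 1 = lam t" "a = b \<or> a = b + 1 \<or> b = a + 1"
proof -
  define D where "D = (\<lambda>k \<tau>. (sextic \<tau> ^ 4 / 16) powi k)"
  have D: "scal (12 * k) k (D k)" for k unfolding D_def by (rule scal_sextic_power)
  define k where "k = t div 12"
  have s: "scal w' n' A" if "scal w n A" "w = w'" "n = n'" for w w' n n' A using that by simp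
  have E0: "scal (12 * k) k (D k)" by (rule D)
  have E4k: "scal (4 + 12 * k) (0 + k) (\<lambda>\<tau>. E4 \<tau> * D k \<tau>)" by (intro scal_mult scal_E4 D)
  have E6k: "scal (6 + 12 * k) (0 + k) (\<lambda>\<tau>. E6 \<tau> * D k \<tau>)" by (intro scal_mult scal_E6 D)
  have E8k: "scal (4 + 4 + 12 * k) (0 + 0 + k) (\<lambda>\<tau>. E4 \<tau> * E4 \<tau> * D k \<tau>)" by (intro scal_mult scal_E4 D)
  have E10: "scal (4 + 6 + 12 * j) (0 + 0 + j) (\<lambda>\<tau>. E4 \<tau> * E6 \<tau> * D j \<tau>)" for j by (intro scal_mult scal_E4 scal_E6 D)
  have E14: "scal (4 + 4 + 6 + 12 * (k - 1)) (0 + 0 + 0 + (k - 1)) (\<lambda>\<tau>. E4 \<tau> * E4 \<tau> * E6 \<tau> * D (k - 1) \<tau>)"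
    by (intro scal_mult scal_E4 scal_E6 D)
  have t: "t = 12 * k + t mod 12" by (simp add: k_def)
  have "t mod 6 \<noteq> 1" using assms by presburger
  then have lam: "lam t = t div 6" using assms by (simp add: lam_def ell_def)
  have "t mod 12 \<in> {0, 2, 4, 6, 8, 10}" using assms by (simp, presburger)
  then consider "t = 12 * k" | "t = 12 * k + 2" | "t = 12 * k + 4" | "t = 12 * k + 6" | "t = 12 * k + 8" | "t = 12 * k + 10"
    using t by auto
  then show ?thesis
  proof cases
    case 1
    show ?thesis by (rule that[OF s[OF E0] s[OF E10[of "k - 1"]]]) (use 1 lam in auto)
  next
    case 2
    show ?thesis by (rule that[OF s[OF E14] s[OF E0]]) (use 2 lam in auto)
  next
    case 3
    show ?thesis by (rule that[OF s[OF E4k] s[OF E14]]) (use 3 lam in auto)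
  next
    case 4
    show ?thesis by (rule that[OF s[OF E6k] s[OF E4k]]) (use 4 lam in auto)
  next
    case 5
    show ?thesis by (rule that[OF s[OF E8k] s[OF E6k]]) (use 5 lam in auto)
  next
    case 6
    show ?thesis by (rule that[OF s[OF E10[of k]] s[OF E8k]]) (use 6 lam in auto)
  qed
qed

text \<open>Theta times A and the quintic pair times B have leading coefficients (1, 2) and (1, -10)
  at the orders a and b. Two neighbouring tight orders suffice by \<open>tight_all\<close>; they
  come from linear combinations, preceded by one multiplication by j if a and b differ.\<close>

lemma tight_even:
  assumes "even t"
  shows "tight t v"
proof -
  obtain a b A B where AB: "scal t a A" "scal (t - 2) b B" "a + b + 1 = lam t" "a = b \<or> a = b + 1 \<or> b = a + 1"
    by (rule scalar_forms[OF assms])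
  obtain x y where xy: "vv t x y" "ord_ge x a" "ord_ge y a" "x a = 1" "y a = 2"
  proof -
    obtain x y where 0: "vv 0 x y" "ord_ge x 0" "ord_ge y 0" "x 0 = 1" "y 0 = 2"
      using vv_theta unfolding ord_ge_def by blast
    obtain x' y' where "vv (0 + t) x' y'" "ord_ge x' (0 + a)" "ord_ge y' (0 + a)"
        "x' (0 + a) = x 0" "y' (0 + a) = y 0"
      by (rule vv_scal_ord[OF AB(1) assms 0(1-3)])
    then show ?thesis using that[of x' y'] 0 by simp
  qed
  obtain p q where pq: "vv t p q" "ord_ge p b" "ord_ge q b" "p b = 1" "q b = - 10"
  proof -
    obtain x y where 0: "vv 2 x y" "ord_ge x 0" "ord_ge y 0" "x 0 = 1" "y 0 = - 10"
      using vv_theta_quintic unfolding ord_ge_def by blast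
    have "even (t - 2)" using assms by simp
    then obtain x' y' where "vv (2 + (t - 2)) x' y'" "ord_ge x' (0 + b)" "ord_ge y' (0 + b)"
        "x' (0 + b) = x 0" "y' (0 + b) = y 0"
      using vv_scal_ord[OF AB(2) _ 0(1-3)] by metis
    then show ?thesis using that[of x' y'] 0 by simp
  qed
  consider "a = b" | "a = b + 1" | "b = a + 1" using AB(4) by blast
  then show ?thesis
  proof cases
    case 1
    \<comment> \<open>The coefficients come from 10 (1, 2) + 2 (1, -10) = (12, 0); for the order a +
      1, (1, 2) - (1, -10) = (0, 12) clears the other component.\<close>
    have "tight t a"
    proof (rule tightI[where v = "a + 1"])
      show "vv t (\<lambda>n. 10 * x n + 2 * p n) (\<lambda>n. 10 * y n + 2 * q n)" by (intro vv_lin xy pq)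
      show "ord_ge (\<lambda>n. 10 * x n + 2 * p n) a" by (intro ord_ge_lin xy pq[folded 1])
      show "ord_ge (\<lambda>n. 10 * y n + 2 * q n) (a + 1)"
        by (intro ord_ge_Suc ord_ge_lin xy pq[folded 1]) (simp add: xy pq[folded 1])
      show "10 * x a + 2 * p a \<noteq> 0 \<or> 10 * y (a + 1) + 2 * q (a + 1) \<noteq> 0" by (simp add: xy pq[folded 1])
    qed (use AB(3) 1 in simp)
    moreover have "tight t (a + 1)"
    proof (rule tightI[where v = a])
      show "vv t (\<lambda>n. 1 * x n + (- 1) * p n) (\<lambda>n. 1 * y n + (- 1) * q n)" by (intro vv_lin xy pq)
      show "ord_ge (\<lambda>n. 1 * x n + (- 1) * p n) (a + 1)"
        by (intro ord_ge_Suc ord_ge_lin xy pq[folded 1]) (simp add: xy pq[folded 1])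
      show "ord_ge (\<lambda>n. 1 * y n + (- 1) * q n) a" by (intro ord_ge_lin xy pq[folded 1])
      show "1 * x (a + 1) + (- 1) * p (a + 1) \<noteq> 0 \<or> 1 * y a + (- 1) * q a \<noteq> 0" by (simp add: xy pq[folded 1])
    qed (use AB(3) 1 in simp)
    ultimately show ?thesis using tight_all by blast
  next
    case 2
    \<comment> \<open>Here 2 a = \<open>lam t\<close>, so theta times A is tight as it stands. Its
      product with j, minus the other form and a multiple of itself, has orders a + 1 and a -
      1.\<close>
    have ta: "tight t a" by (rule tightI[OF xy(1-3)]) (use AB(3) 2 xy in auto)
    have b: "b = a - 1" using 2 by simp
    obtain x' y' where j: "vv t x' y'" "ord_ge x' (a - 1)" "ord_ge y' (a - 1)" "x' (a - 1) = 1" "y' (a - 1) = 2"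
      using vv_times_j[OF xy(1-3)] xy by metis
    define r s where "r = (\<lambda>n. 1 * x' n + (- 1) * p n)" and "s = (\<lambda>n. 1 * y' n + (- 1) * q n)"
    have rs: "vv t r s" "ord_ge r (a - 1)" "ord_ge s (a - 1)" unfolding r_def s_def
      by (intro vv_lin ord_ge_lin j pq[unfolded b])+
    have v: "r (a - 1) = 0" "s (a - 1) = 12" using pq[unfolded b] j by (auto simp: r_def s_def)
    have r: "ord_ge r a" using ord_ge_Suc[OF rs(2) v(1)] by simp
    have "tight t (a + 1)"
    proof (rule tightI[where v = "a - 1"])
      show "vv t (\<lambda>n. 1 * r n + (- r a) * x n) (\<lambda>n. 1 * s n + (- r a) * y n)" by (intro vv_lin rs xy)
      show "ord_ge (\<lambda>n. 1 * r n + (- r a) * x n) (a + 1)"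
        by (intro ord_ge_Suc ord_ge_lin r xy) (simp add: xy)
      show "ord_ge (\<lambda>n. 1 * s n + (- r a) * y n) (a - 1)" by (intro ord_ge_lin rs ord_ge_mono[OF xy(3)]) simp
      have "y (a - 1) = 0" using xy(3) by (simp add: ord_ge_def)
      then show "1 * r (a + 1) + (- r a) * x (a + 1) \<noteq> 0 \<or> 1 * s (a - 1) + (- r a) * y (a - 1) \<noteq> 0"
        by (simp add: v)
    qed (use AB(3) b in simp)
    then show ?thesis using tight_all[OF ta] by blast
  next
    case 3
    have tb: "tight t b" by (rule tightI[OF pq(1-3)]) (use AB(3) 3 pq in auto)
    have a: "a = b - 1" using 3 by simp
    obtain x' y' where j: "vv t x' y'" "ord_ge x' (b - 1)" "ord_ge y' (b - 1)" "x' (b - 1) = 1" "y' (b - 1) = - 10"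
      using vv_times_j[OF pq(1-3)] pq by metis
    define r s where "r = (\<lambda>n. 1 * x' n + (- 1) * x n)" and "s = (\<lambda>n. 1 * y' n + (- 1) * y n)"
    have rs: "vv t r s" "ord_ge r (b - 1)" "ord_ge s (b - 1)" unfolding r_def s_def
      by (intro vv_lin ord_ge_lin j xy[unfolded a])+
    have v: "r (b - 1) = 0" "s (b - 1) = - 12" using xy[unfolded a] j by (auto simp: r_def s_def)
    have r: "ord_ge r b" using ord_ge_Suc[OF rs(2) v(1)] by simp
    have "tight t (b + 1)"
    proof (rule tightI[where v = "b - 1"])
      show "vv t (\<lambda>n. 1 * r n + (- r b) * p n) (\<lambda>n. 1 * s n + (- r b) * q n)" by (intro vv_lin rs pq)
      show "ord_ge (\<lambda>n. 1 * r n + (- r b) * p n) (b + 1)"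
        by (intro ord_ge_Suc ord_ge_lin r pq) (simp add: pq)
      show "ord_ge (\<lambda>n. 1 * s n + (- r b) * q n) (b - 1)" by (intro ord_ge_lin rs ord_ge_mono[OF pq(3)]) simp
      have "q (b - 1) = 0" using pq(3) by (simp add: ord_ge_def)
      then show "1 * r (b + 1) + (- r b) * p (b + 1) \<noteq> 0 \<or> 1 * s (b - 1) + (- r b) * q (b - 1) \<noteq> 0"
        by (simp add: v)
    qed (use AB(3) a in simp)
    then show ?thesis using tight_all[OF tb] by blast
  qed
qed

text \<open>Odd weights are reached from the even t + 3 by \<open>vv_odd\<close>, which swaps the
  two orders; for odd t the bound \<open>lam\<close> is the same at t and t + 3.\<close>

theorem tight_exists: "tight t u"
proof (cases "even t")
  case False
  define d where "d = t div 6"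
  have "t mod 6 = 1 \<or> t mod 6 = 3 \<or> t mod 6 = 5" using False by presburger
  moreover have "t = 6 * d + t mod 6" by (simp add: d_def)
  ultimately consider "t = 6 * d + 1" | "t = 6 * d + 3" | "t = 6 * d + 5" by auto
  then have lam: "lam (t + 3) = lam t"
  proof cases
    case 1
    then have "t - 7 = 6 * (d - 1)" "t + 3 = 6 * d + 4" by auto
    then show ?thesis using 1 False by (simp add: lam_def ell_def)
  next
    case 2
    then have "t + 3 = 6 * (d + 1)" by simp
    then show ?thesis using 2 False by (simp add: lam_def ell_def)
  next
    case 3
    then have "t + 3 = 6 * (d + 1) + 2" by simp
    then show ?thesis using 3 False by (simp add: lam_def ell_def)
  qed
  define L where "L = lam t - u"
  have "tight (t + 3) L" using tight_even[of "t + 3"] False by simp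
  then obtain \<alpha> \<beta> where ab: "vv (t + 3) \<alpha> \<beta>" "ord_ge \<alpha> L" "ord_ge \<beta> u" "\<alpha> L \<noteq> 0" "\<beta> u \<noteq> 0"
    unfolding tight_def lam by (auto simp: L_def)
  have "\<exists>\<alpha>' \<beta>'. vv (t + 3 - 3) \<alpha>' \<beta>' \<and> (\<forall>n<u. \<alpha>' n = 0) \<and> (\<forall>n<L. \<beta>' n = 0) \<and> \<alpha>' u = \<beta> u / 2 \<and> \<beta>' L = - \<alpha> L / 2"
    by (rule vv_odd[OF _ ab(1)]) (use ab False in \<open>auto simp: ord_ge_def\<close>)
  then obtain \<alpha>' \<beta>' where r: "vv (t + 3 - 3) \<alpha>' \<beta>'" "\<forall>n<u. \<alpha>' n = 0" "\<forall>n<L. \<beta>' n = 0" "\<alpha>' u = \<beta> u / 2"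
    by blast
  show ?thesis by (rule tightI[of t \<alpha>' \<beta>' u L]) (use r ab in \<open>auto simp: ord_ge_def L_def\<close>)
qed (rule tight_even)

section \<open>The plus space\<close>

lemma has_qexp_ee:
  "has_qexp f a \<longleftrightarrow> (\<forall>\<tau>\<in>upper_half. ((\<lambda>n. a n * ee (of_int n * \<tau>)) has_sum f \<tau>) UNIV)"
  unfolding has_qexp_def by (simp add: ee_def mult_ac)

lemma sgnpow_cases: "sgnpow t = 1 \<or> sgnpow t = - 1"
  by (simp add: sgnpow_def)

lemma plus_index_iff: "plus_index t n \<longleftrightarrow> n mod 4 = 0 \<or> (n - sgnpow t) mod 4 = 0"
  unfolding plus_index_def sgnpow_def by (cases "even t"; simp; presburger)

lemma plus_index_range:
  assumes "plus_index t n"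
  shows "n \<in> range (\<lambda>k. 4 * k) \<union> range (\<lambda>k. 4 * k + sgnpow t)"
proof -
  from assms consider "n mod 4 = 0" | "(n - sgnpow t) mod 4 = 0" unfolding plus_index_iff by blast
  then show ?thesis
  proof cases
    case 1
    then have "n = 4 * (n div 4)" by auto
    then show ?thesis by blast
  next
    case 2
    then have "n = 4 * ((n - sgnpow t) div 4) + sgnpow t" by auto
    then show ?thesis by blast
  qed
qed

lemma plus_ranges_disjoint: "range (\<lambda>k::int. 4 * k) \<inter> range (\<lambda>k. 4 * k + sgnpow t) = {}"
proof -
  have "4 * k \<noteq> 4 * l + sgnpow t" for k l :: int
    using sgnpow_cases[of t] by presburger
  then show ?thesis by auto
qed

lemma has_sum_plus_split:
  fixes g :: "int \<Rightarrow> complex"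
  assumes z: "\<And>n. \<not> plus_index t n \<Longrightarrow> g n = 0"
    and A: "((\<lambda>k. g (4 * k)) has_sum A) UNIV" and B: "((\<lambda>k. g (4 * k + sgnpow t)) has_sum B) UNIV"
  shows "(g has_sum (A + B)) UNIV"
proof -
  have 1: "(g has_sum A) (range (\<lambda>k. 4 * k))"
    using A by (subst has_sum_reindex) (auto simp: o_def inj_on_def)
  have 2: "(g has_sum B) (range (\<lambda>k. 4 * k + sgnpow t))"
    using B by (subst has_sum_reindex) (auto simp: o_def inj_on_def)
  have "(g has_sum (A + B)) (range (\<lambda>k. 4 * k) \<union> range (\<lambda>k. 4 * k + sgnpow t))"
    by (rule has_sum_Un_disjoint[OF 1 2 plus_ranges_disjoint])
  then show ?thesis
    by (subst has_sum_cong_neutral[of "range (\<lambda>k. 4 * k) \<union> range (\<lambda>k. 4 * k + sgnpow t)" _ g g])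
       (use z plus_index_range in blast)+
qed

lemma qs_plus_1:
  assumes "has_qs \<kappa> \<alpha> F" and t: "\<tau> \<in> upper_half"
  shows "F (\<tau> + 1) = ee \<kappa> * F \<tau>"
proof -
  have "((\<lambda>n. ee \<kappa> * (\<alpha> n * ee ((of_int n + \<kappa>) * \<tau>))) has_sum ee \<kappa> * F \<tau>) UNIV"
    using assms unfolding has_qs_def by (intro has_sum_cmult_right) auto
  moreover have "ee \<kappa> * (\<alpha> n * ee ((of_int n + \<kappa>) * \<tau>)) = \<alpha> n * ee ((of_int n + \<kappa>) * (\<tau> + 1))" for n
    by (simp add: ring_distribs ee_add)
  moreover have "((\<lambda>n. \<alpha> n * ee ((of_int n + \<kappa>) * (\<tau> + 1))) has_sum F (\<tau> + 1)) UNIV"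
    using assms unfolding has_qs_def by auto
  ultimately show ?thesis using has_sum_unique by fastforce
qed

lemma ee_ceps_sq: "ee (ceps t) * ee (ceps t) = - 1"
proof -
  have m: "ee (- (1/2)) = - 1" using ee_diff[of 0 "1/2"] by (simp add: ee_half)
  have "ee (ceps t) * ee (ceps t) = ee (of_int (sgnpow t) / 2)"
    unfolding ee_add[symmetric] by (rule arg_cong[of _ _ ee]) (simp add: ceps_def)
  then show ?thesis using sgnpow_cases[of t] by (auto simp: ee_half m)
qed

section \<open>From the plus space to vector-valued forms\<close>

lemma qexp_plus_split:
  assumes f: "has_qexp f a" and a: "\<And>n. \<not> plus_index t n \<Longrightarrow> a n = 0"
  obtains F G where "has_qs 0 (\<lambda>n. a (4 * n)) F" "has_qs (ceps t) (\<lambda>n. a (4 * n + sgnpow t)) G"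
    "\<And>\<tau>. \<tau> \<in> upper_half \<Longrightarrow> f (\<tau> / 4) = F \<tau> + G \<tau>"
proof -
  define g where "g = (\<lambda>\<tau> n. a n * ee (of_int n * (\<tau> / 4)))"
  have g: "(g \<tau> has_sum f (\<tau> / 4)) UNIV" if "\<tau> \<in> upper_half" for \<tau>
    using f upper_half_scale(3)[OF that] unfolding has_qexp_ee g_def by blast
  define F where "F = (\<lambda>\<tau>. infsum (\<lambda>n. g \<tau> (4 * n)) UNIV)"
  define G where "G = (\<lambda>\<tau>. infsum (\<lambda>n. g \<tau> (4 * n + sgnpow t)) UNIV)"
  have sub: "(\<lambda>n. g \<tau> (4 * n + r)) summable_on UNIV" if "\<tau> \<in> upper_half" for \<tau> r
  proof -
    have "g \<tau> summable_on range (\<lambda>n. 4 * n + r)"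
      by (rule summable_on_subset_banach[OF has_sum_imp_summable[OF g[OF that]]]) simp
    then show ?thesis by (subst (asm) summable_on_reindex) (auto simp: o_def inj_on_def)
  qed
  have F: "((\<lambda>n. g \<tau> (4 * n)) has_sum F \<tau>) UNIV" if "\<tau> \<in> upper_half" for \<tau>
    unfolding F_def using sub[OF that, of 0] by simp
  have G: "((\<lambda>n. g \<tau> (4 * n + sgnpow t)) has_sum G \<tau>) UNIV" if "\<tau> \<in> upper_half" for \<tau>
    unfolding G_def using sub[OF that] by simp
  show thesis
  proof
    show "has_qs 0 (\<lambda>n. a (4 * n)) F" unfolding has_qs_def using F by (simp add: g_def)
    have k: "of_int (4 * n + sgnpow t) * (\<tau> / 4) = (of_int n + ceps t) * \<tau>" for n \<tau>
      by (simp add: ceps_def field_simps)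
    show "has_qs (ceps t) (\<lambda>n. a (4 * n + sgnpow t)) G" unfolding has_qs_def using G unfolding g_def k by blast
    show "f (\<tau> / 4) = F \<tau> + G \<tau>" if "\<tau> \<in> upper_half" for \<tau>
      by (rule has_sum_unique[OF g[OF that] has_sum_plus_split[OF _ F[OF that] G[OF that]]])
         (simp add: g_def a)
  qed
qed

text \<open>The behaviour of theta under the two elements of Gamma0(4) used in
  \<open>wh_plus_imp_vv\<close>, written in the variable of the inversion.\<close>

lemma theta_shifted_inversion:
  assumes t: "\<tau> \<in> upper_half"
  shows "theta ((- 1 / \<tau> - 1) / 4) = sfac \<tau> * (1 - \<i>) * theta ((\<tau> + 1) / 4)"
    and "theta ((- 1 / \<tau> - 1) / 4 + 1/2) = sfac \<tau> * (1 + \<i>) * theta ((\<tau> + 1) / 4 + 1/2)"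
proof -
  have H: "- 1 / \<tau> - 1 \<in> upper_half" by (intro upper_half_shift upper_half_inversion t)
  have "theta (- 1 / \<tau> - 1) = theta (- 1 / \<tau>)" "\<i> * theta1 (- 1 / \<tau> - 1) = theta1 (- 1 / \<tau>)"
    using theta_plus_1[OF H] theta1_plus_1[OF H] by simp_all
  moreover have "theta1 (- 1 / \<tau> - 1) = - \<i> * (\<i> * theta1 (- 1 / \<tau> - 1))" by (simp flip: mult.assoc)
  ultimately have e: "theta (- 1 / \<tau> - 1) = sfac \<tau> * (theta \<tau> + theta1 \<tau>)"
      "theta1 (- 1 / \<tau> - 1) = - \<i> * (sfac \<tau> * (theta \<tau> - theta1 \<tau>))"
    using theta_S[OF t] theta1_S[OF t] by metis+
  show "theta ((- 1 / \<tau> - 1) / 4) = sfac \<tau> * (1 - \<i>) * theta ((\<tau> + 1) / 4)"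
    unfolding theta_quarter[OF H] theta_quarter_shift[OF t] e by (simp add: algebra_simps)
  have th: "theta ((\<tau> + 1) / 4 + 1/2) = theta \<tau> - \<i> * theta1 \<tau>"
    using theta_half_shift[of "\<tau> + 1"] t theta_plus_1[OF t] theta1_plus_1[OF t] by simp
  show "theta ((- 1 / \<tau> - 1) / 4 + 1/2) = sfac \<tau> * (1 + \<i>) * theta ((\<tau> + 1) / 4 + 1/2)"
    unfolding theta_half_shift[OF H] e th by (simp add: algebra_simps)
qed

text \<open>Sum and twisted difference of the two theta multipliers give the same constant, so a
  single \<open>cS t\<close> serves both rows of \<open>vvf\<close>.\<close>

lemma cS_sum:
  "(1 - \<i>) powi (2 * t + 1) + (1 + \<i>) powi (2 * t + 1) = 2 * cS t"
  "ee (ceps t) * ((1 - \<i>) powi (2 * t + 1) - (1 + \<i>) powi (2 * t + 1)) = 2 * cS t"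
proof -
  have nz: "1 - \<i> \<noteq> 0" "1 + \<i> \<noteq> 0" by (auto simp: complex_eq_iff)
  have sq: "(1 + \<i>)\<^sup>2 = 2 * \<i>" "(1 - \<i>)\<^sup>2 = - (2 * \<i>)" by (simp_all add: power2_eq_square algebra_simps)
  have odd: "x powi (2 * t + 1) = (x\<^sup>2) powi t * x" if "x \<noteq> 0" for x :: complex
    using that by (simp add: power_int_add flip: powi_double)
  have p: "(1 + \<i>) powi (2 * t + 1) = (2 * \<i>) powi t * (1 + \<i>)"
    using odd[OF nz(2)] unfolding sq .
  have "(1 - \<i>) powi (2 * t + 1) = (- (2 * \<i>)) powi t * (1 - \<i>)"
    using odd[OF nz(1)] unfolding sq .
  then have m: "(1 - \<i>) powi (2 * t + 1) = (if even t then 1 else - 1) * (2 * \<i>) powi t * (1 - \<i>)"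
    by (simp add: power_int_minus_left)
  show "(1 - \<i>) powi (2 * t + 1) + (1 + \<i>) powi (2 * t + 1) = 2 * cS t"
    unfolding p m cS_def by (simp add: algebra_simps)
  have "ee (- (1/4)) = - \<i>" using ee_diff[of 0 "1/4"] by (simp add: ee_quarter)
  then have e: "ee (ceps t) = (if even t then \<i> else - \<i>)" by (simp add: ceps_def sgnpow_def ee_quarter)
  show "ee (ceps t) * ((1 - \<i>) powi (2 * t + 1) - (1 + \<i>) powi (2 * t + 1)) = 2 * cS t"
    unfolding p m cS_def e by (simp add: algebra_simps)
qed

text \<open>F + G and F - G are the values of f at \<tau>/4 and \<tau>/4 + 1/2. Invariance under
  Gamma0(4) links each of them at -1/\<tau> - 1 with its counterpart at \<tau> + 1; the two
  equations are then solved for F and G.\<close>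

theorem wh_plus_imp_vv:
  assumes wh: "wh_plus t f" and f: "has_qexp f a" and a: "\<And>n. \<not> plus_index t n \<Longrightarrow> a n = 0"
    and fin: "\<And>n. n < n\<^sub>0 \<Longrightarrow> a n = 0"
  shows "vv t (\<lambda>n. a (4 * n)) (\<lambda>n. a (4 * n + sgnpow t))"
proof -
  obtain F G where F: "has_qs 0 (\<lambda>n. a (4 * n)) F" and G: "has_qs (ceps t) (\<lambda>n. a (4 * n + sgnpow t)) G"
    and fFG: "\<And>\<tau>. \<tau> \<in> upper_half \<Longrightarrow> f (\<tau> / 4) = F \<tau> + G \<tau>"
    using qexp_plus_split[OF f a] by blast
  define e where "e = ee (ceps t)"
  have e2: "e * e = - 1" unfolding e_def by (rule ee_ceps_sq)
  have e0: "e \<noteq> 0" by (simp add: e_def)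
  have F1: "F (\<tau> + 1) = F \<tau>" if "\<tau> \<in> upper_half" for \<tau> using qs_plus_1[OF F that] by simp
  have G1: "G (\<tau> + 1) = e * G \<tau>" if "\<tau> \<in> upper_half" for \<tau> using qs_plus_1[OF G that] by (simp add: e_def)
  \<comment> \<open>Two translations multiply G by e e = -1.\<close>
  have fh: "f (\<tau> / 4 + 1/2) = F \<tau> - G \<tau>" if "\<tau> \<in> upper_half" for \<tau>
  proof -
    have "f ((\<tau> + 1 + 1) / 4) = F \<tau> + e * (e * G \<tau>)"
      using fFG[of "\<tau> + 1 + 1"] F1[of "\<tau> + 1"] F1[OF that] G1[of "\<tau> + 1"] G1[OF that] that
      by (metis upper_half_shift(1))
    moreover have "(\<tau> + 1 + 1) / 4 = \<tau> / 4 + 1/2" by (simp add: field_simps)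
    ultimately show ?thesis using e2 by (metis mult.assoc mult_minus1 diff_conv_add_uminus)
  qed
  have tr: "f (moeb a b c d z) = (theta (moeb a b c d z) / theta z) powi (2 * t + 1) * f z"
    if "(a, b, c, d) \<in> Gamma0_4" "z \<in> upper_half" for a b c d z
    using wh that unfolding wh_plus_def by blast
  have "vvf t F G" unfolding vvf_def
  proof
    fix \<tau> assume t: "\<tau> \<in> upper_half"
    define \<tau>' where "\<tau>' = - 1 / \<tau> - 1"
    have H': "\<tau>' \<in> upper_half" unfolding \<tau>'_def by (intro upper_half_shift upper_half_inversion t)
    define s where "s = sfac \<tau>"
    have s0: "s \<noteq> 0" using sfac_nonzero[OF t] by (simp add: s_def)
    have ii: "1 - \<i> \<noteq> 0" "1 + \<i> \<noteq> 0" by (auto simp: complex_eq_iff)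
    have \<tau>0: "\<tau> \<noteq> 0" by (rule upper_half_nonzero[OF t])
    \<comment> \<open>Two elements of Gamma0(4) that carry the points \<tau>'/4 and \<tau>'/4 + 1/2
      to the analogous points for \<tau> + 1.\<close>
    have m1: "moeb 1 0 4 1 (\<tau>' / 4) = (\<tau> + 1) / 4"
      using \<tau>0 by (simp add: moeb_def \<tau>'_def field_simps)
    have m2: "moeb 3 (- 1) 4 (- 1) (\<tau>' / 4 + 1/2) = (\<tau> + 1) / 4 + 1/2"
      using \<tau>0 by (simp add: moeb_def \<tau>'_def field_simps)
    have th0: "theta ((\<tau> + 1) / 4) \<noteq> 0" "theta ((\<tau> + 1) / 4 + 1/2) \<noteq> 0"
      using t by (intro theta_nonzero; simp)+
    have inv: "x = c powi (2 * t + 1) * y" if "y = inverse c powi (2 * t + 1) * x" "c \<noteq> 0" for x y c :: complex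
      using that by (simp add: power_int_inverse)
    have "f ((\<tau> + 1) / 4) = (theta ((\<tau> + 1) / 4) / theta (\<tau>' / 4)) powi (2 * t + 1) * f (\<tau>' / 4)"
      using tr[of 1 0 4 1 "\<tau>' / 4"] H' unfolding m1 by (simp add: Gamma0_4_def)
    moreover have "theta ((\<tau> + 1) / 4) / theta (\<tau>' / 4) = inverse (s * (1 - \<i>))"
      unfolding \<tau>'_def theta_shifted_inversion(1)[OF t] s_def
      by (simp only: nonzero_divide_mult_cancel_right[OF th0(1)] inverse_eq_divide)
    ultimately have 1: "f (\<tau>' / 4) = s powi (2 * t + 1) * (1 - \<i>) powi (2 * t + 1) * f ((\<tau> + 1) / 4)"
      unfolding power_int_mult_distrib[symmetric]
      by - (rule inv, simp only:, use s0 ii in simp)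
    have "f ((\<tau> + 1) / 4 + 1/2) = (theta ((\<tau> + 1) / 4 + 1/2) / theta (\<tau>' / 4 + 1/2)) powi (2 * t + 1) * f (\<tau>' / 4 + 1/2)"
      using tr[of 3 "- 1" 4 "- 1" "\<tau>' / 4 + 1/2"] H' unfolding m2 by (simp add: Gamma0_4_def)
    moreover have "theta ((\<tau> + 1) / 4 + 1/2) / theta (\<tau>' / 4 + 1/2) = inverse (s * (1 + \<i>))"
      unfolding \<tau>'_def theta_shifted_inversion(2)[OF t] s_def
      by (simp only: nonzero_divide_mult_cancel_right[OF th0(2)] inverse_eq_divide)
    ultimately have 2: "f (\<tau>' / 4 + 1/2) = s powi (2 * t + 1) * (1 + \<i>) powi (2 * t + 1) * f ((\<tau> + 1) / 4 + 1/2)"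
      unfolding power_int_mult_distrib[symmetric]
      by - (rule inv, simp only:, use s0 ii in simp)
    have F': "F \<tau>' = F (- 1 / \<tau>)" using F1[OF H'] by (simp add: \<tau>'_def)
    have G': "e * G \<tau>' = G (- 1 / \<tau>)" using G1[OF H'] by (simp add: \<tau>'_def)
    define S M P where "S = s powi (2 * t + 1)" and "M = (1 - \<i>) powi (2 * t + 1)" and "P = (1 + \<i>) powi (2 * t + 1)"
    have k1: "M + P = 2 * cS t" and k2: "e * (M - P) = 2 * cS t"
      unfolding M_def P_def e_def by (rule cS_sum)+
    have E1: "F \<tau>' + G \<tau>' = S * M * (F \<tau> + e * G \<tau>)"
      using 1 fFG[OF H'] fFG[of "\<tau> + 1"] F1[OF t] G1[OF t] t by (simp add: S_def M_def)
    have E2: "F \<tau>' - G \<tau>' = S * P * (F \<tau> - e * G \<tau>)"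
      using 2 fh[OF H'] fh[of "\<tau> + 1"] F1[OF t] G1[OF t] t by (simp add: S_def P_def)
    have "2 * F \<tau>' = S * ((M + P) * F \<tau> + e * (M - P) * G \<tau>)"
      using E1 E2 by algebra
    also have "\<dots> = 2 * (cS t * S * (F \<tau> + G \<tau>))" unfolding k1 k2 by (simp add: algebra_simps)
    finally have A: "F \<tau>' = cS t * S * (F \<tau> + G \<tau>)" by simp
    have "2 * (e * G \<tau>') = S * (e * (M - P) * F \<tau> + (e * e) * (M + P) * G \<tau>)"
      using E1 E2 by algebra
    also have "\<dots> = 2 * (cS t * S * (F \<tau> - G \<tau>))" unfolding k1 k2 e2 by (simp add: algebra_simps)
    finally have B: "e * G \<tau>' = cS t * S * (F \<tau> - G \<tau>)" by simp
    show "F (- 1 / \<tau>) = cS t * sfac \<tau> powi (2 * t + 1) * (F \<tau> + G \<tau>) \<and>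
        G (- 1 / \<tau>) = cS t * sfac \<tau> powi (2 * t + 1) * (F \<tau> - G \<tau>)"
      using A B unfolding F' G' S_def s_def by simp
  qed
  moreover have "\<forall>n<n\<^sub>0 div 4 - 1. a (4 * n) = 0 \<and> a (4 * n + sgnpow t) = 0"
    using sgnpow_cases[of t] by (auto intro!: fin)
  ultimately show ?thesis unfolding vv_def using F G by blast
qed

section \<open>Generators of the modular groups\<close>

lemma moeb_denom_nonzero:
  assumes "a * d - b * c = 1" "\<tau> \<in> upper_half"
  shows "of_int c * \<tau> + of_int d \<noteq> (0::complex)"
proof
  assume z: "of_int c * \<tau> + of_int d = (0::complex)"
  then have "Im (of_int c * \<tau> + of_int d) = 0" by simp
  then have c: "c = 0" using assms(2) by (simp add: upper_half_def)
  with z have "d = 0" by simp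
  with c show False using assms(1) by simp
qed

lemma Im_moeb:
  assumes "a * d - b * c = 1"
  shows "Im (moeb a b c d \<tau>) = Im \<tau> / (norm (of_int c * \<tau> + of_int d))\<^sup>2"
proof -
  have "real_of_int (a * d - b * c) = 1" using assms by simp
  then have "real_of_int a * Im \<tau> * (real_of_int c * Re \<tau> + real_of_int d) -
      (real_of_int a * Re \<tau> + real_of_int b) * (real_of_int c * Im \<tau>) = Im \<tau> * 1"
    by (simp only: of_int_diff of_int_mult flip: \<open>real_of_int (a * d - b * c) = 1\<close>) (simp add: algebra_simps)
  then show ?thesis unfolding moeb_def by (simp add: Im_divide cmod_power2)
qed

lemma moeb_upper_half:
  assumes "a * d - b * c = 1" "\<tau> \<in> upper_half"
  shows "moeb a b c d \<tau> \<in> upper_half"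
  using Im_moeb[OF assms(1), of \<tau>] moeb_denom_nonzero[OF assms] assms(2) by (simp add: upper_half_def)

lemma moeb_translate:
  assumes "a * d - b * c = 1" "\<tau> \<in> upper_half"
  shows "moeb (a + k * c) (b + k * d) c d \<tau> = moeb a b c d \<tau> + of_int k"
  using moeb_denom_nonzero[OF assms] by (simp add: moeb_def field_simps)

lemma moeb_upper_triangular:
  assumes "a * d - b * 0 = (1::int)"
  shows "moeb a b 0 d \<tau> = \<tau> + of_int (a * b)"
proof -
  have "a * d = 1" using assms by simp
  then have "a = 1 \<and> d = 1 \<or> a = - 1 \<and> d = - 1" using zmult_eq_1_iff by blast
  then show ?thesis by (auto simp: moeb_def)
qed

text \<open>Euclid's algorithm on the first column: a translation reduces a modulo c, the inversion
  swaps the rows, and |c| decreases.\<close>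

lemma SL2_invariant:
  fixes \<phi> :: "complex \<Rightarrow> 'a"
  assumes T: "\<And>\<tau>. \<tau> \<in> upper_half \<Longrightarrow> \<phi> (\<tau> + 1) = \<phi> \<tau>"
    and S: "\<And>\<tau>. \<tau> \<in> upper_half \<Longrightarrow> \<phi> (- 1 / \<tau>) = \<phi> \<tau>"
    and det: "a * d - b * c = 1" and t: "\<tau> \<in> upper_half"
  shows "\<phi> (moeb a b c d \<tau>) = \<phi> \<tau>"
  using det
proof (induction "nat \<bar>c\<bar>" arbitrary: a b c d rule: less_induct)
  case less
  show ?case
  proof (cases "c = 0")
    case True
    then show ?thesis using less(2) moeb_upper_triangular[of a d b \<tau>] periodic_of_int[of \<phi> \<tau> "a * b"] T t by simp
  next
    case False
    define k where "k = - (a div c)"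
    define a' b' where "a' = a + k * c" and "b' = b + k * d"
    have a': "\<bar>a'\<bar> < \<bar>c\<bar>"
    proof -
      have "a' = a mod c" unfolding a'_def k_def by (simp add: minus_div_mult_eq_mod)
      then show ?thesis using False abs_mod_less by simp
    qed
    have det': "a' * d - b' * c = 1" using less(2) by (simp add: a'_def b'_def algebra_simps)
    then have det'': "(- c) * b' - (- d) * a' = 1" by (simp add: algebra_simps)
    have w: "moeb a' b' c d \<tau> = moeb a b c d \<tau> + of_int k"
      unfolding a'_def b'_def by (rule moeb_translate[OF less(2) t])
    have "\<phi> (moeb a b c d \<tau>) = \<phi> (moeb a' b' c d \<tau>)"
      unfolding w using periodic_of_int[of \<phi> "moeb a b c d \<tau>" k] T moeb_upper_half[OF less(2) t] by simp
    also have "\<dots> = \<phi> (- 1 / moeb a' b' c d \<tau>)"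
      using S[OF moeb_upper_half[OF det' t]] by simp
    also have "- 1 / moeb a' b' c d \<tau> = moeb (- c) (- d) a' b' \<tau>"
      by (simp add: moeb_def minus_divide_left[symmetric])
    also have "\<phi> (moeb (- c) (- d) a' b' \<tau>) = \<phi> \<tau>"
      by (rule less(1)[OF _ det'']) (use a' in simp)
    finally show ?thesis .
  qed
qed

text \<open>Remainders of least absolute value: the gained factor 2 pays for reducing modulo 4 a in
  \<open>Gamma0_4_invariant\<close>.\<close>

lemma nearest_multiple:
  fixes a c :: int
  assumes "c \<noteq> 0"
  obtains k where "2 * \<bar>a + k * c\<bar> \<le> \<bar>c\<bar>"
proof -
  define m where "m = \<bar>c\<bar>"
  define r where "r = a mod m"
  have m: "m > 0" using assms by (simp add: m_def)
  have r: "0 \<le> r" "r < m" using m by (auto simp: r_def)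
  have a: "a = m * (a div m) + r" by (simp add: r_def)
  have mc: "m = sgn c * c" by (simp add: m_def abs_sgn mult.commute)
  show ?thesis
  proof (cases "2 * r \<le> m")
    case True
    have "a + (- (a div m) * sgn c) * c = r" using a mc by (simp add: algebra_simps)
    then show ?thesis using that[of "- (a div m) * sgn c"] r True by (simp add: m_def)
  next
    case False
    have "a + (- (a div m + 1) * sgn c) * c = r - m" using a mc by (simp add: algebra_simps)
    then show ?thesis using that[of "- (a div m + 1) * sgn c"] r False by (simp add: m_def)
  qed
qed

text \<open>Translation and \<tau> / (4\<tau> + 1) generate Gamma0(4) up to sign. First a is reduced
  modulo c, then c modulo 4 a. As a is odd and 4 divides c, the first step gives 2 |a| < |c|
  strictly, and the second makes |c| at most 2 |a|.\<close>

lemma Gamma0_4_invariant: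
  fixes \<phi> :: "complex \<Rightarrow> 'a"
  assumes T: "\<And>\<tau>. \<tau> \<in> upper_half \<Longrightarrow> \<phi> (\<tau> + 1) = \<phi> \<tau>"
    and V: "\<And>\<tau>. \<tau> \<in> upper_half \<Longrightarrow> \<phi> (\<tau> / (4 * \<tau> + 1)) = \<phi> \<tau>"
    and det: "a * d - b * c = 1" and c4: "4 dvd c" and t: "\<tau> \<in> upper_half"
  shows "\<phi> (moeb a b c d \<tau>) = \<phi> \<tau>"
  using det c4
proof (induction "nat \<bar>c\<bar>" arbitrary: a b c d rule: less_induct)
  case less
  \<comment> \<open>Conjugation by w -> -1/(4w) turns the second generator into a translation, so
    its integer powers are covered by \<open>periodic_of_int\<close>.\<close>
  define \<psi> where "\<psi> = (\<lambda>w. \<phi> (- 1 / (4 * w)))"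
  have \<psi>T: "\<psi> (w + 1) = \<psi> w" if w: "w \<in> upper_half" for w
  proof -
    define z where "z = - 1 / (4 * (w + 1))"
    have z: "z \<in> upper_half" unfolding z_def
      by (intro upper_half_inversion upper_half_scale upper_half_shift w)
    have nz: "w \<noteq> 0" "w + 1 \<noteq> 0" using upper_half_nonzero w by auto
    have "4 * (- 1 / (4 * x)) = - 1 / x" for x :: complex by simp
    then have "4 * z = - 1 / (w + 1)" unfolding z_def by blast
    then have "4 * z + 1 = w / (w + 1)" using nz by (simp add: field_simps)
    moreover have "z = 4 * z / 4" by simp
    ultimately have 4: "z = - 1 / (w + 1) / 4" "4 * z + 1 = w / (w + 1)"
      unfolding \<open>4 * z = - 1 / (w + 1)\<close> by blast+
    have "- 1 / v / 4 / (w / v) = - 1 / (4 * w)" if "v \<noteq> 0" for v using that nz by simp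
    from this[OF nz(2)] have "z / (4 * z + 1) = - 1 / (4 * w)" unfolding 4(1)[symmetric] 4(2)[symmetric] .
    then show ?thesis using V[OF z] by (simp add: \<psi>_def z_def)
  qed
  have Vl: "\<phi> (w / (4 * of_int l * w + 1)) = \<phi> w" if w: "w \<in> upper_half" for w l
  proof -
    have w0: "w \<noteq> 0" using upper_half_nonzero[OF w] .
    have H: "- 1 / (4 * w) \<in> upper_half" by (intro upper_half_inversion upper_half_scale w)
    have "\<psi> (- 1 / (4 * w) + of_int (- l)) = \<psi> (- 1 / (4 * w))"
      using periodic_of_int[of \<psi> "- 1 / (4 * w)" "- l"] \<psi>T H by simp
    moreover have q: "4 * (- 1 / (4 * w) + of_int (- l)) = - (4 * of_int l * w + 1) / w"
      using w0 by (simp add: field_simps)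
    have "- 1 / (- D / w) = w / D" for D by simp
    then have "- 1 / (4 * (- 1 / (4 * w) + of_int (- l))) = w / (4 * of_int l * w + 1)"
      unfolding q by blast
    moreover have "- 1 / (4 * (- 1 / (4 * w))) = w" using w0 by simp
    ultimately show ?thesis unfolding \<psi>_def by simp
  qed
  show ?case
  proof (cases "c = 0")
    case True
    then show ?thesis using less(2) moeb_upper_triangular[of a d b \<tau>] periodic_of_int[of \<phi> \<tau> "a * b"] T t by simp
  next
    case False
    obtain k where k: "2 * \<bar>a + k * c\<bar> \<le> \<bar>c\<bar>" using nearest_multiple[OF False] by blast
    define a' b' where "a' = a + k * c" and "b' = b + k * d"
    have det': "a' * d - b' * c = 1" using less(2) by (simp add: a'_def b'_def algebra_simps)
    obtain c' where c': "c = 4 * c'" using less(3) by blast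
    have "odd a'"
    proof
      assume "even a'"
      then have "even (a' * d - b' * c)" using c' by simp
      then show False using det' by simp
    qed
    then have a'0: "a' \<noteq> 0" by auto
    have "2 * \<bar>a'\<bar> \<noteq> \<bar>c\<bar>"
    proof
      assume "2 * \<bar>a'\<bar> = \<bar>c\<bar>"
      then have "\<bar>a'\<bar> = 2 * \<bar>c'\<bar>" using c' by (simp add: abs_mult)
      then have "even a'" by (metis dvd_abs_iff dvd_triv_left)
      then show False using \<open>odd a'\<close> by simp
    qed
    then have a': "2 * \<bar>a'\<bar> < \<bar>c\<bar>" using k by (simp add: a'_def)
    obtain l where l: "2 * \<bar>c + l * (4 * a')\<bar> \<le> \<bar>4 * a'\<bar>" using nearest_multiple[of "4 * a'" c] a'0 by auto
    define c'' d'' where "c'' = c + 4 * l * a'" and "d'' = d + 4 * l * b'"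
    have "2 * \<bar>c''\<bar> \<le> 4 * \<bar>a'\<bar>" using l by (simp add: c''_def abs_mult mult_ac)
    then have cc: "\<bar>c''\<bar> < \<bar>c\<bar>" using a' by simp
    have det'': "a' * d'' - b' * c'' = 1" using det' by (simp add: c''_def d''_def algebra_simps)
    define w where "w = moeb a' b' c d \<tau>"
    have wH: "w \<in> upper_half" unfolding w_def by (rule moeb_upper_half[OF det' t])
    have nz: "of_int c * \<tau> + of_int d \<noteq> (0::complex)" by (rule moeb_denom_nonzero[OF det' t])
    have "4 * of_int l * w + 1 = (of_int c'' * \<tau> + of_int d'') / (of_int c * \<tau> + of_int d)"
      using nz by (simp add: w_def moeb_def c''_def d''_def field_simps)
    then have "w / (4 * of_int l * w + 1) = moeb a' b' c'' d'' \<tau>"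
      using nz by (simp add: w_def moeb_def)
    then have "\<phi> (moeb a' b' c'' d'' \<tau>) = \<phi> w" using Vl[OF wH, of l] by simp
    moreover have "\<phi> (moeb a' b' c'' d'' \<tau>) = \<phi> \<tau>"
      by (rule less(1)[OF _ det'']) (use cc less(3) in \<open>auto simp: c''_def\<close>)
    moreover have "w = moeb a b c d \<tau> + of_int k"
      unfolding w_def a'_def b'_def by (rule moeb_translate[OF less(2) t])
    then have "\<phi> w = \<phi> (moeb a b c d \<tau>)"
      using periodic_of_int[of \<phi> "moeb a b c d \<tau>" k] T moeb_upper_half[OF less(2) t] by simp
    ultimately show ?thesis by simp
  qed
qed

section \<open>Growth at the cusps and the converse\<close>

lemma qrep_growth:
  assumes h: "h holomorphic_on ball 0 1"
    and F: "\<And>\<tau>. \<tau> \<in> upper_half \<Longrightarrow> F \<tau> = ee (of_real r * \<tau>) * h (ee \<tau>)"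
  obtains K where "K > 0" "\<And>\<tau>. Im \<tau> \<ge> 1/4 \<Longrightarrow> norm (F \<tau>) \<le> K * exp (K * Im \<tau>)"
proof -
  \<comment> \<open>The value of |q| at height 1/4, which is the least height that
    \<open>hecke_decomposition\<close> produces from Im \<tau> \<ge> 1.\<close>
  define \<rho> where "\<rho> = exp (- pi / 2)"
  have "\<rho> < 1" by (simp add: \<rho>_def)
  then have "continuous_on (cball 0 \<rho>) h"
    by (intro continuous_on_subset[OF holomorphic_on_imp_continuous_on[OF h]]) auto
  then have "bounded (h ` cball 0 \<rho>)" by (intro compact_imp_bounded compact_continuous_image) auto
  then obtain B where B: "B > 0" "\<And>w. norm w \<le> \<rho> \<Longrightarrow> norm (h w) \<le> B"
    unfolding bounded_pos by force
  define K where "K = B + 2 * pi * \<bar>r\<bar>"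
  show ?thesis
  proof
    show "K > 0" using B by (simp add: K_def add_pos_nonneg)
    fix \<tau> assume t: "Im \<tau> \<ge> 1/4"
    then have H: "\<tau> \<in> upper_half" by (simp add: upper_half_def)
    have "norm (ee \<tau>) \<le> \<rho>" using t by (simp add: norm_ee \<rho>_def)
    then have 1: "norm (h (ee \<tau>)) \<le> B" by (rule B)
    have "- (r * Im \<tau>) \<le> \<bar>r\<bar> * Im \<tau>" using t by (metis abs_ge_minus_self abs_mult abs_of_nonneg divide_nonneg_nonneg order_trans zero_le_numeral zero_le_one)
    then have "2 * pi * (- (r * Im \<tau>)) \<le> 2 * pi * (\<bar>r\<bar> * Im \<tau>)" by (intro mult_left_mono) auto
    also have "\<dots> \<le> K * Im \<tau>" using B t by (simp add: K_def distrib_right)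
    finally have 2: "norm (ee (of_real r * \<tau>)) \<le> exp (K * Im \<tau>)" by (simp add: norm_ee)
    have "norm (F \<tau>) \<le> exp (K * Im \<tau>) * B" unfolding F[OF H] norm_mult
      by (intro mult_mono 1 2) auto
    also have "\<dots> \<le> exp (K * Im \<tau>) * K" by (intro mult_left_mono) (auto simp: K_def)
    finally show "norm (F \<tau>) \<le> K * exp (K * Im \<tau>)" by (simp add: mult.commute)
  qed
qed

text \<open>By the parallelogram identity the matrix with rows (1, 1) and (1, -1) is sqrt 2 times a
  unitary one, so only the modulus of the automorphy factor remains.\<close>

lemma vvf_norm_S:
  assumes "vvf t F G" and t: "\<tau> \<in> upper_half"
  shows "(norm (F (- 1 / \<tau>)))\<^sup>2 + (norm (G (- 1 / \<tau>)))\<^sup>2 = norm \<tau> powi (2 * t + 1) * ((norm (F \<tau>))\<^sup>2 + (norm (G \<tau>))\<^sup>2)"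
proof -
  define C where "C = cS t * sfac \<tau> powi (2 * t + 1)"
  have E: "F (- 1 / \<tau>) = C * (F \<tau> + G \<tau>)" "G (- 1 / \<tau>) = C * (F \<tau> - G \<tau>)"
    using assms unfolding vvf_def C_def by auto
  have C: "(norm C)\<^sup>2 = norm \<tau> powi (2 * t + 1) / 2" unfolding C_def by (rule norm_vv_factor_sq[OF t])
  have "(norm (F \<tau> + G \<tau>))\<^sup>2 + (norm (F \<tau> - G \<tau>))\<^sup>2 = 2 * ((norm (F \<tau>))\<^sup>2 + (norm (G \<tau>))\<^sup>2)"
    unfolding cmod_power2 by (simp add: power2_eq_square algebra_simps)
  then have "(norm C)\<^sup>2 * ((norm (F \<tau> + G \<tau>))\<^sup>2 + (norm (F \<tau> - G \<tau>))\<^sup>2) =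
      norm \<tau> powi (2 * t + 1) * ((norm (F \<tau>))\<^sup>2 + (norm (G \<tau>))\<^sup>2)" unfolding C by simp
  then show ?thesis unfolding E norm_mult power_mult_distrib by (simp add: distrib_left)
qed

text \<open>Hermite normal form: diag(4, 1) times an element of SL(2,Z) is an element of SL(2,Z)
  times an upper triangular matrix with diagonal g, D and g D = 4. It moves the 4 in F (4 z) + G (4
  z) to the right of the group element, so growth at every cusp reduces to growth at
  infinity.\<close>

lemma hecke_decomposition:
  assumes det: "a * d - b * c = (1::int)" and t: "\<tau> \<in> upper_half"
  obtains \<tau>' g A y C x where "A * x - y * C = (1::int)" "moeb A y C x \<tau>' = 4 * moeb a b c d \<tau>"
    "Im \<tau>' = (real g)\<^sup>2 / 4 * Im \<tau>" "1 \<le> g" "g \<le> 4"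
proof -
  define g where "g = gcd (4 * a) c"
  obtain x y where xy: "x * (4 * a) + y * c = g" using bezout_int[of "4 * a" c] unfolding g_def by blast
  have g0: "g > 0"
  proof -
    have "4 * a \<noteq> 0 \<or> c \<noteq> 0" using det by auto
    then show ?thesis unfolding g_def by (simp add: gcd_pos_int)
  qed
  obtain A where A: "4 * a = g * A" unfolding g_def using gcd_dvd1 by blast
  obtain C where C: "c = g * C" unfolding g_def using gcd_dvd2 by blast
  have "g * (x * A + y * C) = x * (g * A) + y * (g * C)" by (simp add: algebra_simps)
  also have "\<dots> = g * 1" using xy unfolding A[symmetric] C[symmetric] by simp
  finally have "g * (x * A + y * C) = g * 1" .
  then have one: "x * A + y * C = 1" using g0 by (metis mult_left_cancel less_irrefl)
  define B where "B = 4 * b * x + d * y"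
  define D where "D = A * d - 4 * b * C"
  have gD: "g * D = 4"
  proof -
    have "g * D = (g * A) * d - 4 * b * (g * C)" by (simp add: D_def algebra_simps)
    also have "\<dots> = 4 * (a * d - b * c)" unfolding A[symmetric] C[symmetric] by (simp add: algebra_simps)
    finally show ?thesis using det by simp
  qed
  have D0: "D > 0" using gD g0 by (metis zero_less_mult_pos zero_less_numeral)
  have g4: "g \<le> 4" using gD g0 D0 by (metis mult_le_cancel_left_pos mult.right_neutral int_one_le_iff_zero_less)
  define \<tau>' where "\<tau>' = (of_int g * \<tau> + of_int B) / of_int D"
  have detA: "A * x - (- y) * C = 1" using one by (simp add: algebra_simps)
  have "moeb A (- y) C x \<tau>' = 4 * moeb a b c d \<tau>"
  proof -
    have Dn: "complex_of_int D \<noteq> 0" using D0 by simp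
    have i1: "A * g = 4 * a" "C * g = c" using A C by (auto simp: mult.commute)
    have i2: "A * B - y * D = 4 * b"
    proof -
      have "A * B - y * D = 4 * b * (x * A + y * C)" by (simp add: B_def D_def algebra_simps)
      then show ?thesis using one by simp
    qed
    have i3: "C * B + x * D = d"
    proof -
      have "C * B + x * D = d * (x * A + y * C)" by (simp add: B_def D_def algebra_simps)
      then show ?thesis using one by simp
    qed
    have "of_int A * \<tau>' + of_int (- y) = (of_int (A * g) * \<tau> + of_int (A * B - y * D)) / of_int D"
      using Dn by (simp add: \<tau>'_def field_simps)
    moreover have "of_int C * \<tau>' + of_int x = (of_int (C * g) * \<tau> + of_int (C * B + x * D)) / of_int D"
      using Dn by (simp add: \<tau>'_def field_simps)
    ultimately show ?thesis unfolding moeb_def i1 i2 i3 using Dn by (simp add: distrib_left mult.assoc)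
  qed
  moreover have "Im \<tau>' = (real (nat g))\<^sup>2 / 4 * Im \<tau>"
  proof -
    have rg: "real_of_int g * real_of_int D = 4" using gD by (metis of_int_mult of_int_numeral)
    have "\<tau>' = of_real (real_of_int g / real_of_int D) * \<tau> + of_real (real_of_int B / real_of_int D)"
      by (simp add: \<tau>'_def add_divide_distrib)
    then have "Im \<tau>' = real_of_int g / real_of_int D * Im \<tau>"
      by (simp only: Im_complex_of_real plus_complex.simps times_complex.simps Re_complex_of_real)
    moreover have "real_of_int g / real_of_int D = (real_of_int g)\<^sup>2 / 4"
      using rg D0 by (simp add: field_simps power2_eq_square)
    moreover have "real (nat g) = real_of_int g" using g0 by simp
    ultimately show ?thesis by simp
  qed
  ultimately show ?thesis using that[OF detA, of \<tau>' "nat g"] g0 g4 by simp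
qed

text \<open>With f z = F (4 z) + G (4 z), invariance of f / theta^(2t+1) need only be checked on two
  generators of Gamma0(4). The growth condition follows because (|F|^2 + |G|^2) (Im \<tau>)^(t +
  1/2) is invariant under the full modular group.\<close>

theorem vv_imp_wh_plus:
  assumes vv: "vv t \<alpha> \<beta>"
  obtains f a where "wh_plus t f" "has_qexp f a" "\<And>n. a (4 * n) = \<alpha> n" "\<And>n. a (4 * n + sgnpow t) = \<beta> n"
    "\<And>n. \<not> plus_index t n \<Longrightarrow> a n = 0"
proof -
  obtain u where u: "\<And>n. n < u \<Longrightarrow> \<alpha> n = 0" "\<And>n. n < u \<Longrightarrow> \<beta> n = 0" using vv unfolding vv_def by blast
  obtain F G h k where FG: "h holomorphic_on ball 0 1" "k holomorphic_on ball 0 1"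
    "\<And>\<tau>. \<tau> \<in> upper_half \<Longrightarrow> F \<tau> = ee (of_int u * \<tau>) * h (ee \<tau>)"
    "\<And>\<tau>. \<tau> \<in> upper_half \<Longrightarrow> G \<tau> = ee ((of_int u + ceps t) * \<tau>) * k (ee \<tau>)"
    "vvf t F G" "has_qs 0 \<alpha> F" "has_qs (ceps t) \<beta> G"
    by (rule vv_functions[OF vv u]) blast+
  define e where "e = ee (ceps t)"
  have e2: "e * e = - 1" unfolding e_def by (rule ee_ceps_sq)
  have e0: "e \<noteq> 0" by (simp add: e_def)
  have F1: "F (\<tau> + 1) = F \<tau>" if "\<tau> \<in> upper_half" for \<tau> using qs_plus_1[OF FG(6) that] by simp
  have G1: "G (\<tau> + 1) = e * G \<tau>" if "\<tau> \<in> upper_half" for \<tau> using qs_plus_1[OF FG(7) that] by (simp add: e_def)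
  have FGholo: "F holomorphic_on upper_half" "G holomorphic_on upper_half"
    using qrep_holomorphic[OF FG(1,3)] qrep_holomorphic[OF FG(2,4)] by auto
  define f where "f = (\<lambda>z. F (4 * z) + G (4 * z))"
  define a where "a = (\<lambda>n. if n mod 4 = 0 then \<alpha> (n div 4) else if (n - sgnpow t) mod 4 = 0 then \<beta> ((n - sgnpow t) div 4) else 0)"
  have a0: "a (4 * n) = \<alpha> n" for n by (simp add: a_def)
  have a1: "a (4 * n + sgnpow t) = \<beta> n" for n
  proof -
    have "(4 * n + sgnpow t) mod 4 \<noteq> 0" using sgnpow_cases[of t] by presburger
    then show ?thesis by (simp add: a_def)
  qed
  have az: "a n = 0" if "\<not> plus_index t n" for n using that unfolding plus_index_iff a_def by auto
  have qexp: "has_qexp f a" unfolding has_qexp_ee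
  proof
    fix z assume z: "z \<in> upper_half"
    have z4: "4 * z \<in> upper_half" using z by simp
    show "((\<lambda>n. a n * ee (of_int n * z)) has_sum f z) UNIV" unfolding f_def
    proof (rule has_sum_plus_split[of t])
      show "((\<lambda>n. a (4 * n) * ee (of_int (4 * n) * z)) has_sum F (4 * z)) UNIV"
      proof -
        have k: "(of_int n + 0) * (4 * z) = of_int (4 * n) * z" for n by simp
        have "((\<lambda>n. \<alpha> n * ee ((of_int n + 0) * (4 * z))) has_sum F (4 * z)) UNIV"
          using FG(6) z4 unfolding has_qs_def by blast
        then show ?thesis unfolding a0 k .
      qed
      have k: "(of_int n + ceps t) * (4 * z) = of_int (4 * n + sgnpow t) * z" for n
        by (simp add: ceps_def algebra_simps)
      have "((\<lambda>n. \<beta> n * ee ((of_int n + ceps t) * (4 * z))) has_sum G (4 * z)) UNIV"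
        using FG(7) z4 unfolding has_qs_def by blast
      then show "((\<lambda>n. a (4 * n + sgnpow t) * ee (of_int (4 * n + sgnpow t) * z)) has_sum G (4 * z)) UNIV"
        unfolding a1 k .
    qed (simp add: az)
  qed
  have "f holomorphic_on upper_half"
  proof -
    have "(\<lambda>z. F (4 * z)) holomorphic_on upper_half" "(\<lambda>z. G (4 * z)) holomorphic_on upper_half"
      by (rule holomorphic_on_compose_gen[OF _ FGholo(1), unfolded o_def]
          holomorphic_on_compose_gen[OF _ FGholo(2), unfolded o_def]; auto intro!: holomorphic_intros)+
    then show ?thesis unfolding f_def by (intro holomorphic_intros)
  qed
  moreover have "f (moeb a b c d z) = (theta (moeb a b c d z) / theta z) powi (2 * t + 1) * f z"
    if G04: "(a, b, c, d) \<in> Gamma0_4" and z: "z \<in> upper_half" for a b c d z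
  proof -
    define \<phi> where "\<phi> = (\<lambda>z. f z / theta z powi (2 * t + 1))"
    have det: "a * d - b * c = 1" "4 dvd c" using G04 by (auto simp: Gamma0_4_def)
    have "\<phi> (moeb a b c d z) = \<phi> z"
    proof (rule Gamma0_4_invariant[OF _ _ det z])
      fix z assume z: "z \<in> upper_half"
      have H: "4 * z \<in> upper_half" "4 * z + 1 \<in> upper_half" "4 * z + 1 + 1 \<in> upper_half" "4 * z + 1 + 1 + 1 \<in> upper_half"
        by (intro upper_half_shift upper_half_scale z)+
      \<comment> \<open>In the variable 4 z the translation by 1 is applied four times, and e^4 =
        1.\<close>
      have "4 * (z + 1) = 4 * z + 1 + 1 + 1 + 1" by simp
      then have "f (z + 1) = F (4 * z) + e * (e * (e * (e * G (4 * z))))"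
        unfolding f_def using F1[OF H(1)] F1[OF H(2)] F1[OF H(3)] F1[OF H(4)] G1[OF H(1)] G1[OF H(2)] G1[OF H(3)] G1[OF H(4)]
        by metis
      also have "\<dots> = F (4 * z) + (e * e) * (e * e) * G (4 * z)" by (simp only: mult.assoc)
      finally have "f (z + 1) = f z" unfolding e2 f_def by simp
      then show "\<phi> (z + 1) = \<phi> z" using theta_plus_1[OF z] by (simp add: \<phi>_def)
      \<comment> \<open>Chosen so that -1/\<tau> - 1 = 4 z and (\<tau> + 1)/4 = z / (4 z + 1);
        \<open>theta_shifted_inversion\<close> then describes the second generator.\<close>
      define \<tau> where "\<tau> = - 1 / (4 * z + 1)"
      have t: "\<tau> \<in> upper_half" unfolding \<tau>_def by (intro upper_half_inversion H)
      have nz: "4 * z + 1 \<noteq> 0" using upper_half_nonzero[OF H(2)] .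
      have t1: "- 1 / \<tau> - 1 = 4 * z" by (simp add: \<tau>_def)
      have q: "\<tau> + 1 = 4 * z / (4 * z + 1)" using nz by (simp add: \<tau>_def field_simps)
      have "4 * z / D / 4 = z / D" for D by simp
      then have t2: "(\<tau> + 1) / 4 = z / (4 * z + 1)" unfolding q by blast
      define s S M where "s = sfac \<tau>" and "S = s powi (2 * t + 1)" and "M = (1 - \<i>) powi (2 * t + 1)"
      have th: "theta z = s * (1 - \<i>) * theta (z / (4 * z + 1))"
        using theta_shifted_inversion(1)[OF t] unfolding t1 t2 s_def by simp
      have "- 1 / \<tau> = 4 * z + 1" using t1 by (simp add: algebra_simps)
      then have FS: "F (4 * z + 1) = cS t * S * (F \<tau> + G \<tau>)" "G (4 * z + 1) = cS t * S * (F \<tau> - G \<tau>)"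
        using FG(5) t unfolding vvf_def S_def s_def by metis+
      have "e * (2 * M) = e * (M + (1 + \<i>) powi (2 * t + 1)) + e * (M - (1 + \<i>) powi (2 * t + 1))"
        by (simp add: algebra_simps)
      also have "\<dots> = 2 * (e * cS t + cS t)"
        unfolding M_def e_def cS_sum by (simp add: algebra_simps)
      finally have "2 * (e * M) = 2 * (e * cS t + cS t)" by (simp only: mult.left_commute)
      then have M: "e * M = e * cS t + cS t" unfolding mult_cancel_left by simp
      have "e * f z = e * F (4 * z + 1) + G (4 * z + 1)"
        unfolding f_def F1[OF H(1)] G1[OF H(1)] by (simp add: algebra_simps)
      also have "\<dots> = S * ((e * cS t + cS t) * F \<tau> + (e * cS t - cS t) * G \<tau>)"
        unfolding FS by (simp add: algebra_simps)
      also have "e * cS t - cS t = e * (e * cS t + cS t)"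
        unfolding distrib_left mult.assoc[symmetric] e2 by simp
      also have "S * ((e * cS t + cS t) * F \<tau> + e * (e * cS t + cS t) * G \<tau>) = e * (S * M * (F \<tau> + e * G \<tau>))"
        unfolding M[symmetric] by (simp add: algebra_simps)
      finally have "f z = S * M * (F \<tau> + e * G \<tau>)" using e0 by simp
      moreover have "4 * (x / 4) = x" for x :: complex by simp
      then have "f (z / (4 * z + 1)) = F \<tau> + e * G \<tau>"
        unfolding f_def t2[symmetric] using F1[OF t] G1[OF t] by metis
      ultimately have fz: "f z = (s * (1 - \<i>)) powi (2 * t + 1) * f (z / (4 * z + 1))"
        unfolding S_def M_def power_int_mult_distrib by simp
      have "1 - \<i> \<noteq> 0" by (auto simp: complex_eq_iff)
      then have "(s * (1 - \<i>)) powi (2 * t + 1) \<noteq> 0" using sfac_nonzero[OF t] by (simp add: s_def)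
      then show "\<phi> (z / (4 * z + 1)) = \<phi> z"
        unfolding \<phi>_def fz th power_int_mult_distrib[of "s * (1 - \<i>)"]
        by (rule mult_divide_mult_cancel_left[symmetric])
    qed
    moreover have "theta z \<noteq> 0" "theta (moeb a b c d z) \<noteq> 0"
      by (intro theta_nonzero z moeb_upper_half[OF det(1) z])+
    ultimately show ?thesis unfolding \<phi>_def by (simp add: power_int_divide_distrib field_simps)
  qed
  moreover have "\<exists>C>0. \<forall>\<tau>. Im \<tau> \<ge> 1 \<longrightarrow>
      norm (f (moeb a b c d \<tau>)) \<le> C * exp (C * Im \<tau>) * norm (of_int c * \<tau> + of_int d) powr (real_of_int t + 1/2)"
    if det: "a * d - b * c = 1" for a b c d
  proof -
    define \<kappa> where "\<kappa> = real_of_int t + 1/2"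
    define N where "N = (\<lambda>\<tau>. (norm (F \<tau>))\<^sup>2 + (norm (G \<tau>))\<^sup>2)"
    define \<Phi> where "\<Phi> = (\<lambda>\<tau>. N \<tau> * Im \<tau> powr \<kappa>)"
    have norm_e: "norm e = 1"
    proof -
      have "norm e * norm e = 1" unfolding norm_mult[symmetric] e2 by simp
      then show ?thesis by (metis norm_ge_zero abs_of_nonneg abs_square_eq_1 power2_eq_square)
    qed
    have \<Phi>T: "\<Phi> (\<tau> + 1) = \<Phi> \<tau>" if "\<tau> \<in> upper_half" for \<tau>
      unfolding \<Phi>_def N_def F1[OF that] G1[OF that] by (simp add: norm_mult norm_e)
    have \<Phi>S: "\<Phi> (- 1 / \<tau>) = \<Phi> \<tau>" if t: "\<tau> \<in> upper_half" for \<tau>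
    proof -
      have n: "norm \<tau> > 0" using upper_half_nonzero[OF t] by simp
      have "((norm \<tau>)\<^sup>2) powr \<kappa> = norm \<tau> powr (2 * \<kappa>)" using n by (simp add: powr_powr flip: powr_numeral)
      also have "2 * \<kappa> = real_of_int (2 * t + 1)" by (simp add: \<kappa>_def)
      also have "norm \<tau> powr real_of_int (2 * t + 1) = norm \<tau> powi (2 * t + 1)" using n by (intro powr_real_of_int') auto
      finally have p: "((norm \<tau>)\<^sup>2) powr \<kappa> = norm \<tau> powi (2 * t + 1)" .
      have "Im (- 1 / \<tau>) powr \<kappa> = Im \<tau> powr \<kappa> / norm \<tau> powi (2 * t + 1)"
        unfolding Im_inversion p[symmetric] by (rule powr_divide)
      moreover have "N (- 1 / \<tau>) = norm \<tau> powi (2 * t + 1) * N \<tau>"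
        unfolding N_def by (rule vvf_norm_S[OF FG(5) t])
      ultimately show ?thesis unfolding \<Phi>_def using n by simp
    qed
    obtain K1 where K1: "K1 > 0" "\<And>\<tau>. Im \<tau> \<ge> 1/4 \<Longrightarrow> norm (F \<tau>) \<le> K1 * exp (K1 * Im \<tau>)"
      using qrep_growth[OF FG(1), of F "real_of_int u"] FG(3) by auto
    have "of_int u + ceps t = of_real (real_of_int u + real_of_int (sgnpow t) / 4)" by (simp add: ceps_def)
    then obtain K2 where K2: "K2 > 0" "\<And>\<tau>. Im \<tau> \<ge> 1/4 \<Longrightarrow> norm (G \<tau>) \<le> K2 * exp (K2 * Im \<tau>)"
      using qrep_growth[OF FG(2), of G "real_of_int u + real_of_int (sgnpow t) / 4"] FG(4) by metis
    define K where "K = K1 + K2"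
    have K: "K > 0" using K1 K2 by (simp add: K_def)
    have NK: "N \<tau> \<le> 2 * (K * exp (K * Im \<tau>))\<^sup>2" if t: "Im \<tau> \<ge> 1/4" for \<tau>
    proof -
      have "K1 * exp (K1 * Im \<tau>) \<le> K * exp (K * Im \<tau>)" "K2 * exp (K2 * Im \<tau>) \<le> K * exp (K * Im \<tau>)"
        using K1(1) K2(1) t by (auto intro!: mult_mono simp: K_def)
      then have "norm (F \<tau>) \<le> K * exp (K * Im \<tau>)" "norm (G \<tau>) \<le> K * exp (K * Im \<tau>)"
        using K1(2)[OF t] K2(2)[OF t] by linarith+
      then have "(norm (F \<tau>))\<^sup>2 \<le> (K * exp (K * Im \<tau>))\<^sup>2" "(norm (G \<tau>))\<^sup>2 \<le> (K * exp (K * Im \<tau>))\<^sup>2"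
        by (auto intro: power_mono)
      then show ?thesis by (simp add: N_def)
    qed
    \<comment> \<open>The values of (g^2/16) powr \<kappa> for g = 1, 4, 2, 3; their sum bounds each
      of them whatever the sign of \<kappa>.\<close>
    define Q where "Q = (1/16) powr \<kappa> + 1 powr \<kappa> + (1/4) powr \<kappa> + (9/16) powr \<kappa>"
    have Q: "Q > 0" unfolding Q_def by (intro add_pos_nonneg) auto
    define C where "C = 4 * K + 2 * K * sqrt Q"
    have C: "C > 0" using K Q by (simp add: C_def add_pos_pos)
    have "norm (f (moeb a b c d \<tau>)) \<le> C * exp (C * Im \<tau>) * norm (of_int c * \<tau> + of_int d) powr \<kappa>"
      if im: "Im \<tau> \<ge> 1" for \<tau>
    proof -
      have t: "\<tau> \<in> upper_half" using im by (simp add: upper_half_def)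
      define z where "z = moeb a b c d \<tau>"
      define n where "n = norm (of_int c * \<tau> + of_int d)"
      have n: "n > 0" using moeb_denom_nonzero[OF det t] by (simp add: n_def)
      obtain \<tau>' g A y C' x where h: "A * x - y * C' = (1::int)" "moeb A y C' x \<tau>' = 4 * z"
          "Im \<tau>' = (real g)\<^sup>2 / 4 * Im \<tau>" "1 \<le> g" "g \<le> 4"
        by (rule hecke_decomposition[OF det t, folded z_def])
      have g: "1 \<le> (real g)\<^sup>2" "(real g)\<^sup>2 \<le> 16"
      proof -
        show "1 \<le> (real g)\<^sup>2" using h(4) by (simp add: one_le_power)
        have "(real g)\<^sup>2 \<le> 4\<^sup>2" using h(5) by (intro power_mono) auto
        then show "(real g)\<^sup>2 \<le> 16" by simp
      qed
      have im': "Im \<tau>' \<ge> 1/4" "Im \<tau>' \<le> 4 * Im \<tau>"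
      proof -
        have "1 * 1 \<le> (real g)\<^sup>2 * Im \<tau>" using g im by (intro mult_mono) auto
        then show "Im \<tau>' \<ge> 1/4" by (simp add: h(3))
        have "(real g)\<^sup>2 * Im \<tau> \<le> 16 * Im \<tau>" using g im by (intro mult_right_mono) auto
        then show "Im \<tau>' \<le> 4 * Im \<tau>" by (simp add: h(3))
      qed
      have t': "\<tau>' \<in> upper_half" using im' by (simp add: upper_half_def)
      have "\<Phi> (4 * z) = \<Phi> \<tau>'" unfolding h(2)[symmetric] by (rule SL2_invariant[OF \<Phi>T \<Phi>S h(1) t'])
      have imz: "Im (4 * z) = 4 * Im \<tau> / n\<^sup>2" using Im_moeb[OF det, of \<tau>] by (simp add: z_def n_def)
      have imz0: "Im (4 * z) > 0" unfolding imz using im n by simp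
      have "N (4 * z) = N \<tau>' * (Im \<tau>' / Im (4 * z)) powr \<kappa>"
        using \<open>\<Phi> (4 * z) = \<Phi> \<tau>'\<close> imz0 im' unfolding \<Phi>_def by (simp add: powr_divide field_simps)
      also have "Im \<tau>' / Im (4 * z) = ((real g)\<^sup>2 / 16) * n\<^sup>2"
        unfolding imz h(3) using im n by (simp add: field_simps)
      also have "(((real g)\<^sup>2 / 16) * n\<^sup>2) powr \<kappa> = ((real g)\<^sup>2 / 16) powr \<kappa> * (n\<^sup>2) powr \<kappa>"
        by (rule powr_mult)
      also have "(n\<^sup>2) powr \<kappa> = (n powr \<kappa>)\<^sup>2"
        unfolding power2_eq_square by (rule powr_mult)
      also have "N \<tau>' * (((real g)\<^sup>2 / 16) powr \<kappa> * (n powr \<kappa>)\<^sup>2) \<le>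
          (2 * (K * exp (4 * K * Im \<tau>))\<^sup>2) * (Q * (n powr \<kappa>)\<^sup>2)"
      proof (intro mult_mono mult_nonneg_nonneg)
        have "N \<tau>' \<le> 2 * (K * exp (K * Im \<tau>'))\<^sup>2" by (rule NK[OF im'(1)])
        also have "\<dots> \<le> 2 * (K * exp (4 * K * Im \<tau>))\<^sup>2"
        proof -
          have "K * Im \<tau>' \<le> K * (4 * Im \<tau>)" using K im'(2) by (intro mult_left_mono) auto
          then have "K * exp (K * Im \<tau>') \<le> K * exp (4 * K * Im \<tau>)" using K by (simp add: mult_ac)
          then show ?thesis using K by (auto intro: power_mono)
        qed
        finally show "N \<tau>' \<le> 2 * (K * exp (4 * K * Im \<tau>))\<^sup>2" .
        have "g = 1 \<or> g = 2 \<or> g = 3 \<or> g = 4" using h(4,5) by auto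
        then show "((real g)\<^sup>2 / 16) powr \<kappa> \<le> Q" unfolding Q_def by (auto simp: add_nonneg_nonneg)
      qed (use Q in auto)
      finally have N4: "N (4 * z) \<le> 2 * (K * exp (4 * K * Im \<tau>))\<^sup>2 * (Q * (n powr \<kappa>)\<^sup>2)" .
      have "(norm (f z))\<^sup>2 \<le> (norm (F (4 * z)) + norm (G (4 * z)))\<^sup>2"
        unfolding f_def by (intro power_mono norm_triangle_ineq) simp
      also have "\<dots> \<le> 2 * N (4 * z)"
        using sum_squares_bound[of "norm (F (4 * z))" "norm (G (4 * z))"] unfolding N_def
        by (simp add: power2_eq_square algebra_simps)
      also have "\<dots> \<le> (2 * K * sqrt Q * exp (4 * K * Im \<tau>) * n powr \<kappa>)\<^sup>2"
      proof -
        have "(2 * K * sqrt Q * exp (4 * K * Im \<tau>) * n powr \<kappa>)\<^sup>2 = 2 * (2 * (K * exp (4 * K * Im \<tau>))\<^sup>2 * (Q * (n powr \<kappa>)\<^sup>2))"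
          using Q by (simp add: power_mult_distrib)
        then show ?thesis using N4 by linarith
      qed
      finally have "norm (f z) \<le> 2 * K * sqrt Q * exp (4 * K * Im \<tau>) * n powr \<kappa>"
        by (rule power2_le_imp_le) (use K Q in auto)
      also have "\<dots> \<le> C * exp (C * Im \<tau>) * n powr \<kappa>"
      proof -
        have "4 * K * Im \<tau> \<le> C * Im \<tau>" using K Q im by (intro mult_right_mono) (auto simp: C_def)
        then have "2 * K * sqrt Q * exp (4 * K * Im \<tau>) \<le> C * exp (C * Im \<tau>)"
          using K Q by (intro mult_mono) (auto simp: C_def)
        then show ?thesis by (intro mult_right_mono) auto
      qed
      finally show ?thesis by (simp add: z_def n_def)
    qed
    then show ?thesis using C unfolding \<kappa>_def by blast
  qed
  ultimately have "wh_plus t f" unfolding wh_plus_def using qexp az by blast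
  then show thesis using that qexp a0 a1 az by blast
qed

section \<open>The canonical basis\<close>

text \<open>The plus space seen through coefficients. For sequences with finite principal part this
  amounts to being the expansion of some \<open>wh_plus\<close> form: see
  \<open>plus_coeffs_of_wh_plus\<close> and \<open>plus_coeffs_wh_plus\<close>.\<close>

definition plus_coeffs :: "int \<Rightarrow> (int \<Rightarrow> complex) \<Rightarrow> bool" where
  "plus_coeffs t a \<longleftrightarrow> vv t (\<lambda>n. a (4 * n)) (\<lambda>n. a (4 * n + sgnpow t)) \<and> (\<forall>n. \<not> plus_index t n \<longrightarrow> a n = 0)"

lemma plus_coeffs_diff_sum:
  assumes "plus_coeffs t a" "finite I" "\<And>i. i \<in> I \<Longrightarrow> plus_coeffs t (b i)"
  shows "plus_coeffs t (\<lambda>n. a n - (\<Sum>i\<in>I. c i * b i n))"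
proof -
  have "vv t (\<lambda>n. \<Sum>i\<in>I. c i * b i (4 * n)) (\<lambda>n. \<Sum>i\<in>I. c i * b i (4 * n + sgnpow t))"
    using assms by (intro vv_sum[of I t "\<lambda>i n. b i (4 * n)" "\<lambda>i n. b i (4 * n + sgnpow t)"]) (auto simp: plus_coeffs_def)
  from vv_lin[OF _ this, of "\<lambda>n. a (4 * n)" "\<lambda>n. a (4 * n + sgnpow t)" 1 "- 1"] assms
  show ?thesis unfolding plus_coeffs_def by simp
qed

lemma plus_coeffs_diff:
  assumes "plus_coeffs t a" "plus_coeffs t b"
  shows "plus_coeffs t (\<lambda>n. a n - b n)"
  using plus_coeffs_diff_sum[of t a "{()}" "\<lambda>_. b" "\<lambda>_. 1"] assms by simp

lemma plus_coeffs_of_wh_plus: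
  assumes "wh_plus t f" "has_qexp f a" "\<And>n. \<not> plus_index t n \<Longrightarrow> a n = 0" "\<And>n. n < n\<^sub>0 \<Longrightarrow> a n = 0"
  shows "plus_coeffs t a"
  using wh_plus_imp_vv[OF assms] assms(3) by (simp add: plus_coeffs_def)

lemma plus_coeffs_wh_plus:
  assumes "plus_coeffs t a"
  shows "\<exists>f. wh_plus t f \<and> has_qexp f a"
proof -
  obtain f a' where f: "wh_plus t f" "has_qexp f a'" "\<And>n. a' (4 * n) = a (4 * n)"
      "\<And>n. a' (4 * n + sgnpow t) = a (4 * n + sgnpow t)" "\<And>n. \<not> plus_index t n \<Longrightarrow> a' n = 0"
    using vv_imp_wh_plus[of t "\<lambda>n. a (4 * n)" "\<lambda>n. a (4 * n + sgnpow t)"] assms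
    unfolding plus_coeffs_def by metis
  have "a' n = a n" for n
  proof (cases "plus_index t n")
    case True
    then show ?thesis using plus_index_range[OF True] f(3,4) by auto
  next
    case False
    then show ?thesis using f(5) assms unfolding plus_coeffs_def by simp
  qed
  then have "a' = a" by (rule ext)
  then show ?thesis using f by blast
qed

lemma plus_coeffs_of_vv:
  assumes "vv t \<alpha> \<beta>"
  obtains a where "plus_coeffs t a" "\<And>n. a (4 * n) = \<alpha> n" "\<And>n. a (4 * n + sgnpow t) = \<beta> n"
proof -
  obtain f a where "\<And>n. a (4 * n) = \<alpha> n" "\<And>n. a (4 * n + sgnpow t) = \<beta> n" "\<And>n. \<not> plus_index t n \<Longrightarrow> a n = 0"
    using vv_imp_wh_plus[OF assms] by metis
  then show ?thesis using that[of a] assms by (simp add: plus_coeffs_def)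
qed

text \<open>The orders of vanishing prescribed by \<open>n > Nk t\<close> for the two components exceed the bound of
  \<open>vv_eq_zero\<close> by exactly one.\<close>

lemma Nk_lam: "Nk t div 4 + (Nk t - sgnpow t) div 4 + 1 = lam t"
proof (cases "even (ell t)")
  case True
  then obtain j where "ell t = 2 * j" by (elim evenE)
  then show ?thesis unfolding Nk_def lam_def sgnpow_def by (cases "even t"; simp; presburger)
next
  case False
  then obtain j where "ell t = 2 * j + 1" by (elim oddE)
  then show ?thesis unfolding Nk_def lam_def sgnpow_def by (cases "even t"; simp; presburger)
qed

text \<open>By \<open>Nk_lam\<close>, vanishing up to \<open>Nk t\<close> forces a total order of at
  least \<open>lam t\<close> + 1. This is what makes the canonical basis unique.\<close>

lemma plus_coeffs_eq_zero:
  assumes a: "plus_coeffs t a" and z: "\<And>n. n \<le> Nk t \<Longrightarrow> a n = 0"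
  shows "a = (\<lambda>_. 0)"
proof -
  have 0: "ord_ge (\<lambda>n. a (4 * n)) (Nk t div 4 + 1)" unfolding ord_ge_def using z by auto
  have 1: "ord_ge (\<lambda>n. a (4 * n + sgnpow t)) ((Nk t - sgnpow t) div 4 + 1)" unfolding ord_ge_def using z by auto
  have s: "Nk t div 4 + 1 + ((Nk t - sgnpow t) div 4 + 1) > lam t" using Nk_lam[of t] by linarith
  have vv: "vv t (\<lambda>n. a (4 * n)) (\<lambda>n. a (4 * n + sgnpow t))" using a by (simp add: plus_coeffs_def)
  have "a n = 0" for n
  proof (cases "plus_index t n")
    case True
    then show ?thesis using plus_index_range[OF True] vv_eq_zero[OF vv 0 1 s] by auto
  next
    case False
    then show ?thesis using a by (simp add: plus_coeffs_def)
  qed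
  then show ?thesis by auto
qed

text \<open>Induction downwards from U: a form with leading index u is cleared at u + 1, ..., U by
  the normalized forms already obtained there. R is abstract so that the argument serves either
  component.\<close>

lemma triangular_elimination:
  fixes R :: "(int \<Rightarrow> complex) \<Rightarrow> (int \<Rightarrow> complex) \<Rightarrow> bool"
  assumes lin: "\<And>x y x' y' c d. R x y \<Longrightarrow> R x' y' \<Longrightarrow> R (\<lambda>n. c * x n + d * x' n) (\<lambda>n. c * y n + d * y' n)"
    and ex: "\<And>u. u \<le> U \<Longrightarrow> \<exists>x y. R x y \<and> ord_ge x u \<and> x u \<noteq> 0 \<and> (\<forall>n\<le>V. y n = 0)"
    and u: "u \<le> U"
  shows "\<exists>x y. R x y \<and> x u = 1 \<and> (\<forall>n\<le>U. n \<noteq> u \<longrightarrow> x n = 0) \<and> (\<forall>n\<le>V. y n = 0)"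
  using u
proof (induction "nat (U - u)" arbitrary: u rule: less_induct)
  case less
  obtain x y where xy: "R x y" "ord_ge x u" "x u \<noteq> 0" "\<And>n. n \<le> V \<Longrightarrow> y n = 0" using ex[OF less(2)] by blast
  \<comment> \<open>Here k counts the positions after u that are already cleared.\<close>
  have "\<exists>x y. R x y \<and> ord_ge x u \<and> x u = 1 \<and> (\<forall>n. u < n \<and> n \<le> u + int k \<and> n \<le> U \<longrightarrow> x n = 0) \<and> (\<forall>n\<le>V. y n = 0)" for k
  proof (induction k)
    case 0
    have "R (\<lambda>n. (1 / x u) * x n + 0 * x n) (\<lambda>n. (1 / x u) * y n + 0 * y n)" by (rule lin[OF xy(1) xy(1)])
    then show ?case using xy
      by (intro exI[of _ "\<lambda>n. (1 / x u) * x n + 0 * x n"] exI[of _ "\<lambda>n. (1 / x u) * y n + 0 * y n"])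
         (auto simp: ord_ge_def)
  next
    case (Suc k)
    then obtain x y where xy: "R x y" "ord_ge x u" "x u = 1" "\<And>n. u < n \<Longrightarrow> n \<le> u + int k \<Longrightarrow> n \<le> U \<Longrightarrow> x n = 0"
      "\<And>n. n \<le> V \<Longrightarrow> y n = 0" by blast
    define w where "w = u + int (Suc k)"
    show ?case
    proof (cases "w \<le> U")
      case False
      then show ?thesis using xy by (intro exI[of _ x] exI[of _ y]) (auto simp: w_def)
    next
      case True
      then obtain p q where pq: "R p q" "p w = 1" "\<And>n. n \<le> U \<Longrightarrow> n \<noteq> w \<Longrightarrow> p n = 0" "\<And>n. n \<le> V \<Longrightarrow> q n = 0"
        using less(1)[of w] by (auto simp: w_def)
      define x' where "x' = (\<lambda>n. 1 * x n + (- x w) * p n)"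
      define y' where "y' = (\<lambda>n. 1 * y n + (- x w) * q n)"
      have "R x' y'" unfolding x'_def y'_def by (rule lin[OF xy(1) pq(1)])
      moreover have "ord_ge x' u" using xy(2) pq(3) less(2) by (auto simp: ord_ge_def x'_def w_def)
      moreover have "x' u = 1" using xy(3) pq(3)[of u] less(2) by (simp add: x'_def w_def)
      moreover have "x' n = 0" if "u < n" "n \<le> u + int (Suc k)" "n \<le> U" for n
      proof (cases "n = w")
        case True
        then show ?thesis by (simp add: x'_def pq(2))
      next
        case False
        then show ?thesis using that xy(4)[of n] pq(3)[of n] by (simp add: x'_def w_def)
      qed
      moreover have "y' n = 0" if "n \<le> V" for n using that xy(5) pq(4) by (simp add: y'_def)
      ultimately show ?thesis by blast
    qed
  qed
  from this[of "nat (U - u)"] obtain x y where f: "R x y" "ord_ge x u" "x u = 1"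
      "\<And>n. u < n \<Longrightarrow> n \<le> u + int (nat (U - u)) \<Longrightarrow> n \<le> U \<Longrightarrow> x n = 0" "\<forall>n\<le>V. y n = 0" by blast
  have "x n = 0" if "n \<le> U" "n \<noteq> u" for n
    using that f(2) f(4)[of n] by (cases "n < u") (auto simp: ord_ge_def)
  then show ?case using f by blast
qed

lemma admissible_iff: "admissible t i \<longleftrightarrow> - i \<le> Nk t \<and> plus_index t (- i)"
proof -
  have "sgnpow (t - 1) * i = sgnpow t * (- i)" by (simp add: sgnpow_def)
  then show ?thesis unfolding admissible_def plus_index_def by auto
qed

text \<open>As U + V + 1 = \<open>lam t\<close>, a tight form of order w \<le> U in the first
  component has order at least V + 1 in the second, and symmetrically. The other component is thus
  already clean, and elimination in one component is enough.\<close>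

lemma canonical_exists:
  assumes "admissible t i"
  shows "\<exists>a. plus_coeffs t a \<and> a (- i) = 1 \<and> (\<forall>n\<le>Nk t. n \<noteq> - i \<longrightarrow> a n = 0)"
proof -
  define U where "U = Nk t div 4"
  define V where "V = (Nk t - sgnpow t) div 4"
  have UV: "U + V + 1 = lam t" unfolding U_def V_def by (rule Nk_lam)
  have e: "- i \<le> Nk t" "plus_index t (- i)" using assms unfolding admissible_iff by auto
  have "- i \<in> range (\<lambda>k. 4 * k) \<union> range (\<lambda>k. 4 * k + sgnpow t)" by (rule plus_index_range[OF e(2)])
  then consider u where "- i = 4 * u" | v where "- i = 4 * v + sgnpow t" by auto
  then obtain \<alpha> \<beta> where ab: "vv t \<alpha> \<beta>"
    "\<And>n. n \<le> U \<Longrightarrow> \<alpha> n = (if 4 * n = - i then 1 else 0)"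
    "\<And>n. n \<le> V \<Longrightarrow> \<beta> n = (if 4 * n + sgnpow t = - i then 1 else 0)"
  proof cases
    case 1
    have "u \<le> U" using e(1) 1 by (simp add: U_def)
    then have "\<exists>x y. vv t x y \<and> x u = 1 \<and> (\<forall>n\<le>U. n \<noteq> u \<longrightarrow> x n = 0) \<and> (\<forall>n\<le>V. y n = 0)"
    proof (rule triangular_elimination[where R = "vv t", rotated -1])
      show "\<exists>x y. vv t x y \<and> ord_ge x w \<and> x w \<noteq> 0 \<and> (\<forall>n\<le>V. y n = 0)" if "w \<le> U" for w
      proof -
        obtain x y where "vv t x y" "ord_ge x w" "ord_ge y (lam t - w)" "x w \<noteq> 0"
          using tight_exists[of t w] unfolding tight_def by blast
        moreover have "n < lam t - w" if "n \<le> V" for n using that \<open>w \<le> U\<close> UV by linarith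
        ultimately show ?thesis unfolding ord_ge_def by blast
      qed
    qed (rule vv_lin)
    then obtain x y where xy: "vv t x y" "x u = 1" "\<And>n. n \<le> U \<Longrightarrow> n \<noteq> u \<Longrightarrow> x n = 0" "\<And>n. n \<le> V \<Longrightarrow> y n = 0" by blast
    have "4 * n + sgnpow t \<noteq> - i" for n unfolding 1 using sgnpow_cases[of t] by presburger
    then show ?thesis using xy 1 by (intro that[of x y]) auto
  next
    case 2
    have "v \<le> V" using e(1) 2 by (simp add: V_def)
    then have "\<exists>y x. vv t x y \<and> y v = 1 \<and> (\<forall>n\<le>V. n \<noteq> v \<longrightarrow> y n = 0) \<and> (\<forall>n\<le>U. x n = 0)"
    proof (rule triangular_elimination[where R = "\<lambda>y x. vv t x y", rotated -1])
      show "\<exists>y x. vv t x y \<and> ord_ge y w \<and> y w \<noteq> 0 \<and> (\<forall>n\<le>U. x n = 0)" if "w \<le> V" for w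
      proof -
        have "lam t - (lam t - w) = w" by simp
        then obtain x y where "vv t x y" "ord_ge x (lam t - w)" "ord_ge y w" "y w \<noteq> 0"
          using tight_exists[of t "lam t - w"] unfolding tight_def by metis
        moreover have "n < lam t - w" if "n \<le> U" for n using that \<open>w \<le> V\<close> UV by linarith
        ultimately show ?thesis unfolding ord_ge_def by blast
      qed
    qed (rule vv_lin)
    then obtain x y where xy: "vv t x y" "y v = 1" "\<And>n. n \<le> V \<Longrightarrow> n \<noteq> v \<Longrightarrow> y n = 0" "\<And>n. n \<le> U \<Longrightarrow> x n = 0" by blast
    have "4 * n \<noteq> - i" for n unfolding 2 using sgnpow_cases[of t] by presburger
    then show ?thesis using xy 2 by (intro that[of x y]) auto
  qed
  obtain a where a: "plus_coeffs t a" "\<And>n. a (4 * n) = \<alpha> n" "\<And>n. a (4 * n + sgnpow t) = \<beta> n"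
    using plus_coeffs_of_vv[OF ab(1)] by blast
  have an: "a n = (if n = - i then 1 else 0)" if n: "n \<le> Nk t" for n
  proof (cases "plus_index t n")
    case True
    then consider k where "n = 4 * k" | k where "n = 4 * k + sgnpow t" using plus_index_range[OF True] by auto
    then show ?thesis
    proof cases
      case 1
      then have "k \<le> U" using n by (simp add: U_def)
      then show ?thesis using a(2)[of k] ab(2)[of k] 1 by simp
    next
      case 2
      then have "k \<le> V" using n by (simp add: V_def)
      then show ?thesis using a(3)[of k] ab(3)[of k] 2 by simp
    qed
  next
    case False
    then show ?thesis using a(1) e(2) unfolding plus_coeffs_def by auto
  qed
  show ?thesis using a(1) an e(1) by (intro exI[of _ a]) auto
qed

text \<open>Existence by \<open>canonical_exists\<close> and uniqueness by
  \<open>plus_coeffs_eq_zero\<close> make the definite description proper, so its defining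
  properties may be used.\<close>

lemma canon_coeff:
  assumes i: "admissible t i"
  shows "plus_coeffs t (canon_coeff t i)" "canon_coeff t i (- i) = 1"
    "\<And>n. n \<le> Nk t \<Longrightarrow> n \<noteq> - i \<Longrightarrow> canon_coeff t i n = 0"
proof -
  define Q where "Q = (\<lambda>a. a (- i) = 1 \<and> (\<forall>n. n \<noteq> - i \<and> n \<le> Nk t \<longrightarrow> a n = 0) \<and>
       (\<forall>n. \<not> plus_index t n \<longrightarrow> a n = 0) \<and> (\<exists>f. wh_plus t f \<and> has_qexp f a))"
  have le: "- i \<le> Nk t" using i unfolding admissible_iff by simp
  have pc: "plus_coeffs t a" if Qa: "Q a" for a
  proof -
    obtain f where f: "wh_plus t f" "has_qexp f a" using Qa unfolding Q_def by blast
    \<comment> \<open>The cut-off -i bounds the principal part: since -i \<le> \<open>Nk t\<close>,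
      all indices below -i fall under the vanishing condition of Q.\<close>
    show ?thesis by (rule plus_coeffs_of_wh_plus[OF f, of "- i"]) (use Qa le in \<open>auto simp: Q_def\<close>)
  qed
  obtain a where a: "plus_coeffs t a" "a (- i) = 1" "\<forall>n\<le>Nk t. n \<noteq> - i \<longrightarrow> a n = 0"
    using canonical_exists[OF i] by blast
  have "\<exists>!a. Q a"
  proof (rule ex1I[of _ a])
    show "Q a" unfolding Q_def using a plus_coeffs_wh_plus[OF a(1)] by (auto simp: plus_coeffs_def)
    fix b assume b: "Q b"
    have "(\<lambda>n. b n - a n) = (\<lambda>_. 0)"
      by (rule plus_coeffs_eq_zero[OF plus_coeffs_diff[OF pc[OF b] a(1)]])
         (use a b in \<open>auto simp: Q_def\<close>, metis)
    then show "b = a" by (metis eq_iff_diff_eq_0 ext)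
  qed
  then have "Q (THE a. Q a)" by (rule theI')
  then have "Q (canon_coeff t i)" unfolding canon_coeff_def Q_def .
  then show "plus_coeffs t (canon_coeff t i)" "canon_coeff t i (- i) = 1"
    "\<And>n. n \<le> Nk t \<Longrightarrow> n \<noteq> - i \<Longrightarrow> canon_coeff t i n = 0"
    using pc by (auto simp: Q_def)
qed

text \<open>Subtracting the basis elements with weights a (-i) leaves a form vanishing up to
  \<open>Nk t\<close>, hence zero. So a is a combination of the listed elements, and one of them
  must contribute at m.\<close>

lemma canon_coeff_nonzero:
  assumes a: "plus_coeffs t a" and m: "a m \<noteq> 0"
    and supp: "\<And>n. n \<le> Nk t \<Longrightarrow> a n \<noteq> 0 \<Longrightarrow> (- n) mod 4 \<noteq> m mod 4 \<and> - n \<le> L"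
  shows "\<exists>i. admissible t i \<and> i mod 4 \<noteq> m mod 4 \<and> i \<le> L \<and> canon_coeff t i m \<noteq> 0"
proof -
  define I where "I = {i. admissible t i \<and> i mod 4 \<noteq> m mod 4 \<and> i \<le> L}"
  have "I \<subseteq> {- Nk t..L}" unfolding I_def admissible_iff by auto
  then have fin: "finite I" using finite_subset by blast
  define b where "b = (\<lambda>n. a n - (\<Sum>i\<in>I. a (- i) * canon_coeff t i n))"
  have adm: "admissible t i" if "i \<in> I" for i using that by (simp add: I_def)
  have "b = (\<lambda>_. 0)"
  proof (rule plus_coeffs_eq_zero)
    show "plus_coeffs t b" unfolding b_def
      by (rule plus_coeffs_diff_sum[OF a fin canon_coeff(1)[OF adm]])
    fix n assume n: "n \<le> Nk t"
    have "(\<Sum>i\<in>I. a (- i) * canon_coeff t i n) = (\<Sum>i\<in>I. if i = - n then a n else 0)"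
    proof (rule sum.cong[OF refl])
      fix i assume "i \<in> I"
      then show "a (- i) * canon_coeff t i n = (if i = - n then a n else 0)"
        using canon_coeff(2)[OF adm[OF \<open>i \<in> I\<close>]] canon_coeff(3)[OF adm[OF \<open>i \<in> I\<close>] n] by auto
    qed
    also have "\<dots> = (if - n \<in> I then a n else 0)" using fin by simp
    also have "\<dots> = a n"
    proof (cases "a n = 0")
      case False
      then have "plus_index t n" using a unfolding plus_coeffs_def by blast
      then have "- n \<in> I" using supp[OF n False] n unfolding I_def admissible_iff by simp
      then show ?thesis by simp
    qed simp
    finally show "b n = 0" by (simp add: b_def)
  qed
  then have "b m = 0" by simp
  then have "(\<Sum>i\<in>I. a (- i) * canon_coeff t i m) \<noteq> 0" using m by (simp add: b_def)
  then obtain i where "i \<in> I" "a (- i) * canon_coeff t i m \<noteq> 0"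
    by (rule sum.not_neutral_contains_not_neutral)
  then show ?thesis unfolding I_def by auto
qed

section \<open>Counting indices and the conclusion\<close>

lemma card_residue_class:
  fixes lo hi r :: int
  assumes "lo \<le> hi"
  shows "int (card {j\<in>{lo..<hi}. j mod 4 = r}) \<le> hi div 4 - lo div 4 + 1"
proof -
  have "inj_on (\<lambda>j. j div 4) {j\<in>{lo..<hi}. j mod 4 = r}"
    by (rule inj_onI) (metis (mono_tags, lifting) mem_Collect_eq div_mult_mod_eq)
  then have "card {j\<in>{lo..<hi}. j mod 4 = r} \<le> card {lo div 4..hi div 4}"
    by (rule card_inj_on_le) (auto intro: zdiv_mono1)
  then show ?thesis using assms zdiv_mono1[of lo hi 4] by (simp add: nat_le_iff)
qed

text \<open>Admissible indices fill two classes modulo 4, about half of the integers from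
  -\<open>Nk t\<close> to i - 1; the 7 absorbs the rounding at both ends and the extra element in
  each class.\<close>

lemma card_admissible:
  assumes "- Nk t \<le> i"
  shows "2 * int (card {j. admissible t j \<and> P j \<and> j < i}) \<le> i + Nk t + 7"
proof -
  have residue: "j mod 4 = 0 \<or> j mod 4 = (- e) mod 4" if "(- j) mod 4 = 0 \<or> (- j - e) mod 4 = 0" for j e :: int
    using that by presburger
  have cls: "j mod 4 = 0 \<or> j mod 4 = (- sgnpow t) mod 4" if "admissible t j" for j
    by (rule residue) (use that in \<open>simp only: admissible_iff plus_index_iff\<close>)
  have sub: "{j. admissible t j \<and> P j \<and> j < i} \<subseteq>
      {j\<in>{- Nk t..<i}. j mod 4 = 0} \<union> {j\<in>{- Nk t..<i}. j mod 4 = (- sgnpow t) mod 4}"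
  proof
    fix j assume j: "j \<in> {j. admissible t j \<and> P j \<and> j < i}"
    then have "j \<in> {- Nk t..<i}" unfolding admissible_iff by auto
    then show "j \<in> {j\<in>{- Nk t..<i}. j mod 4 = 0} \<union> {j\<in>{- Nk t..<i}. j mod 4 = (- sgnpow t) mod 4}"
      using cls[of j] j by blast
  qed
  have "int (card {j. admissible t j \<and> P j \<and> j < i}) \<le>
      int (card {j\<in>{- Nk t..<i}. j mod 4 = 0} + card {j\<in>{- Nk t..<i}. j mod 4 = (- sgnpow t) mod 4})"
    unfolding zle_int by (rule le_trans[OF card_mono[OF _ sub] card_Un_le])
      (intro finite_UnI; rule finite_subset[of _ "{- Nk t..<i}"]; auto)
  also have "\<dots> \<le> 2 * (i div 4 - (- Nk t) div 4 + 1)"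
    using card_residue_class[OF assms, of 0] card_residue_class[OF assms, of "(- sgnpow t) mod 4"] by simp
  finally have "2 * int (card {j. admissible t j \<and> P j \<and> j < i}) \<le> 4 * (i div 4) - 4 * ((- Nk t) div 4) + 4"
    by simp
  moreover have "4 * (x div 4) \<le> x" "x - 3 \<le> 4 * (x div 4)" for x :: int by presburger+
  ultimately show ?thesis by (smt (verit))
qed

text \<open>The difference t - 6 \<open>ell t\<close> takes the values 0, 2, 3, 4, 5, 7.\<close>

lemma ell_bounds: "6 * ell t \<le> t" "t \<le> 6 * ell t + 7"
  unfolding ell_def by presburger+

lemma Nk_le: "Nk t \<le> 2 * ell t + 1"
  unfolding Nk_def using sgnpow_cases[of t] by auto

text \<open>Applied to the tight form with leading exponent m: as m > \<open>Nk t\<close>, its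
  nonzero coefficients up to \<open>Nk t\<close> all lie in the other class, where the complementary
  order, with \<open>ell t\<close> \<le> \<open>lam t\<close>, yields the bound on i.\<close>

lemma canon_coeff_nonzero_bounded:
  assumes m: "m mod 4 = 0 \<or> m mod 4 = sgnpow t mod 4" and mN: "Nk t < m"
  shows "\<exists>i. admissible t i \<and> i mod 4 \<noteq> m mod 4 \<and> i \<le> m + 1 - 4 * ell t \<and> canon_coeff t i m \<noteq> 0"
proof -
  have le: "ell t \<le> lam t" by (simp add: lam_def)
  note eps = sgnpow_cases[of t]
  show ?thesis using m
  proof
    assume m0: "m mod 4 = 0"
    then obtain u where u: "m = 4 * u" by (metis mod_0_imp_dvd dvdE)
    obtain \<alpha> \<beta> where ab: "vv t \<alpha> \<beta>" "ord_ge \<alpha> u" "ord_ge \<beta> (lam t - u)" "\<alpha> u \<noteq> 0"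
      using tight_exists[of t u] unfolding tight_def by blast
    obtain a where a: "plus_coeffs t a" "\<And>n. a (4 * n) = \<alpha> n" "\<And>n. a (4 * n + sgnpow t) = \<beta> n"
      using plus_coeffs_of_vv[OF ab(1)] by blast
    show ?thesis
    proof (rule canon_coeff_nonzero[OF a(1)])
      show "a m \<noteq> 0" using a(2)[of u] ab(4) u by simp
      fix n assume n: "n \<le> Nk t" "a n \<noteq> 0"
      then have "plus_index t n" using a(1) unfolding plus_coeffs_def by blast
      then consider k where "n = 4 * k" | k where "n = 4 * k + sgnpow t" using plus_index_range by blast
      then show "(- n) mod 4 \<noteq> m mod 4 \<and> - n \<le> m + 1 - 4 * ell t"
      proof cases
        case 1
        then have "k < u" using n(1) mN u by simp
        then show ?thesis using n(2) a(2)[of k] ab(2) 1 by (simp add: ord_ge_def)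
      next
        case 2
        then have "lam t - u \<le> k" using n(2) a(3)[of k] ab(3) by (auto simp: ord_ge_def not_less[symmetric])
        then have "- n \<le> m + 1 - 4 * ell t" using le eps 2 u by auto
        moreover have "(- n) mod 4 \<noteq> 0" using 2 eps by presburger
        ultimately show ?thesis using m0 by simp
      qed
    qed
  next
    assume m1: "m mod 4 = sgnpow t mod 4"
    then have "(m - sgnpow t) mod 4 = 0" by (simp add: mod_eq_dvd_iff)
    then obtain v where "m - sgnpow t = 4 * v" by (metis mod_0_imp_dvd dvdE)
    then have v: "m = 4 * v + sgnpow t" by simp
    have "lam t - (lam t - v) = v" by simp
    then obtain \<alpha> \<beta> where ab: "vv t \<alpha> \<beta>" "ord_ge \<alpha> (lam t - v)" "ord_ge \<beta> v" "\<beta> v \<noteq> 0"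
      using tight_exists[of t "lam t - v"] unfolding tight_def by metis
    obtain a where a: "plus_coeffs t a" "\<And>n. a (4 * n) = \<alpha> n" "\<And>n. a (4 * n + sgnpow t) = \<beta> n"
      using plus_coeffs_of_vv[OF ab(1)] by blast
    show ?thesis
    proof (rule canon_coeff_nonzero[OF a(1)])
      show "a m \<noteq> 0" using a(3)[of v] ab(4) v by simp
      fix n assume n: "n \<le> Nk t" "a n \<noteq> 0"
      then have "plus_index t n" using a(1) unfolding plus_coeffs_def by blast
      then consider k where "n = 4 * k" | k where "n = 4 * k + sgnpow t" using plus_index_range by blast
      then show "(- n) mod 4 \<noteq> m mod 4 \<and> - n \<le> m + 1 - 4 * ell t"
      proof cases
        case 1
        then have "lam t - v \<le> k" using n(2) a(2)[of k] ab(2) by (auto simp: ord_ge_def not_less[symmetric])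
        then have "- n \<le> m + 1 - 4 * ell t" using le eps 1 v by auto
        moreover have "(- n) mod 4 \<noteq> m mod 4" unfolding m1 using 1 eps by auto
        ultimately show ?thesis by simp
      next
        case 2
        then have "k < v" using n(1) mN v by simp
        then show ?thesis using n(2) a(3)[of k] ab(3) 2 by (simp add: ord_ge_def)
      qed
    qed
  qed
qed

theorem theorem1p4:
  shows "\<exists>A B :: real. 0 < A \<and> A \<le> 9 \<and> 0 < B \<and> B \<le> 109 \<and>
    (\<forall>s a b m M :: int.
       s = 12 * a + b \<longrightarrow> b \<in> {6, 8, 9, 10, 11, 12, 13, 14, 15, 16, 17, 19} \<longrightarrow>
       real_of_int m \<ge> A * \<bar>real_of_int a\<bar> + B \<longrightarrow>
       (m mod 4 = 0 \<or> m mod 4 = sgnpow (s - 1) mod 4) \<longrightarrow>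
       real_of_int M > 3 * real_of_int a + 3 * real_of_int m / 4 + real_of_int b / 2 - Cconst m b \<longrightarrow>
       (\<exists>i\<in>firstM (1 - s) m M. canon_coeff (1 - s) i m \<noteq> 0))"
proof (rule exI[of _ 9], rule exI[of _ 109], intro conjI allI impI)
  \<comment> \<open>9 and 109 are the largest constants that the statement permits, hence the
    strongest lower bound on m.\<close>
  fix s a b m M :: int
  assume s: "s = 12 * a + b" and b: "b \<in> {6, 8, 9, 10, 11, 12, 13, 14, 15, 16, 17, 19}"
    and m: "real_of_int m \<ge> 9 * \<bar>real_of_int a\<bar> + 109"
    and m4: "m mod 4 = 0 \<or> m mod 4 = sgnpow (s - 1) mod 4"
    and M: "real_of_int M > 3 * real_of_int a + 3 * real_of_int m / 4 + real_of_int b / 2 - Cconst m b"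
  define t where "t = 1 - s"
  \<comment> \<open>All cases of the constant are replaced by the largest one; multiplying by 4 then
    leaves an inequality between integers.\<close>
  have "Cconst m b \<le> 7/4" by (simp add: Cconst_def)
  then have "4 * real_of_int M > 12 * real_of_int a + 3 * real_of_int m + 2 * real_of_int b - 7" using M by linarith
  then have M': "4 * M > 12 * a + 3 * m + 2 * b - 7" by linarith
  have m': "m \<ge> 9 * \<bar>a\<bar> + 109" using m by linarith
  have b': "6 \<le> b" "b \<le> 19" using b by auto
  have t: "t = 1 - 12 * a - b" by (simp add: t_def s)
  note ell = ell_bounds[of t]
  have "sgnpow (s - 1) = sgnpow t" by (simp add: sgnpow_def t_def)
  moreover have "Nk t < m" using Nk_le[of t] ell m' b' t by linarith
  ultimately obtain i where i: "admissible t i" "i mod 4 \<noteq> m mod 4" "i \<le> m + 1 - 4 * ell t" "canon_coeff t i m \<noteq> 0"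
    using canon_coeff_nonzero_bounded[of m t] m4 by auto
  have "2 * int (card {j. admissible t j \<and> j mod 4 \<noteq> m mod 4 \<and> j < i}) \<le> i + Nk t + 7"
    by (rule card_admissible) (use i(1) in \<open>auto simp: admissible_iff\<close>)
  also have "\<dots> \<le> m - 2 * ell t + 9" using i(3) Nk_le[of t] by linarith
  \<comment> \<open>Up to constants, 2 M exceeds 3m/2 + 6a + b, while the left side is at most m +
    4a + b/3. What remains is that m exceeds -4a by a constant.\<close>
  also have "\<dots> < 2 * M" using M' ell m' b' t by linarith
  finally have "i \<in> firstM t m M" unfolding firstM_def using i by simp
  then show "\<exists>i\<in>firstM (1 - s) m M. canon_coeff (1 - s) i m \<noteq> 0" using i(4) unfolding t_def by blast
qed auto

end
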